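(* Let $t_0<t_1$ be real numbers, let $\alpha>0$ and let $X$ be a Banach algebra. Then the spaces $RL^{\alpha}([t_0,t_1];X)$ and $C^{\alpha}([t_0,t_1];X)$, with pointwise multiplication of functions, are Banach algebras.
   Context: $[\alpha]$ denotes the smallest integer greater than or equal to $\alpha$. For $\gamma>0$, $J_{t_0,t}^{\gamma}f(t)=\frac{1}{\Gamma(\gamma)}\int_{t_0}^{t}(t-s)^{\gamma-1}f(s)\,ds$ (Bochner integral), $J_{t_0,t}^0f=f$. The Riemann–Liouville derivative is $D_{t_0,t}^{\alpha}f(t)=\frac{d^{[\alpha]}}{dt^{[\alpha]}}\big[J_{t_0,t}^{[\alpha]-\alpha}f(t)\big]$ in the weak sense, and the Caputo derivative is $cD_{t_0,t}^{\alpha}f(t)=D_{t_0,t}^{\alpha}\Big[f(t)-\sum_{j=0}^{[\alpha]-1}\frac{f^{(j)}(t_0)}{j!}(t-t_0)^j\Big]$. For an integer $k\ge0$, $C^k([t_0,t_1];X)$ is the classical space with norm $\sum_{j=0}^k\sup_t\|f^{(j)}(t)\|_X$. $RL^{\alpha}([t_0,t_1];X)=\{f\in C^{[\alpha]-1}([t_0,t_1];X): D_{t_0,t}^{\alpha}f\in C^0([t_0,t_1];X)\}$ with norm $\|f\|_{C^{[\alpha]-1}}+\|D_{t_0,t}^{\alpha}f\|_{C^0}$, and $C^{\alpha}([t_0,t_1];X)=\{f\in C^{[\alpha]-1}([t_0,t_1];X): cD_{t_0,t}^{\alpha}f\in C^0([t_0,t_1];X)\}$ with norm $\|f\|_{C^{[\alpha]-1}}+\|cD_{t_0,t}^{\alpha}f\|_{C^0}$;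 membership in $C^0$ means the weak derivative exists and has a continuous representative on $[t_0,t_1]$. "Banach algebra" means a Banach space closed under the (associative, bilinear) multiplication, with $\|fg\|\le K\|f\|\,\|g\|$ for some constant $K>0$ (so that the norm is submultiplicative after passing to an equivalent norm); a unit is not required. *)

theory Defs
  imports "HOL-Analysis.Analysis" "HOL-Library.Function_Algebras"
begin

section \<open>Banach algebras\<close>

text \<open>
  A Banach algebra (not necessarily unital) with carrier \<open>V\<close>, a subspace of an ambient vector
  space.  Up to isomorphism the scalar fields of class \<open>real_normed_field\<close> are exactly the reals
  and the complex numbers (Gelfand--Mazur).
\<close>

locale banach_algebra = vector_space scale
  for scale :: "'k::real_normed_field \<Rightarrow> 'b::ab_group_add \<Rightarrow> 'b" +
  fixes V :: "'b set"
    and mul :: "'b \<Rightarrow> 'b \<Rightarrow> 'b"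
    and nrm :: "'b \<Rightarrow> real"
  assumes subspace_carrier: "subspace V"
    and nrm_nonneg: "f \<in> V \<Longrightarrow> 0 \<le> nrm f"
    and nrm_eq_0_iff: "f \<in> V \<Longrightarrow> nrm f = 0 \<longleftrightarrow> f = 0"
    and nrm_triangle: "f \<in> V \<Longrightarrow> g \<in> V \<Longrightarrow> nrm (f + g) \<le> nrm f + nrm g"
    and nrm_scale: "f \<in> V \<Longrightarrow> nrm (scale c f) = norm c * nrm f"
    and complete: "(\<And>n. \<sigma> n \<in> V) \<Longrightarrow>
          (\<And>e. 0 < e \<Longrightarrow> \<exists>N. \<forall>m\<ge>N. \<forall>n\<ge>N. nrm (\<sigma> m - \<sigma> n) < e) \<Longrightarrow>
          \<exists>f\<in>V. (\<lambda>n. nrm (\<sigma> n - f)) \<longlonglongrightarrow> 0"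
    and mul_closed: "f \<in> V \<Longrightarrow> g \<in> V \<Longrightarrow> mul f g \<in> V"
    and mul_assoc: "f \<in> V \<Longrightarrow> g \<in> V \<Longrightarrow> h \<in> V \<Longrightarrow> mul (mul f g) h = mul f (mul g h)"
    and mul_add_left: "f \<in> V \<Longrightarrow> g \<in> V \<Longrightarrow> h \<in> V \<Longrightarrow> mul (f + g) h = mul f h + mul g h"
    and mul_add_right: "f \<in> V \<Longrightarrow> g \<in> V \<Longrightarrow> h \<in> V \<Longrightarrow> mul f (g + h) = mul f g + mul f h"
    and mul_scale_left: "f \<in> V \<Longrightarrow> g \<in> V \<Longrightarrow> mul (scale c f) g = scale c (mul f g)"
    and mul_scale_right: "f \<in> V \<Longrightarrow> g \<in> V \<Longrightarrow> mul f (scale c g) = scale c (mul f g)"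
    and nrm_mul: "\<exists>K>0. \<forall>f\<in>V. \<forall>g\<in>V. nrm (mul f g) \<le> K * nrm f * nrm g"

lemma banach_algebra_UNIV:
  "banach_algebra scaleR (UNIV :: 'a::{real_normed_algebra, banach} set) (*) norm"
proof
  fix \<sigma> :: "nat \<Rightarrow> 'a"
  assume "\<And>e. 0 < e \<Longrightarrow> \<exists>N. \<forall>m\<ge>N. \<forall>n\<ge>N. norm (\<sigma> m - \<sigma> n) < e"
  then have "Cauchy \<sigma>" by (simp add: Cauchy_def dist_norm)
  then obtain f where "\<sigma> \<longlonglongrightarrow> f" using Cauchy_convergent convergent_def by blast
  then show "\<exists>f\<in>UNIV. (\<lambda>n. norm (\<sigma> n - f)) \<longlonglongrightarrow> 0"
    using LIM_zero tendsto_norm_zero by blast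
next
  show "\<exists>K>0. \<forall>f\<in>UNIV. \<forall>g\<in>UNIV. norm (f * g :: 'a) \<le> K * norm f * norm g"
    by (rule exI[of _ 1]) (simp add: norm_mult_ineq)
qed (auto simp: algebra_simps norm_triangle_ineq real_vector.subspace_UNIV[unfolded subspace_raw_def])


section \<open>Bochner integral\<close>

text \<open>
  The library's \<open>has_bochner_integral\<close> and \<open>lebesgue_integral\<close> require a second countable range.
  The definitions below are the same ones without that restriction.
\<close>

definition has_Bochner :: "'m measure \<Rightarrow> ('m \<Rightarrow> 'a::banach) \<Rightarrow> 'a \<Rightarrow> bool" where
  "has_Bochner M f I \<longleftrightarrow>
     f \<in> borel_measurable M \<and>
     (\<exists>s. (\<forall>i. Bochner_Integration.simple_bochner_integrable M (s i)) \<and>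
          (\<lambda>i. \<integral>\<^sup>+x. norm (f x - s i x) \<partial>M) \<longlonglongrightarrow> 0 \<and>
          (\<lambda>i. Bochner_Integration.simple_bochner_integral M (s i)) \<longlonglongrightarrow> I)"

definition Bochner_integrable :: "'m measure \<Rightarrow> ('m \<Rightarrow> 'a::banach) \<Rightarrow> bool" where
  "Bochner_integrable M f \<longleftrightarrow> (\<exists>I. has_Bochner M f I)"

definition Bochner_integral :: "'m measure \<Rightarrow> ('m \<Rightarrow> 'a::banach) \<Rightarrow> 'a" where
  "Bochner_integral M f = (if Bochner_integrable M f then THE I. has_Bochner M f I else 0)"

lemma has_Bochner_iff_has_bochner_integral:
  fixes f :: "'m \<Rightarrow> 'a::{banach, second_countable_topology}"
  shows "has_Bochner M f I \<longleftrightarrow> has_bochner_integral M f I"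
  unfolding has_Bochner_def has_bochner_integral.simps by blast

lemma Bochner_integral_eq_lebesgue_integral:
  fixes f :: "'m \<Rightarrow> 'a::{banach, second_countable_topology}"
  shows "Bochner_integral M f = integral\<^sup>L M f"
  unfolding Bochner_integral_def Bochner_integrable_def lebesgue_integral_def
    has_Bochner_iff_has_bochner_integral ..


section \<open>Weak derivatives\<close>

definition test_function :: "real \<Rightarrow> real \<Rightarrow> (real \<Rightarrow> real) \<Rightarrow> bool" where
  "test_function a b \<phi> \<longleftrightarrow>
     (\<forall>n x. ((deriv ^^ n) \<phi>) field_differentiable (at x)) \<and>
     compact (closure {x. \<phi> x \<noteq> 0}) \<and> closure {x. \<phi> x \<noteq> 0} \<subseteq> {a<..<b}"

definition locally_Bochner_integrable :: "real \<Rightarrow> real \<Rightarrow> (real \<Rightarrow> 'a::banach) \<Rightarrow> bool" where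
  "locally_Bochner_integrable a b g \<longleftrightarrow>
     (\<forall>c d. a < c \<and> c \<le> d \<and> d < b \<longrightarrow> Bochner_integrable (lebesgue_on {c..d}) g)"

definition has_weak_deriv ::
  "nat \<Rightarrow> real \<Rightarrow> real \<Rightarrow> (real \<Rightarrow> 'a::banach) \<Rightarrow> (real \<Rightarrow> 'a) \<Rightarrow> bool" where
  "has_weak_deriv n a b g v \<longleftrightarrow>
     locally_Bochner_integrable a b g \<and> locally_Bochner_integrable a b v \<and>
     (\<forall>\<phi>. test_function a b \<phi> \<longrightarrow>
        Bochner_integral (lebesgue_on {a..b}) (\<lambda>s. (deriv ^^ n) \<phi> s *\<^sub>R g s) =
        (- 1) ^ n *\<^sub>R Bochner_integral (lebesgue_on {a..b}) (\<lambda>s. \<phi> s *\<^sub>R v s))"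


section \<open>Classically differentiable functions on a compact interval\<close>

text \<open>
  Throughout, a function on \<open>[a,b]\<close> is represented by its extension by zero to the real line, so
  that the pointwise operations and the equality of functions are those of the type
  \<open>real \<Rightarrow> 'a\<close>.  Derivatives are taken within \<open>[a,b]\<close> (one-sided at the end points).
\<close>

primrec ivl_deriv :: "real \<Rightarrow> real \<Rightarrow> nat \<Rightarrow> (real \<Rightarrow> 'a::real_normed_vector) \<Rightarrow> real \<Rightarrow> 'a" where
  "ivl_deriv a b 0 f = f"
| "ivl_deriv a b (Suc j) f = (\<lambda>t. vector_derivative (ivl_deriv a b j f) (at t within {a..b}))"

definition Ck_space :: "nat \<Rightarrow> real \<Rightarrow> real \<Rightarrow> (real \<Rightarrow> 'a::real_normed_vector) set" where
  "Ck_space k a b = {f. (\<forall>t. t \<notin> {a..b} \<longrightarrow> f t = 0) \<and>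
     (\<forall>j<k. \<forall>t\<in>{a..b}. ivl_deriv a b j f differentiable (at t within {a..b})) \<and>
     continuous_on {a..b} (ivl_deriv a b k f)}"

definition Ck_norm :: "nat \<Rightarrow> real \<Rightarrow> real \<Rightarrow> (real \<Rightarrow> 'a::real_normed_vector) \<Rightarrow> real" where
  "Ck_norm k a b f = (\<Sum>j\<le>k. SUP t\<in>{a..b}. norm (ivl_deriv a b j f t))"


section \<open>Fractional integrals and derivatives\<close>

definition frac_integral :: "real \<Rightarrow> real \<Rightarrow> (real \<Rightarrow> 'a::banach) \<Rightarrow> real \<Rightarrow> 'a" where
  "frac_integral \<gamma> a f t =
     (if \<gamma> = 0 then f t
      else (1 / Gamma \<gamma>) *\<^sub>R
             Bochner_integral (lebesgue_on {a..t}) (\<lambda>s. (t - s) powr (\<gamma> - 1) *\<^sub>R f s))"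

abbreviation ceil_nat :: "real \<Rightarrow> nat" where
  "ceil_nat \<alpha> \<equiv> nat \<lceil>\<alpha>\<rceil>"

text \<open>
  Weak derivatives are determined only almost everywhere, so the fractional derivatives are
  introduced as relations; \<open>RL_deriv\<close> and \<open>caputo_deriv\<close> pick a continuous representative,
  which is unique on \<open>[a,b]\<close> if it exists.
\<close>

definition has_RL_deriv ::
  "real \<Rightarrow> real \<Rightarrow> real \<Rightarrow> (real \<Rightarrow> 'a::banach) \<Rightarrow> (real \<Rightarrow> 'a) \<Rightarrow> bool" where
  "has_RL_deriv \<alpha> a b f v \<longleftrightarrow>
     has_weak_deriv (ceil_nat \<alpha>) a b (frac_integral (real (ceil_nat \<alpha>) - \<alpha>) a f) v"

definition taylor_poly ::
  "nat \<Rightarrow> real \<Rightarrow> real \<Rightarrow> (real \<Rightarrow> 'a::real_normed_vector) \<Rightarrow> real \<Rightarrow> 'a" where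
  "taylor_poly n a b f t = (\<Sum>j<n. ((t - a) ^ j / fact j) *\<^sub>R ivl_deriv a b j f a)"

definition has_caputo_deriv ::
  "real \<Rightarrow> real \<Rightarrow> real \<Rightarrow> (real \<Rightarrow> 'a::banach) \<Rightarrow> (real \<Rightarrow> 'a) \<Rightarrow> bool" where
  "has_caputo_deriv \<alpha> a b f v \<longleftrightarrow>
     has_RL_deriv \<alpha> a b (\<lambda>t. f t - taylor_poly (ceil_nat \<alpha>) a b f t) v"

definition RL_deriv :: "real \<Rightarrow> real \<Rightarrow> real \<Rightarrow> (real \<Rightarrow> 'a::banach) \<Rightarrow> real \<Rightarrow> 'a" where
  "RL_deriv \<alpha> a b f = (SOME v. continuous_on {a..b} v \<and> has_RL_deriv \<alpha> a b f v)"

definition caputo_deriv :: "real \<Rightarrow> real \<Rightarrow> real \<Rightarrow> (real \<Rightarrow> 'a::banach) \<Rightarrow> real \<Rightarrow> 'a" where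
  "caputo_deriv \<alpha> a b f = (SOME v. continuous_on {a..b} v \<and> has_caputo_deriv \<alpha> a b f v)"

definition RL_space :: "real \<Rightarrow> real \<Rightarrow> real \<Rightarrow> (real \<Rightarrow> 'a::banach) set" where
  "RL_space \<alpha> a b = {f \<in> Ck_space (ceil_nat \<alpha> - 1) a b.
     \<exists>v. continuous_on {a..b} v \<and> has_RL_deriv \<alpha> a b f v}"

definition RL_norm :: "real \<Rightarrow> real \<Rightarrow> real \<Rightarrow> (real \<Rightarrow> 'a::banach) \<Rightarrow> real" where
  "RL_norm \<alpha> a b f =
     Ck_norm (ceil_nat \<alpha> - 1) a b f + (SUP t\<in>{a..b}. norm (RL_deriv \<alpha> a b f t))"

definition caputo_space :: "real \<Rightarrow> real \<Rightarrow> real \<Rightarrow> (real \<Rightarrow> 'a::banach) set" where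
  "caputo_space \<alpha> a b = {f \<in> Ck_space (ceil_nat \<alpha> - 1) a b.
     \<exists>v. continuous_on {a..b} v \<and> has_caputo_deriv \<alpha> a b f v}"

definition caputo_norm :: "real \<Rightarrow> real \<Rightarrow> real \<Rightarrow> (real \<Rightarrow> 'a::banach) \<Rightarrow> real" where
  "caputo_norm \<alpha> a b f =
     Ck_norm (ceil_nat \<alpha> - 1) a b f + (SUP t\<in>{a..b}. norm (caputo_deriv \<alpha> a b f t))"

end

theory Submission
  imports Defs
begin

text \<open>
  Write \<open>k\<close> for the integer below \<open>\<alpha>\<close> with \<open>\<beta> = \<alpha> - k\<close> in \<open>(0,1]\<close>, and \<open>J\<close> for fractional
  integration.  A function of class \<open>C\<^sup>k\<close> has the continuous Caputo derivative \<open>v\<close> iff its \<open>k\<close>-th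
  derivative is a constant plus \<open>J\<^sup>\<beta> v\<close>; for the Riemann--Liouville derivative with \<open>\<beta> < 1\<close>, all
  derivatives up to order \<open>k\<close> must vanish at the left end point in addition, because
  \<open>J\<^sup>1 f = \<Sum>\<^sub>j c\<^sub>j (t - a)\<^bsup>j+\<beta>\<^esup> + J\<^bsup>\<alpha>+1\<^esup> v\<close> has \<open>k + 1\<close> continuous derivatives only if all
  \<open>c\<^sub>j\<close> are zero.  By the Leibniz rule it remains to see that \<open>J\<^sup>\<beta> u \<cdot> J\<^sup>\<beta> w = J\<^sup>\<beta> z\<close> with \<open>z\<close>
  continuous and \<open>\<parallel>z\<parallel> \<le> K \<parallel>u\<parallel> \<parallel>w\<parallel>\<close>.  For polynomials \<open>u\<close>, \<open>w\<close> with coefficients in the algebra,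
  \<open>z\<close> is explicit, and Marchaud's formula expresses it through \<open>u\<close>, \<open>w\<close> and an integral of
  \<open>(f\<^sub>t - f\<^sub>s) (g\<^sub>t - g\<^sub>s) / (t - s)\<^bsup>1+\<beta>\<^esup>\<close>, which converges absolutely since \<open>f = J\<^sup>\<beta> u\<close> and
  \<open>g = J\<^sup>\<beta> w\<close> are Hoelder continuous of exponent \<open>\<beta>\<close>.  Density of the polynomials does the rest,
  and also reduces the semigroup law of fractional integration to Beta integrals.
\<close>

section \<open>Polynomials with vector coefficients\<close>

text \<open>The values lie in an arbitrary, possibly nonseparable Banach space, where even the
  difference of two measurable functions can fail to be measurable. So the Bochner integral is
  evaluated only for a scalar weight times a continuous function, and all later work is
  Henstock-Kurzweil calculus. Polynomials serve here too: on a monomial the vector factors out and a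
  scalar integral remains. Marchaud's formula is never passed to the limit, since that would mean
  controlling singular integrals. It is verified for monomials, and only the bound it gives is kept:
  bilinearity writes a difference of two densities z as two densities of products, each with one
  small factor. The Leibniz rule hides a loss of balance: in \<open>f * g' + f' * g\<close> the
  undifferentiated factor has one derivative more than the other. Because
  \<open>J^1 = J^\<beta> J^(1-\<beta>)\<close>, the smoother class embeds in the rougher one at the
  price of a constant, and the induction on the number of derivatives closes. Both spaces share one
  argument, with a flag for vanishing initial values, a condition that products inherit.\<close>

inductive_set vec_poly :: "real \<Rightarrow> (real \<Rightarrow> 'a::real_normed_vector) set" for a where
  vec_poly_monom: "(\<lambda>t. (t - a) ^ k *\<^sub>R x) \<in> vec_poly a"
| vec_poly_add: "p \<in> vec_poly a \<Longrightarrow> q \<in> vec_poly a \<Longrightarrow> (\<lambda>t. p t + q t) \<in> vec_poly a"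

lemma vec_poly_scaleR: "p \<in> vec_poly a \<Longrightarrow> (\<lambda>t. c *\<^sub>R p t) \<in> vec_poly a"
proof (induction rule: vec_poly.induct)
  case (vec_poly_monom k x)
  show ?case using vec_poly.vec_poly_monom[of a k "c *\<^sub>R x"] by (simp add: mult.commute)
qed (auto simp: scaleR_add_right intro: vec_poly.intros)

lemma vec_poly_diff:
  assumes "p \<in> vec_poly a" "q \<in> vec_poly a"
  shows "(\<lambda>t. p t - q t) \<in> vec_poly a"
  using vec_poly_add[OF assms(1) vec_poly_scaleR[OF assms(2), of "-1"]] by simp

lemma vec_poly_sum:
  "(\<And>i. i \<in> I \<Longrightarrow> p i \<in> vec_poly a) \<Longrightarrow> (\<lambda>t. \<Sum>i\<in>I. p i t) \<in> vec_poly a"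
proof (induction I rule: infinite_finite_induct)
  case (insert i I)
  then show ?case by (auto intro!: vec_poly_add)
qed (use vec_poly_monom[of a 0 0] in simp_all)

lemma vec_poly_poly: "(\<lambda>t. poly p (t - a) *\<^sub>R x) \<in> vec_poly a"
proof -
  have "(\<lambda>t. \<Sum>i\<le>degree p. (t - a) ^ i *\<^sub>R (coeff p i *\<^sub>R x)) \<in> vec_poly a"
    by (intro vec_poly_sum vec_poly_monom)
  then show ?thesis
    by (simp add: poly_altdef scaleR_sum_left mult.commute)
qed

lemma continuous_on_vec_poly: "p \<in> vec_poly a \<Longrightarrow> continuous_on S p"
  by (induction rule: vec_poly.induct) (auto intro!: continuous_intros)

text \<open>The variance of k/n for a binomially distributed k. The square is expanded in 1, k and
  k(k - 1) because the Bernstein sums with exactly these weights have closed forms.\<close>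

lemma Bernstein_variance:
  assumes "n > 0"
  shows "(\<Sum>k\<le>n. (x - k/n)\<^sup>2 * Bernstein n k x) = x * (1 - x) / n"
proof -
  have "(\<Sum>k\<le>n. (x - k/n)\<^sup>2 * Bernstein n k x) =
      (\<Sum>k\<le>n. x\<^sup>2 * Bernstein n k x - (2 * x / n - 1 / n\<^sup>2) * (k * Bernstein n k x)
        + (1 / n\<^sup>2) * (real k * (real k - 1) * Bernstein n k x))"
  proof (intro sum.cong refl)
    fix k
    have "(x - k/n)\<^sup>2 = x\<^sup>2 - (2 * x / n - 1 / n\<^sup>2) * k + (1 / n\<^sup>2) * (real k * (real k - 1))"
      using assms by (simp add: field_simps power2_eq_square)
    then show "(x - k/n)\<^sup>2 * Bernstein n k x = x\<^sup>2 * Bernstein n k x - (2 * x / n - 1 / n\<^sup>2) * (k * Bernstein n k x)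
        + (1 / n\<^sup>2) * (real k * (real k - 1) * Bernstein n k x)"
      by (simp only: ring_distribs mult.assoc)
  qed
  also have "\<dots> = x\<^sup>2 - (2 * x / n - 1 / n\<^sup>2) * (n * x) + (1 / n\<^sup>2) * (real n * (real n - 1) * x\<^sup>2)"
    by (simp add: sum.distrib sum_subtractf flip: sum_distrib_left sum_divide_distrib)
  also have "\<dots> = x * (1 - x) / n"
    using assms by (simp add: field_simps power2_eq_square)
  finally show ?thesis .
qed

text \<open>Bernstein's proof of the Weierstrass theorem by Chebyshev's inequality. It carries over
  to vector values because the weights are nonnegative scalars with sum 1.\<close>

lemma Bernstein_approx:
  fixes g :: "real \<Rightarrow> 'a::real_normed_vector"
  assumes g: "continuous_on {0..1} g" and e: "0 < e"
  shows "\<exists>n>0. \<forall>x\<in>{0..1}. norm (g x - (\<Sum>k\<le>n. Bernstein n k x *\<^sub>R g (k/n))) < e"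
proof -
  have "bounded (g ` {0..1})"
    using g by (intro compact_imp_bounded compact_continuous_image) auto
  then obtain M where M: "M > 0" "\<And>x. x \<in> {0..1} \<Longrightarrow> norm (g x) \<le> M"
    by (auto simp: bounded_pos)
  have "uniformly_continuous_on {0..1} g"
    using g by (intro compact_uniformly_continuous) auto
  then obtain d where d: "d > 0"
    "\<And>x y. x \<in> {0..1} \<Longrightarrow> y \<in> {0..1} \<Longrightarrow> dist y x < d \<Longrightarrow> dist (g y) (g x) < e / 2"
    using e unfolding uniformly_continuous_on_def by (metis half_gt_zero)
  \<comment> \<open>The far nodes contribute at most 2M / (d^2 n), which this n pushes below e /
    2.\<close>
  obtain n :: nat where n: "real n > 4 * M / (e * d\<^sup>2)" using reals_Archimedean2 by blast
  moreover have "4 * M / (e * d\<^sup>2) > 0" using M e d by simp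
  ultimately have n0: "n > 0" by (cases n) auto
  have "norm (g x - (\<Sum>k\<le>n. Bernstein n k x *\<^sub>R g (k/n))) < e" if x: "x \<in> {0..1}" for x
  proof -
    have B: "Bernstein n k x \<ge> 0" for k using x by (auto intro: Bernstein_nonneg)
    \<comment> \<open>Uniform continuity handles nodes closer than d to x; for the others (x -
      k/n)^2 / d^2 is at least 1 and 2M is the trivial bound.\<close>
    have *: "norm (g x - g (k/n)) \<le> e/2 + 2 * M / d\<^sup>2 * (x - k/n)\<^sup>2" if "k \<le> n" for k
    proof (cases "\<bar>x - k/n\<bar> < d")
      case True
      have kn: "k/n \<in> {0..1}" using that n0 by (auto simp: field_simps)
      have "norm (g x - g (k/n)) < e/2" using d(2)[OF kn x] True by (simp add: dist_norm)
      moreover have "2 * M / d\<^sup>2 * (x - k/n)\<^sup>2 \<ge> 0" using M by simp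
      ultimately show ?thesis by linarith
    next
      case False
      have kn: "k/n \<in> {0..1}" using that n0 by (auto simp: field_simps)
      have "d\<^sup>2 \<le> (x - k/n)\<^sup>2" using False d(1) by (metis abs_le_square_iff abs_of_pos not_less)
      then have "2 * M * 1 \<le> 2 * M * ((x - k/n)\<^sup>2 / d\<^sup>2)"
        using M d by (intro mult_left_mono) (auto simp: field_simps)
      moreover have "norm (g x - g (k/n)) \<le> 2 * M"
        using norm_triangle_ineq4[of "g x" "g (k/n)"] M(2)[OF x] M(2)[OF kn] by linarith
      ultimately show ?thesis using e by simp
    qed
    have "g x - (\<Sum>k\<le>n. Bernstein n k x *\<^sub>R g (k/n)) = (\<Sum>k\<le>n. Bernstein n k x *\<^sub>R (g x - g (k/n)))"
      by (simp add: scaleR_diff_right sum_subtractf flip: scaleR_sum_left)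
    also have "norm \<dots> \<le> (\<Sum>k\<le>n. Bernstein n k x * (e/2 + 2 * M / d\<^sup>2 * (x - k/n)\<^sup>2))"
      using B * by (intro sum_norm_le) (auto intro!: mult_left_mono)
    also have "\<dots> = e/2 * (\<Sum>k\<le>n. Bernstein n k x) + 2 * M / d\<^sup>2 * (\<Sum>k\<le>n. (x - k/n)\<^sup>2 * Bernstein n k x)"
      unfolding sum_distrib_left sum.distrib[symmetric] by (intro sum.cong) (auto simp: algebra_simps)
    also have "\<dots> = e/2 + 2 * M / d\<^sup>2 * (x * (1 - x) / n)"
      by (simp add: Bernstein_variance[OF n0])
    also have "2 * M / d\<^sup>2 * (x * (1 - x) / n) \<le> 2 * M / d\<^sup>2 * (1 / n)"
      using x M n0 by (intro mult_left_mono divide_right_mono) (auto intro!: mult_le_one)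
    also have "2 * M / d\<^sup>2 * (1 / n) < e/2"
      using n n0 e d M by (simp add: field_simps)
    finally show ?thesis by simp
  qed
  then show ?thesis using n0 by blast
qed

lemma vec_poly_approx:
  fixes u :: "real \<Rightarrow> 'a::real_normed_vector"
  assumes "a \<le> b" and u: "continuous_on {a..b} u" and e: "0 < e"
  obtains p where "p \<in> vec_poly a" "\<And>t. t \<in> {a..b} \<Longrightarrow> norm (u t - p t) < e"
proof (cases "a = b")
  case True
  show ?thesis by (rule that[OF vec_poly_monom[of a 0 "u a"]]) (use True e in auto)
next
  case False
  then have ab: "a < b" using assms(1) by simp
  define g where "g x = u (a + x * (b - a))" for x
  have "a + x * (b - a) \<in> {a..b}" if "x \<in> {0..1}" for x
  proof -
    have "x * (b - a) \<le> 1 * (b - a)" "0 \<le> x * (b - a)"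
      using that ab by (auto intro!: mult_right_mono)
    then show ?thesis by (simp add: algebra_simps)
  qed
  then have "continuous_on {0..1} g"
    unfolding g_def by (intro continuous_on_compose2[OF u] continuous_intros) auto
  from Bernstein_approx[OF this e] obtain n where n: "n > 0"
    "\<And>x. x \<in> {0..1} \<Longrightarrow> norm (g x - (\<Sum>k\<le>n. Bernstein n k x *\<^sub>R g (k/n))) < e" by blast
  define c where "c = 1 / (b - a)"
  \<comment> \<open>\<open>B k\<close> is the k-th Bernstein polynomial in x = (t - a) / (b - a),
    written in the variable t - a whose powers span \<open>vec_poly a\<close>.\<close>
  define B where "B k = smult (real (n choose k)) ([:0, c:] ^ k * [:1, -c:] ^ (n - k))" for k
  define p where "p t = (\<Sum>k\<le>n. poly (B k) (t - a) *\<^sub>R g (k/n))" for t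
  show ?thesis
  proof
    show "p \<in> vec_poly a" unfolding p_def by (intro vec_poly_sum vec_poly_poly)
  next
    fix t assume t: "t \<in> {a..b}"
    define x where "x = (t - a) / (b - a)"
    have "poly (B k) (t - a) = Bernstein n k x" for k
      by (simp add: B_def c_def x_def Bernstein_def poly_power algebra_simps)
    moreover have "g x = u t" using ab by (simp add: g_def x_def)
    moreover have "x \<in> {0..1}" using t ab by (auto simp: x_def)
    ultimately show "norm (u t - p t) < e" using n(2)[of x] by (simp add: p_def)
  qed
qed

section \<open>The Bochner integral of a weighted continuous function\<close>

text \<open>The library hides these two names.\<close>

abbreviation (input) "simple_Bochner_integrable \<equiv> Bochner_Integration.simple_bochner_integrable"
abbreviation (input) "simple_Bochner_integral \<equiv> Bochner_Integration.simple_bochner_integral"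

text \<open>Without a countable base, \<open>h - s\<close> may not be measurable as a vector-valued
  map. Since \<open>s\<close> has finitely many values, the norm can be assembled from its level
  sets, on each of which only a constant is subtracted from \<open>h\<close>.\<close>

lemma borel_measurable_norm_diff_simple:
  fixes h s :: "'m \<Rightarrow> 'a::real_normed_vector"
  assumes h: "h \<in> borel_measurable M" and s: "simple_function M s"
  shows "(\<lambda>x. norm (h x - s x)) \<in> borel_measurable M"
proof -
  have "(\<lambda>x. \<Sum>y\<in>s ` space M. indicator (s -` {y} \<inter> space M) x * norm (h x - y)) \<in> borel_measurable M"
  proof (intro borel_measurable_sum borel_measurable_times)
    fix y assume "y \<in> s ` space M"
    have "s -` {y} \<inter> space M \<in> sets M"
      using s by (rule simple_functionD)
    then show "(\<lambda>x. indicator (s -` {y} \<inter> space M) x :: real) \<in> borel_measurable M"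
      by simp
    have "(\<lambda>x. (\<lambda>z. norm (z - y)) (h x)) \<in> borel_measurable M"
      by (rule borel_measurable_continuous_on[OF _ h]) (intro continuous_intros)
    then show "(\<lambda>x. norm (h x - y)) \<in> borel_measurable M" by simp
  qed
  moreover have "(\<Sum>y\<in>s ` space M. indicator (s -` {y} \<inter> space M) x * norm (h x - y)) = norm (h x - s x)"
    if "x \<in> space M" for x
  proof -
    have "(\<Sum>y\<in>s ` space M. indicator (s -` {y} \<inter> space M) x * norm (h x - y))
        = (\<Sum>y\<in>s ` space M. if s x = y then norm (h x - y) else 0)"
      using that by (intro sum.cong) (auto simp: indicator_def)
    also have "\<dots> = norm (h x - s x)"
      using that simple_functionD(1)[OF s] by (simp add: sum.delta')
    finally show ?thesis .
  qed
  ultimately show ?thesis by (simp cong: measurable_cong)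
qed

lemma simple_bochner_integrableD: "simple_Bochner_integrable M s \<Longrightarrow> simple_function M s"
  by (auto elim: simple_bochner_integrable.cases)

lemma tendsto_squeeze_zero:
  fixes f g :: "nat \<Rightarrow> ennreal"
  assumes "g \<longlonglongrightarrow> 0" "\<And>i. f i \<le> g i"
  shows "f \<longlonglongrightarrow> 0"
  by (rule tendsto_sandwich[of "\<lambda>_. 0" f sequentially g]) (use assms in auto)

text \<open>The simple integrals of two approximating sequences differ by at most the sum of both L1
  errors. Splitting that sum asks for measurable errors, which
  \<open>borel_measurable_norm_diff_simple\<close> supplies.\<close>

lemma has_Bochner_unique:
  assumes "has_Bochner M f I" "has_Bochner M f J"
  shows "I = J"
proof -
  from assms obtain s t where f: "f \<in> borel_measurable M"
    and s: "\<And>i. simple_Bochner_integrable M (s i)"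
      "(\<lambda>i. \<integral>\<^sup>+x. norm (f x - s i x) \<partial>M) \<longlonglongrightarrow> 0" "(\<lambda>i. simple_Bochner_integral M (s i)) \<longlonglongrightarrow> I"
    and t: "\<And>i. simple_Bochner_integrable M (t i)"
      "(\<lambda>i. \<integral>\<^sup>+x. norm (f x - t i x) \<partial>M) \<longlonglongrightarrow> 0" "(\<lambda>i. simple_Bochner_integral M (t i)) \<longlonglongrightarrow> J"
    unfolding has_Bochner_def by blast
  note meas = borel_measurable_norm_diff_simple[OF f simple_bochner_integrableD]
  have bound: "ennreal (norm (simple_Bochner_integral M (s i) - simple_Bochner_integral M (t i))) \<le>
      (\<integral>\<^sup>+x. norm (f x - s i x) \<partial>M) + (\<integral>\<^sup>+x. norm (f x - t i x) \<partial>M)" for i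
  proof -
    have "ennreal (norm (simple_Bochner_integral M (s i) - simple_Bochner_integral M (t i)))
        = norm (simple_Bochner_integral M (\<lambda>x. s i x - t i x))"
      using s(1) t(1) by (subst simple_bochner_integral_diff) auto
    also have "\<dots> \<le> simple_Bochner_integral M (\<lambda>x. norm (s i x - t i x))"
      using simple_bochner_integrable_compose2[of "(-)" M "s i" "t i"] s t
      by (auto intro!: simple_bochner_integral_norm_bound)
    also have "\<dots> = (\<integral>\<^sup>+x. norm (s i x - t i x) \<partial>M)"
      using simple_bochner_integrable_compose2[of "\<lambda>x y. norm (x - y)" M "s i" "t i"] s t
      by (auto intro!: simple_bochner_integral_eq_nn_integral)
    also have "\<dots> \<le> (\<integral>\<^sup>+x. ennreal (norm (f x - s i x)) + ennreal (norm (f x - t i x)) \<partial>M)"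
    proof (rule nn_integral_mono)
      fix x
      have "norm (s i x - t i x) \<le> norm (f x - s i x) + norm (f x - t i x)"
        by (metis norm_diff_triangle_le norm_minus_commute order.refl)
      then show "ennreal (norm (s i x - t i x)) \<le> ennreal (norm (f x - s i x)) + ennreal (norm (f x - t i x))"
        by (metis ennreal_leI ennreal_plus norm_ge_zero)
    qed
    also have "\<dots> = (\<integral>\<^sup>+x. norm (f x - s i x) \<partial>M) + (\<integral>\<^sup>+x. norm (f x - t i x) \<partial>M)"
      using meas[OF s(1)[of i]] meas[OF t(1)[of i]] by (intro nn_integral_add) auto
    finally show ?thesis .
  qed
  have "(\<lambda>i. (\<integral>\<^sup>+x. norm (f x - s i x) \<partial>M) + (\<integral>\<^sup>+x. norm (f x - t i x) \<partial>M)) \<longlonglongrightarrow> 0"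
    using tendsto_add[OF s(2) t(2)] by simp
  then have "(\<lambda>i. ennreal (norm (simple_Bochner_integral M (s i) - simple_Bochner_integral M (t i)))) \<longlonglongrightarrow> ennreal 0"
    using tendsto_squeeze_zero[OF _ bound] by simp
  then have "(\<lambda>i. norm (simple_Bochner_integral M (s i) - simple_Bochner_integral M (t i))) \<longlonglongrightarrow> 0"
    by (subst (asm) tendsto_ennreal_iff) auto
  moreover have "(\<lambda>i. norm (simple_Bochner_integral M (s i) - simple_Bochner_integral M (t i))) \<longlonglongrightarrow> norm (I - J)"
    using s(3) t(3) by (intro tendsto_intros)
  ultimately show ?thesis using LIMSEQ_unique by fastforce
qed

lemma Bochner_integral_eqI: "has_Bochner M f I \<Longrightarrow> Bochner_integral M f = I"
  unfolding Bochner_integral_def Bochner_integrable_def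
  using has_Bochner_unique by (metis the_equality)

lemma has_Bochner_cong:
  assumes "\<And>x. x \<in> space M \<Longrightarrow> f x = g x"
  shows "has_Bochner M f I \<longleftrightarrow> has_Bochner M g I"
  unfolding has_Bochner_def using assms
  by (simp cong: measurable_cong_simp nn_integral_cong_simp)

lemma Bochner_integral_cong:
  assumes "\<And>x. x \<in> space M \<Longrightarrow> f x = g x"
  shows "Bochner_integral M f = Bochner_integral M g"
proof -
  have "has_Bochner M f = has_Bochner M g" by (rule ext, rule has_Bochner_cong[OF assms])
  then show ?thesis unfolding Bochner_integral_def Bochner_integrable_def by (simp only:)
qed

text \<open>The kernels are unbounded, so approximants of a weighted function are not uniformly
  close to it, only close relative to the weight. This suffices for the Cauchy criterion: two
  Riemann sums over a fine division differ by at most e times the Riemann sum of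
  \<open>w\<close>.\<close>

lemma integrable_weighted_uniform_limit:
  fixes f :: "real \<Rightarrow> 'a::banach" and w :: "real \<Rightarrow> real"
  assumes w: "w integrable_on {a..b}"
    and approx: "\<And>e. e > 0 \<Longrightarrow> \<exists>h. h integrable_on {a..b} \<and> (\<forall>x\<in>{a..b}. norm (f x - h x) \<le> e * w x)"
  shows "f integrable_on {a..b}"
proof -
  have "\<exists>\<gamma>. gauge \<gamma> \<and> (\<forall>D1 D2. D1 tagged_division_of cbox a b \<and> \<gamma> fine D1 \<and>
            D2 tagged_division_of cbox a b \<and> \<gamma> fine D2 \<longrightarrow>
            norm ((\<Sum>(x,K)\<in>D1. measure lborel K *\<^sub>R f x) - (\<Sum>(x,K)\<in>D2. measure lborel K *\<^sub>R f x)) < e)"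
    if e: "e > 0" for e
  proof -
    \<comment> \<open>\<open>W\<close> bounds every Riemann sum of \<open>w\<close> over a
      \<open>g1\<close>-fine division, so the tolerance \<open>e / (4 * W)\<close> costs e / 4 for
      each of the two divisions; the other e / 2 is spent on \<open>h\<close>.\<close>
    define W where "W = \<bar>integral {a..b} w\<bar> + 1"
    have W: "W > 0" unfolding W_def by linarith
    then have "e / (4 * W) > 0" using e by simp
    from approx[OF this] obtain h where h: "h integrable_on {a..b}"
      "\<And>x. x \<in> {a..b} \<Longrightarrow> norm (f x - h x) \<le> e / (4 * W) * w x" by blast
    have "(w has_integral integral {a..b} w) (cbox a b)"
      using w by (simp add: has_integral_integral[symmetric])
    then obtain g1 where g1: "gauge g1" "\<And>D. D tagged_division_of cbox a b \<Longrightarrow> g1 fine D \<Longrightarrow>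
        norm ((\<Sum>(x,K)\<in>D. measure lborel K *\<^sub>R w x) - integral {a..b} w) < 1"
      unfolding has_integral by (metis zero_less_one)
    have "h integrable_on cbox a b" using h by simp
    then obtain g2 where g2: "gauge g2" "\<And>D1 D2. D1 tagged_division_of cbox a b \<Longrightarrow> g2 fine D1 \<Longrightarrow>
            D2 tagged_division_of cbox a b \<Longrightarrow> g2 fine D2 \<Longrightarrow>
            norm ((\<Sum>(x,K)\<in>D1. measure lborel K *\<^sub>R h x) - (\<Sum>(x,K)\<in>D2. measure lborel K *\<^sub>R h x)) < e / 2"
      unfolding integrable_Cauchy using e by (meson half_gt_zero)
    have near: "norm ((\<Sum>(x,K)\<in>D. measure lborel K *\<^sub>R f x) - (\<Sum>(x,K)\<in>D. measure lborel K *\<^sub>R h x)) \<le> e / 4"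
      if D: "D tagged_division_of cbox a b" "g1 fine D" for D
    proof -
      have "norm ((\<Sum>(x,K)\<in>D. measure lborel K *\<^sub>R f x) - (\<Sum>(x,K)\<in>D. measure lborel K *\<^sub>R h x))
          = norm (\<Sum>(x,K)\<in>D. measure lborel K *\<^sub>R (f x - h x))"
        by (simp add: sum_subtractf[symmetric] scaleR_diff_right case_prod_unfold)
      also have "\<dots> \<le> (\<Sum>(x,K)\<in>D. e / (4 * W) * (measure lborel K *\<^sub>R w x))"
      proof (intro sum_norm_le, clarify)
        fix x K assume xK: "(x, K) \<in> D"
        then have "x \<in> {a..b}" using tag_in_interval[OF D(1)] by simp
        then show "norm (measure lborel K *\<^sub>R (f x - h x)) \<le> e / (4 * W) * (measure lborel K *\<^sub>R w x)"
          using mult_left_mono[OF h(2), of x "measure lborel K"] by (simp add: mult_ac)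
      qed
      also have "\<dots> = e / (4 * W) * (\<Sum>(x,K)\<in>D. measure lborel K *\<^sub>R w x)"
        by (simp add: sum_distrib_left case_prod_unfold)
      also have "\<dots> \<le> e / (4 * W) * W"
        using g1(2)[OF D] e W unfolding W_def by (intro mult_left_mono) auto
      also have "\<dots> = e / 4" using W by simp
      finally show ?thesis .
    qed
    show ?thesis
    proof (intro exI[of _ "\<lambda>x. g1 x \<inter> g2 x"] conjI allI impI)
      show "gauge (\<lambda>x. g1 x \<inter> g2 x)" using g1 g2 by (intro gauge_Int)
    next
      fix D1 D2
      assume "D1 tagged_division_of cbox a b \<and> (\<lambda>x. g1 x \<inter> g2 x) fine D1 \<and>
            D2 tagged_division_of cbox a b \<and> (\<lambda>x. g1 x \<inter> g2 x) fine D2"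
      then have D: "D1 tagged_division_of cbox a b" "g1 fine D1" "g2 fine D1"
         "D2 tagged_division_of cbox a b" "g1 fine D2" "g2 fine D2"
        by (auto simp: fine_Int)
      define X Y Z T where "X = (\<Sum>(x,K)\<in>D1. measure lborel K *\<^sub>R f x)" and "Y = (\<Sum>(x,K)\<in>D1. measure lborel K *\<^sub>R h x)"
        and "Z = (\<Sum>(x,K)\<in>D2. measure lborel K *\<^sub>R f x)" and "T = (\<Sum>(x,K)\<in>D2. measure lborel K *\<^sub>R h x)"
      have 1: "norm (X - Y) \<le> e / 4" "norm (Z - T) \<le> e / 4" "norm (Y - T) < e / 2"
        using near[of D1] near[of D2] g2(2)[of D1 D2] D by (auto simp: X_def Y_def Z_def T_def)
      have "X - Z = (X - Y) + (Y - T) - (Z - T)" by simp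
      then have "norm (X - Z) \<le> norm (X - Y) + norm (Y - T) + norm (Z - T)"
        using norm_triangle_ineq4[of "(X - Y) + (Y - T)" "Z - T"] norm_triangle_ineq[of "X - Y" "Y - T"] by simp
      with 1 show "norm ((\<Sum>(x,K)\<in>D1. measure lborel K *\<^sub>R f x) - (\<Sum>(x,K)\<in>D2. measure lborel K *\<^sub>R f x)) < e"
        unfolding X_def Z_def by linarith
    qed
  qed
  then have "f integrable_on cbox a b"
    unfolding integrable_Cauchy by (intro allI impI)
  then show ?thesis by simp
qed

lemma integrable_lebesgue_on_mult_continuous:
  fixes w c :: "real \<Rightarrow> real"
  assumes w: "integrable (lebesgue_on {a..b}) w" and c: "continuous_on {a..b} c"
  shows "integrable (lebesgue_on {a..b}) (\<lambda>s. w s * c s)"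
proof -
  have "bounded (c ` {a..b})"
    using c by (intro compact_imp_bounded compact_continuous_image) auto
  then obtain B where B: "\<And>s. s \<in> {a..b} \<Longrightarrow> \<bar>c s\<bar> \<le> B" unfolding bounded_iff by force
  have cm: "c \<in> borel_measurable (lebesgue_on {a..b})"
    using c by (intro continuous_imp_measurable_on_sets_lebesgue) auto
  show ?thesis
  proof (rule Bochner_Integration.integrable_bound)
    show "integrable (lebesgue_on {a..b}) (\<lambda>s. B * w s)" using w by simp
    show "(\<lambda>s. w s * c s) \<in> borel_measurable (lebesgue_on {a..b})"
      using borel_measurable_integrable[OF w] cm by simp
    show "AE s in lebesgue_on {a..b}. norm (w s * c s) \<le> norm (B * w s)"
    proof (intro AE_I2)
      fix s assume "s \<in> space (lebesgue_on {a..b})"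
      then have "\<bar>w s\<bar> * \<bar>c s\<bar> \<le> \<bar>w s\<bar> * \<bar>B\<bar>"
        using B[of s] by (intro mult_left_mono) auto
      then show "norm (w s * c s) \<le> norm (B * w s)" by (simp add: abs_mult mult.commute)
    qed
  qed
qed

lemma borel_measurable_weighted_continuous:
  fixes f :: "real \<Rightarrow> 'a::real_normed_vector" and w :: "real \<Rightarrow> real"
  assumes w: "w \<in> borel_measurable (lebesgue_on {a..b})" and f: "continuous_on {a..b} f" and ab: "a \<le> b"
  shows "(\<lambda>s. w s *\<^sub>R f s) \<in> borel_measurable (lebesgue_on {a..b})"
proof -
  \<comment> \<open>Measurability of the product is obtained by composing one jointly continuous map
    with the pair (w s, s), which lives in the plane. Clamping by max and min extends
    \<open>f\<close> continuously to the whole line.\<close>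
  define F where "F p = fst p *\<^sub>R f (max a (min b (snd p)))" for p
  have "continuous_on UNIV F"
    unfolding F_def using ab by (intro continuous_intros continuous_on_compose2[OF f]) auto
  moreover have "(\<lambda>s::real. s) \<in> borel_measurable (lebesgue_on {a..b})"
    by (intro continuous_imp_measurable_on_sets_lebesgue continuous_intros) auto
  then have "(\<lambda>s. (w s, s)) \<in> borel_measurable (lebesgue_on {a..b})"
    using w by (rule borel_measurable_Pair[rotated])
  ultimately have "(\<lambda>s. F (w s, s)) \<in> borel_measurable (lebesgue_on {a..b})"
    using borel_measurable_continuous_on[of F "\<lambda>s. (w s, s)"] by blast
  moreover have "F (w s, s) = w s *\<^sub>R f s" if "s \<in> space (lebesgue_on {a..b})" for s
    using that by (cases "s = b") (auto simp: F_def max_def min_def)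
  ultimately show ?thesis
    using measurable_cong[of "lebesgue_on {a..b}" "\<lambda>s. F (w s, s)" "\<lambda>s. w s *\<^sub>R f s" borel] by blast
qed

text \<open>For a monomial the simple functions come from the scalar integral of
  \<open>w s * (s - a) ^ k\<close> and are multiplied by the vector \<open>x\<close>. One simple
  function has to satisfy both estimates, in L1 and for the integral, and this form adds up along
  \<open>vec_poly_add\<close>.\<close>

lemma integral_weighted_vec_poly_approx:
  fixes p :: "real \<Rightarrow> 'a::banach" and w :: "real \<Rightarrow> real"
  assumes w: "integrable (lebesgue_on {a..b}) w" and ab: "a \<le> b" and p: "p \<in> vec_poly a"
  shows "(\<lambda>s. w s *\<^sub>R p s) integrable_on {a..b} \<and>
    (\<forall>e>0. \<exists>s. simple_Bochner_integrable (lebesgue_on {a..b}) s \<and>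
       (\<integral>\<^sup>+x. norm (w x *\<^sub>R p x - s x) \<partial>lebesgue_on {a..b}) \<le> ennreal e \<and>
       norm (simple_Bochner_integral (lebesgue_on {a..b}) s - integral {a..b} (\<lambda>s. w s *\<^sub>R p s)) \<le> e)"
  using p
proof (induction rule: vec_poly.induct)
  case (vec_poly_monom k x)
  let ?M = "lebesgue_on {a..b}"
  define r where "r s = w s * (s - a) ^ k" for s
  have r: "integrable ?M r"
    unfolding r_def using w by (intro integrable_lebesgue_on_mult_continuous continuous_intros)
  have rI: "(r has_integral integral\<^sup>L ?M r) {a..b}"
    using r by (auto simp: has_integral_iff integrable_on_lebesgue_on lebesgue_integral_eq_integral)
  then have I: "((\<lambda>s. w s *\<^sub>R ((s - a) ^ k *\<^sub>R x)) has_integral integral\<^sup>L ?M r *\<^sub>R x) {a..b}"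
    using has_integral_scaleR_left[OF rI, of x] by (simp add: r_def mult_ac)
  have "\<exists>s. simple_Bochner_integrable ?M s \<and>
       (\<integral>\<^sup>+z. norm (w z *\<^sub>R (z - a) ^ k *\<^sub>R x - s z) \<partial>?M) \<le> ennreal e \<and>
       norm (simple_Bochner_integral ?M s - integral {a..b} (\<lambda>s. w s *\<^sub>R (s - a) ^ k *\<^sub>R x)) \<le> e" if e: "e > 0" for e
  proof -
    have "has_bochner_integral ?M r (integral\<^sup>L ?M r)" using r by (rule has_bochner_integral_integrable)
    then obtain s where s: "r \<in> borel_measurable ?M" "\<And>i::nat. simple_Bochner_integrable ?M (s i)"
      "(\<lambda>i. \<integral>\<^sup>+z. norm (r z - s i z) \<partial>?M) \<longlonglongrightarrow> 0"
      "(\<lambda>i. simple_Bochner_integral ?M (s i)) \<longlonglongrightarrow> integral\<^sup>L ?M r"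
      unfolding has_bochner_integral.simps by blast
    \<comment> \<open>The summand 1 covers \<open>x = 0\<close>.\<close>
    define d where "d = e / (norm x + 1)"
    have d: "d > 0" "d * norm x \<le> e" using e by (auto simp: d_def field_simps add_pos_nonneg)
    have "\<forall>\<^sub>F i in sequentially. (\<integral>\<^sup>+z. norm (r z - s i z) \<partial>?M) < ennreal d"
      using s(3) d by (intro order_tendstoD) auto
    moreover have "\<forall>\<^sub>F i in sequentially. norm (simple_Bochner_integral ?M (s i) - integral\<^sup>L ?M r) < d"
      using tendstoD[OF s(4) d(1)] by (simp add: dist_norm)
    ultimately have "\<forall>\<^sub>F i in sequentially. (\<integral>\<^sup>+z. norm (r z - s i z) \<partial>?M) < ennreal d \<and> norm (simple_Bochner_integral ?M (s i) - integral\<^sup>L ?M r) < d"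
      by (rule eventually_conj)
    then obtain i where i: "(\<integral>\<^sup>+z. norm (r z - s i z) \<partial>?M) < ennreal d" "norm (simple_Bochner_integral ?M (s i) - integral\<^sup>L ?M r) < d"
      by (auto simp: eventually_sequentially)
    have lin: "linear (\<lambda>c. c *\<^sub>R x)" by (simp add: linearI scaleR_add_left)
    show ?thesis
    proof (intro exI[of _ "\<lambda>z. s i z *\<^sub>R x"] conjI)
      show "simple_Bochner_integrable ?M (\<lambda>z. s i z *\<^sub>R x)"
        using simple_bochner_integrable_compose2[of "\<lambda>u v. u *\<^sub>R x", OF _ s(2) s(2), of i] by simp
      have "(\<integral>\<^sup>+z. norm (w z *\<^sub>R (z - a) ^ k *\<^sub>R x - s i z *\<^sub>R x) \<partial>?M) = (\<integral>\<^sup>+z. ennreal (norm x) * norm (r z - s i z) \<partial>?M)"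
        by (intro nn_integral_cong) (simp add: r_def scaleR_diff_left[symmetric] ennreal_mult'[symmetric] mult.commute)
      also have "\<dots> = ennreal (norm x) * (\<integral>\<^sup>+z. norm (r z - s i z) \<partial>?M)"
        using borel_measurable_norm_diff_simple[OF s(1) simple_bochner_integrableD[OF s(2)]]
        by (intro nn_integral_cmult) auto
      also have "\<dots> \<le> ennreal (norm x) * ennreal d"
        using i(1) by (intro mult_left_mono) auto
      also have "\<dots> = ennreal (d * norm x)" using d by (simp add: ennreal_mult'[symmetric] mult.commute)
      also have "\<dots> \<le> ennreal e" using d by (intro ennreal_leI)
      finally show "(\<integral>\<^sup>+z. norm (w z *\<^sub>R (z - a) ^ k *\<^sub>R x - s i z *\<^sub>R x) \<partial>?M) \<le> ennreal e" .
      have "simple_Bochner_integral ?M (\<lambda>z. s i z *\<^sub>R x) - integral {a..b} (\<lambda>s. w s *\<^sub>R (s - a) ^ k *\<^sub>R x)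
          = (simple_Bochner_integral ?M (s i) - integral\<^sup>L ?M r) *\<^sub>R x"
        using simple_bochner_integral_linear[OF lin s(2)] integral_unique[OF I]
        by (simp add: scaleR_diff_left)
      also have "norm \<dots> \<le> d * norm x" using i(2) by (simp add: mult_right_mono)
      also have "\<dots> \<le> e" by fact
      finally show "norm (simple_Bochner_integral ?M (\<lambda>z. s i z *\<^sub>R x) - integral {a..b} (\<lambda>s. w s *\<^sub>R (s - a) ^ k *\<^sub>R x)) \<le> e" .
    qed
  qed
  then show ?case using I by blast
next
  case (vec_poly_add p q)
  let ?M = "lebesgue_on {a..b}"
  have int: "(\<lambda>s. w s *\<^sub>R (p s + q s)) integrable_on {a..b}"
    using vec_poly_add.IH by (auto simp: scaleR_add_right intro: integrable_add)
  have I: "integral {a..b} (\<lambda>s. w s *\<^sub>R (p s + q s)) = integral {a..b} (\<lambda>s. w s *\<^sub>R p s) + integral {a..b} (\<lambda>s. w s *\<^sub>R q s)"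
    using vec_poly_add.IH by (simp add: scaleR_add_right integral_add)
  have "\<exists>s. simple_Bochner_integrable ?M s \<and>
       (\<integral>\<^sup>+z. norm (w z *\<^sub>R (p z + q z) - s z) \<partial>?M) \<le> ennreal e \<and>
       norm (simple_Bochner_integral ?M s - integral {a..b} (\<lambda>s. w s *\<^sub>R (p s + q s))) \<le> e" if e: "e > 0" for e
  proof -
    obtain s t where st: "simple_Bochner_integrable ?M s" "simple_Bochner_integrable ?M t"
       "(\<integral>\<^sup>+z. norm (w z *\<^sub>R p z - s z) \<partial>?M) \<le> ennreal (e/2)"
       "norm (simple_Bochner_integral ?M s - integral {a..b} (\<lambda>s. w s *\<^sub>R p s)) \<le> e/2"
       "(\<integral>\<^sup>+z. norm (w z *\<^sub>R q z - t z) \<partial>?M) \<le> ennreal (e/2)"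
       "norm (simple_Bochner_integral ?M t - integral {a..b} (\<lambda>s. w s *\<^sub>R q s)) \<le> e/2"
      using vec_poly_add.IH e by (meson half_gt_zero)
    show ?thesis
    proof (intro exI[of _ "\<lambda>z. s z + t z"] conjI)
      show "simple_Bochner_integrable ?M (\<lambda>z. s z + t z)"
        using simple_bochner_integrable_compose2[of "(+)", OF _ st(1,2)] by simp
      have pm: "(\<lambda>z. w z *\<^sub>R p z) \<in> borel_measurable ?M" "(\<lambda>z. w z *\<^sub>R q z) \<in> borel_measurable ?M"
        using borel_measurable_integrable[OF w] vec_poly_add.hyps ab
        by (auto intro!: borel_measurable_weighted_continuous continuous_on_vec_poly)
      have "(\<integral>\<^sup>+z. norm (w z *\<^sub>R (p z + q z) - (s z + t z)) \<partial>?M)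
          \<le> (\<integral>\<^sup>+z. ennreal (norm (w z *\<^sub>R p z - s z)) + ennreal (norm (w z *\<^sub>R q z - t z)) \<partial>?M)"
      proof (rule nn_integral_mono)
        fix z
        have "norm (w z *\<^sub>R (p z + q z) - (s z + t z)) \<le> norm (w z *\<^sub>R p z - s z) + norm (w z *\<^sub>R q z - t z)"
          unfolding scaleR_add_right by (rule norm_diff_triangle_ineq)
        then show "ennreal (norm (w z *\<^sub>R (p z + q z) - (s z + t z))) \<le> ennreal (norm (w z *\<^sub>R p z - s z)) + ennreal (norm (w z *\<^sub>R q z - t z))"
          by (metis ennreal_leI ennreal_plus norm_ge_zero)
      qed
      also have "\<dots> = (\<integral>\<^sup>+z. norm (w z *\<^sub>R p z - s z) \<partial>?M) + (\<integral>\<^sup>+z. norm (w z *\<^sub>R q z - t z) \<partial>?M)"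
        using borel_measurable_norm_diff_simple[OF pm(1) simple_bochner_integrableD[OF st(1)]]
          borel_measurable_norm_diff_simple[OF pm(2) simple_bochner_integrableD[OF st(2)]]
        by (intro nn_integral_add) auto
      also have "\<dots> \<le> ennreal (e/2) + ennreal (e/2)" using st by (intro add_mono)
      also have "\<dots> = ennreal e" using e by (simp add: ennreal_plus[symmetric] del: ennreal_plus)
      finally show "(\<integral>\<^sup>+z. norm (w z *\<^sub>R (p z + q z) - (s z + t z)) \<partial>?M) \<le> ennreal e" .
      show "norm (simple_Bochner_integral ?M (\<lambda>z. s z + t z) - integral {a..b} (\<lambda>s. w s *\<^sub>R (p s + q s))) \<le> e"
        unfolding I simple_bochner_integral_add[OF st(1,2)]
        by (rule order_trans[OF norm_diff_triangle_ineq]) (use st(4,6) in linarith)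
    qed
  qed
  then show ?case using int by blast
qed

lemma integrable_weighted_continuous:
  fixes f :: "real \<Rightarrow> 'a::banach" and w :: "real \<Rightarrow> real"
  assumes w: "integrable (lebesgue_on {a..b}) w" and f: "continuous_on {a..b} f"
  shows "(\<lambda>s. w s *\<^sub>R f s) integrable_on {a..b}"
proof (cases "a \<le> b")
  case ab: True
  show ?thesis
  proof (rule integrable_weighted_uniform_limit)
    show "(\<lambda>s. \<bar>w s\<bar>) integrable_on {a..b}"
      using w by (intro integrable_on_lebesgue_on) auto
    fix e :: real assume "e > 0"
    then obtain p where p: "p \<in> vec_poly a" "\<And>t. t \<in> {a..b} \<Longrightarrow> norm (f t - p t) < e"
      using vec_poly_approx[OF ab f] by blast
    have "norm (w x *\<^sub>R f x - w x *\<^sub>R p x) \<le> e * \<bar>w x\<bar>" if "x \<in> {a..b}" for x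
      using mult_left_mono[OF less_imp_le[OF p(2)[OF that]], of "\<bar>w x\<bar>"]
      by (simp add: scaleR_diff_right[symmetric] mult.commute)
    then show "\<exists>h. h integrable_on {a..b} \<and> (\<forall>x\<in>{a..b}. norm (w x *\<^sub>R f x - h x) \<le> e * \<bar>w x\<bar>)"
      using integral_weighted_vec_poly_approx[OF w ab p(1)] by blast
  qed
qed auto

text \<open>The bridge from the Bochner integrals in the definitions to Henstock-Kurzweil integrals.
  If \<open>p\<close> is a polynomial uniformly within d of \<open>f\<close>, then
  \<open>w f\<close> and \<open>w p\<close> differ by at most d times the L1 norm of
  \<open>w\<close>, both in L1 and in the integral.\<close>

theorem has_Bochner_weighted_continuous:
  fixes f :: "real \<Rightarrow> 'a::banach" and w :: "real \<Rightarrow> real"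
  assumes w: "integrable (lebesgue_on {a..b}) w" and f: "continuous_on {a..b} f" and ab: "a \<le> b"
  shows "has_Bochner (lebesgue_on {a..b}) (\<lambda>s. w s *\<^sub>R f s) (integral {a..b} (\<lambda>s. w s *\<^sub>R f s))"
proof -
  let ?M = "lebesgue_on {a..b}"
  define W where "W = integral {a..b} (\<lambda>x. \<bar>w x\<bar>)"
  have wi: "integrable ?M (\<lambda>x. \<bar>w x\<bar>)" using w by auto
  have W: "W \<ge> 0" unfolding W_def by (intro integral_nonneg integrable_on_lebesgue_on[OF wi]) auto
  have WL: "(\<integral>\<^sup>+x. \<bar>w x\<bar> \<partial>?M) = ennreal W"
    unfolding W_def using wi by (subst nn_integral_eq_integral) (auto simp: lebesgue_integral_eq_integral)
  have fm: "(\<lambda>s. w s *\<^sub>R f s) \<in> borel_measurable ?M"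
    using borel_measurable_integrable[OF w] f ab by (rule borel_measurable_weighted_continuous)
  have "\<exists>s. simple_Bochner_integrable ?M s \<and>
       (\<integral>\<^sup>+x. norm (w x *\<^sub>R f x - s x) \<partial>?M) \<le> ennreal e \<and>
       norm (simple_Bochner_integral ?M s - integral {a..b} (\<lambda>s. w s *\<^sub>R f s)) \<le> e" if e: "e > 0" for e
  proof -
    \<comment> \<open>Half of e pays for replacing \<open>f\<close> by a polynomial and half for
      replacing that by a simple function; \<open>W + 1\<close> avoids a division by zero.\<close>
    define d where "d = (e / 2) / (W + 1)"
    have d: "d > 0" using e W by (simp add: d_def)
    have "d * W \<le> d * (W + 1)" using d by simp
    also have "\<dots> = e / 2" using W d_def nonzero_eq_divide_eq[of "W + 1" d "e / 2"] by simp
    finally have dW: "d * W \<le> e / 2" .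
    obtain p where p: "p \<in> vec_poly a" "\<And>t. t \<in> {a..b} \<Longrightarrow> norm (f t - p t) < d"
      using vec_poly_approx[OF ab f d] by blast
    have near: "norm (w x *\<^sub>R f x - w x *\<^sub>R p x) \<le> d * \<bar>w x\<bar>" if "x \<in> {a..b}" for x
      using mult_left_mono[OF less_imp_le[OF p(2)[OF that]], of "\<bar>w x\<bar>"]
      by (simp add: scaleR_diff_right[symmetric] mult.commute)
    have pint: "(\<lambda>s. w s *\<^sub>R p s) integrable_on {a..b}"
      using integral_weighted_vec_poly_approx[OF w ab p(1)] by blast
    obtain s where s: "simple_Bochner_integrable ?M s"
       "(\<integral>\<^sup>+x. norm (w x *\<^sub>R p x - s x) \<partial>?M) \<le> ennreal (e/2)"
       "norm (simple_Bochner_integral ?M s - integral {a..b} (\<lambda>s. w s *\<^sub>R p s)) \<le> e/2"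
      using integral_weighted_vec_poly_approx[OF w ab p(1)] e by (meson half_gt_zero)
    have pm: "(\<lambda>z. w z *\<^sub>R p z) \<in> borel_measurable ?M"
      using borel_measurable_integrable[OF w] p(1) ab
      by (auto intro!: borel_measurable_weighted_continuous continuous_on_vec_poly)
    have "(\<integral>\<^sup>+x. norm (w x *\<^sub>R f x - s x) \<partial>?M)
        \<le> (\<integral>\<^sup>+x. ennreal d * ennreal \<bar>w x\<bar> + ennreal (norm (w x *\<^sub>R p x - s x)) \<partial>?M)"
    proof (rule nn_integral_mono)
      fix x assume "x \<in> space ?M"
      then have "norm (w x *\<^sub>R f x - s x) \<le> d * \<bar>w x\<bar> + norm (w x *\<^sub>R p x - s x)"
        using near[of x] by (intro norm_diff_triangle_le[OF _ order.refl]) auto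
      then show "ennreal (norm (w x *\<^sub>R f x - s x)) \<le> ennreal d * ennreal \<bar>w x\<bar> + ennreal (norm (w x *\<^sub>R p x - s x))"
        using d by (simp add: ennreal_mult'[symmetric] ennreal_plus[symmetric] ennreal_leI del: ennreal_plus)
    qed
    also have "\<dots> = ennreal d * (\<integral>\<^sup>+x. \<bar>w x\<bar> \<partial>?M) + (\<integral>\<^sup>+x. norm (w x *\<^sub>R p x - s x) \<partial>?M)"
      using borel_measurable_norm_diff_simple[OF pm simple_bochner_integrableD[OF s(1)]]
        borel_measurable_integrable[OF wi]
      by (subst nn_integral_add) (auto simp: nn_integral_cmult)
    also have "\<dots> \<le> ennreal (d * W) + ennreal (e/2)"
      using s(2) d W by (auto simp: WL ennreal_mult' intro!: add_mono)
    also have "\<dots> = ennreal (d * W + e/2)" using d W e by (simp add: ennreal_plus[symmetric] del: ennreal_plus)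
    also have "\<dots> \<le> ennreal e" using dW by (intro ennreal_leI) simp
    finally have 1: "(\<integral>\<^sup>+x. norm (w x *\<^sub>R f x - s x) \<partial>?M) \<le> ennreal e" .
    have "norm (integral {a..b} (\<lambda>s. w s *\<^sub>R f s) - integral {a..b} (\<lambda>s. w s *\<^sub>R p s))
        = norm (integral {a..b} (\<lambda>s. w s *\<^sub>R f s - w s *\<^sub>R p s))"
      using integrable_weighted_continuous[OF w f] pint by (subst integral_diff) auto
    also have "\<dots> \<le> integral {a..b} (\<lambda>s. d * \<bar>w s\<bar>)"
      using integrable_weighted_continuous[OF w f] pint near integrable_on_lebesgue_on[OF wi]
      by (intro integral_norm_bound_integral integrable_diff integrable_on_mult_right) auto
    also have "\<dots> \<le> e/2" using dW by (simp add: W_def)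
    finally have "norm (simple_Bochner_integral ?M s - integral {a..b} (\<lambda>s. w s *\<^sub>R f s)) \<le> e/2 + e/2"
      using s(3) by (intro norm_diff_triangle_le[OF s(3)]) (simp add: norm_minus_commute)
    then show ?thesis using s(1) 1 by auto
  qed
  \<comment> \<open>Taking e = 1/(n + 1) turns the single approximants into the sequence that
    \<open>has_Bochner\<close> asks for.\<close>
  then have "\<exists>s. simple_Bochner_integrable ?M s \<and>
       (\<integral>\<^sup>+x. norm (w x *\<^sub>R f x - s x) \<partial>?M) \<le> ennreal (inverse (Suc n)) \<and>
       norm (simple_Bochner_integral ?M s - integral {a..b} (\<lambda>s. w s *\<^sub>R f s)) \<le> inverse (Suc n)" for n :: nat
    by simp
  then have "\<exists>s. \<forall>n. simple_Bochner_integrable ?M (s n) \<and>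
       (\<integral>\<^sup>+x. norm (w x *\<^sub>R f x - s n x) \<partial>?M) \<le> ennreal (inverse (Suc n)) \<and>
       norm (simple_Bochner_integral ?M (s n) - integral {a..b} (\<lambda>s. w s *\<^sub>R f s)) \<le> inverse (Suc n)"
    by (rule choice[OF allI])
  then obtain s where s: "\<And>n. simple_Bochner_integrable ?M (s n)"
       "\<And>n. (\<integral>\<^sup>+x. norm (w x *\<^sub>R f x - s n x) \<partial>?M) \<le> ennreal (inverse (Suc n))"
       "\<And>n. norm (simple_Bochner_integral ?M (s n) - integral {a..b} (\<lambda>s. w s *\<^sub>R f s)) \<le> inverse (Suc n)"
    by blast
  have "(\<lambda>n. ennreal (inverse (Suc n))) \<longlonglongrightarrow> ennreal 0"
    by (intro tendsto_ennrealI LIMSEQ_inverse_real_of_nat)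
  then have "(\<lambda>n. \<integral>\<^sup>+x. norm (w x *\<^sub>R f x - s n x) \<partial>?M) \<longlonglongrightarrow> 0"
    using tendsto_squeeze_zero[OF _ s(2)] by simp
  moreover have "(\<lambda>n. simple_Bochner_integral ?M (s n)) \<longlonglongrightarrow> integral {a..b} (\<lambda>s. w s *\<^sub>R f s)"
    by (rule LIM_zero_cancel, rule Lim_null_comparison[OF _ LIMSEQ_inverse_real_of_nat]) (use s(3) in auto)
  ultimately show ?thesis unfolding has_Bochner_def using fm s(1) by blast
qed

lemma Bochner_integral_weighted_continuous:
  fixes f :: "real \<Rightarrow> 'a::banach" and w :: "real \<Rightarrow> real"
  assumes "integrable (lebesgue_on {a..b}) w" "continuous_on {a..b} f" "a \<le> b"
  shows "Bochner_integral (lebesgue_on {a..b}) (\<lambda>s. w s *\<^sub>R f s) = integral {a..b} (\<lambda>s. w s *\<^sub>R f s)"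
  using has_Bochner_weighted_continuous[OF assms] by (rule Bochner_integral_eqI)

lemma integrable_lebesgue_on_continuous:
  fixes c :: "real \<Rightarrow> real"
  assumes "continuous_on {a..b} c"
  shows "integrable (lebesgue_on {a..b}) c"
  using continuous_imp_integrable_real[OF assms] .

lemma locally_Bochner_integrable_continuous:
  assumes "continuous_on {a..b} f"
  shows "locally_Bochner_integrable a b f"
  unfolding locally_Bochner_integrable_def Bochner_integrable_def
proof (intro allI impI)
  fix c d assume cd: "a < c \<and> c \<le> d \<and> d < b"
  then have "continuous_on {c..d} f" by (intro continuous_on_subset[OF assms]) auto
  then show "\<exists>I. has_Bochner (lebesgue_on {c..d}) f I"
    using has_Bochner_weighted_continuous[of c d "\<lambda>_. 1" f] integrable_lebesgue_on_continuous[of c d "\<lambda>_. 1"] cd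
    by auto
qed

section \<open>The fractional integral of continuous functions\<close>

text \<open>The operator \<open>J^\<gamma>\<close> with a Henstock-Kurzweil integral, for positive
  orders; \<open>frac_integral_eq_fint\<close> identifies it with the Bochner version on continuous
  functions.\<close>

definition fint :: "real \<Rightarrow> real \<Rightarrow> (real \<Rightarrow> 'a::banach) \<Rightarrow> real \<Rightarrow> 'a" where
  "fint \<gamma> a u t = (1 / Gamma \<gamma>) *\<^sub>R integral {a..t} (\<lambda>s. (t - s) powr (\<gamma> - 1) *\<^sub>R u s)"

text \<open>The Beta integral on [0, 1], transported by y = (s - a) / (t - a). Through
  \<open>fint_powr\<close> it gives the fractional integrals of all powers, on which every density
  argument below rests.\<close>

lemma has_integral_Beta_kernel:
  fixes \<gamma> p a t :: real
  assumes \<gamma>: "\<gamma> > 0" and p: "p > -1" and at: "a \<le> t"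
  shows "((\<lambda>s. (t - s) powr (\<gamma> - 1) * (s - a) powr p) has_integral
           Beta (p + 1) \<gamma> * (t - a) powr (\<gamma> + p)) {a..t}"
proof (cases "a = t")
  case True
  then show ?thesis using has_integral_refl(2)[of _ t] by simp
next
  case False
  with at have L: "t - a > 0" by simp
  define m where "m = 1 / (t - a)"
  have m: "m > 0" using L by (simp add: m_def)
  have "((\<lambda>y. y powr p * (1 - y) powr (\<gamma> - 1)) has_integral Beta (p + 1) \<gamma>) (cbox 0 1)"
    using has_integral_Beta_real[of "p + 1" \<gamma>] \<gamma> p by simp
  note * = has_integral_affinity'[OF this m, of "- a * m"]
  have "((\<lambda>s. (m * s - a * m) powr p * (1 - (m * s - a * m)) powr (\<gamma> - 1)) has_integral Beta (p + 1) \<gamma> / m) {a..t}"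
  proof -
    have "(0 - - a * m) /\<^sub>R m = a" "(1 - - a * m) /\<^sub>R m = t" "\<And>s. m *\<^sub>R s + - a * m = m * s - a * m"
      using L by (simp_all add: m_def field_simps)
    with *(1) show ?thesis by (simp only: cbox_interval) (simp add: divide_inverse mult.commute)
  qed
  then have "((\<lambda>s. m powr (\<gamma> - 1 + p) * ((t - s) powr (\<gamma> - 1) * (s - a) powr p)) has_integral Beta (p + 1) \<gamma> / m) {a..t}"
  proof (rule has_integral_eq[rotated])
    fix s assume s: "s \<in> {a..t}"
    have "m * s - a * m = m * (s - a)" by (simp add: algebra_simps)
    moreover have "m * (t - a) = 1" using L by (simp add: m_def)
    then have "1 - (m * s - a * m) = m * (t - s)" by (simp add: algebra_simps)
    ultimately show "(m * s - a * m) powr p * (1 - (m * s - a * m)) powr (\<gamma> - 1)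
        = m powr (\<gamma> - 1 + p) * ((t - s) powr (\<gamma> - 1) * (s - a) powr p)"
      using m s by (simp add: powr_mult powr_add mult_ac)
  qed
  from has_integral_mult_right[OF this, of "m powr - (\<gamma> - 1 + p)"]
  have "((\<lambda>s. (t - s) powr (\<gamma> - 1) * (s - a) powr p) has_integral
      m powr - (\<gamma> - 1 + p) * (Beta (p + 1) \<gamma> / m)) {a..t}"
    using m by (simp add: mult.assoc[symmetric] powr_add[symmetric])
  moreover have "m powr - (\<gamma> - 1 + p) / m = (t - a) powr (\<gamma> + p)"
  proof -
    have "m powr - (\<gamma> - 1 + p) / m = m powr - (\<gamma> - 1 + p) * m powr (-1)"
      using m by (simp add: powr_minus divide_inverse)
    also have "\<dots> = m powr - (\<gamma> + p)" unfolding powr_add[symmetric] by (simp add: algebra_simps)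
    also have "\<dots> = (t - a) powr (\<gamma> + p)"
    proof -
      have *: "m = (t - a) powr (- 1)" using L by (simp add: m_def powr_minus_divide)
      show ?thesis unfolding * powr_powr by (simp add: add.commute)
    qed
    finally show ?thesis .
  qed
  then have "m powr - (\<gamma> - 1 + p) * (Beta (p + 1) \<gamma> / m) = Beta (p + 1) \<gamma> * (t - a) powr (\<gamma> + p)"
    by (metis mult.commute times_divide_eq_right)
  ultimately show ?thesis by (simp only:)
qed

lemma Gamma_plus1_pos: "x > 0 \<Longrightarrow> Gamma (x + 1) = x * Gamma (x :: real)"
  by (rule Gamma_plus1) (auto simp: nonpos_Ints_def)

lemma has_integral_kernel:
  fixes \<gamma> a t :: real
  assumes \<gamma>: "\<gamma> > 0" and at: "a \<le> t"
  shows "((\<lambda>s. (t - s) powr (\<gamma> - 1)) has_integral (t - a) powr \<gamma> / \<gamma>) {a..t}"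
proof -
  have B: "Beta 1 \<gamma> = 1 / \<gamma>" using \<gamma> less_imp_neq[OF Gamma_real_pos[OF \<gamma>]]
    by (simp add: Beta_def Gamma_plus1_pos add.commute[of 1 \<gamma>])
  have "((\<lambda>s. (t - s) powr (\<gamma> - 1) * (s - a) powr 0) has_integral (t - a) powr \<gamma> / \<gamma>) {a..t}"
    using has_integral_Beta_kernel[OF \<gamma> _ at, of 0] B by simp
  \<comment> \<open>As \<open>0 powr 0 = 0\<close>, the factor \<open>(s - a) powr 0\<close> is 1
    except at s = a.\<close>
  then show ?thesis by (rule has_integral_spike_finite[rotated 2, of _ _ _ "{a}"]) auto
qed

lemma integrable_kernel:
  fixes \<gamma> a t :: real
  assumes "\<gamma> > 0"
  shows "integrable (lebesgue_on {a..t}) (\<lambda>s. (t - s) powr (\<gamma> - 1))"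
proof (cases "a \<le> t")
  case True
  have "(\<lambda>s. (t - s) powr (\<gamma> - 1)) absolutely_integrable_on {a..t}"
    using has_integral_kernel[OF assms True] by (intro nonnegative_absolutely_integrable_1) auto
  then show ?thesis by (simp add: integrable_restrict_space set_integrable_def)
next
  case False
  then show ?thesis by (intro integrable_lebesgue_on_continuous) simp
qed

lemma integrable_kernel_continuous:
  fixes u :: "real \<Rightarrow> 'a::banach"
  assumes "\<gamma> > 0" "continuous_on {a..t} u"
  shows "(\<lambda>s. (t - s) powr (\<gamma> - 1) *\<^sub>R u s) integrable_on {a..t}"
  using integrable_weighted_continuous[OF integrable_kernel[OF assms(1)] assms(2)] .

section \<open>Linearity of fractional integration, sup-norm bounds, powers\<close>

lemma fint_at_left [simp]: "fint \<gamma> a u a = 0"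
  by (simp add: fint_def)

lemma fint_cong:
  assumes "\<And>s. s \<in> {a..t} \<Longrightarrow> u s = v s"
  shows "fint \<gamma> a u t = fint \<gamma> a v t"
  unfolding fint_def using assms by (intro arg_cong[where f="scaleR _"] integral_cong) auto

lemma fint_add:
  fixes u v :: "real \<Rightarrow> 'a::banach"
  assumes "\<gamma> > 0" "continuous_on {a..t} u" "continuous_on {a..t} v"
  shows "fint \<gamma> a (\<lambda>s. u s + v s) t = fint \<gamma> a u t + fint \<gamma> a v t"
  unfolding fint_def
  using integrable_kernel_continuous[OF assms(1,2)] integrable_kernel_continuous[OF assms(1,3)]
  by (simp add: scaleR_add_right integral_add)

lemma fint_diff:
  fixes u v :: "real \<Rightarrow> 'a::banach"
  assumes "\<gamma> > 0" "continuous_on {a..t} u" "continuous_on {a..t} v"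
  shows "fint \<gamma> a (\<lambda>s. u s - v s) t = fint \<gamma> a u t - fint \<gamma> a v t"
  unfolding fint_def
  using integrable_kernel_continuous[OF assms(1,2)] integrable_kernel_continuous[OF assms(1,3)]
  by (simp add: scaleR_diff_right integral_diff)

lemma fint_linear:
  fixes u :: "real \<Rightarrow> 'a::banach" and h :: "'a \<Rightarrow> 'b::banach"
  assumes "\<gamma> > 0" "continuous_on {a..t} u" "bounded_linear h"
  shows "fint \<gamma> a (\<lambda>s. h (u s)) t = h (fint \<gamma> a u t)"
proof -
  interpret h: bounded_linear h by fact
  show ?thesis unfolding fint_def
    using integral_linear[OF integrable_kernel_continuous[OF assms(1,2)] assms(3)]
    by (simp add: o_def h.scaleR)
qed

lemma norm_fint_le:
  fixes u :: "real \<Rightarrow> 'a::banach"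
  assumes \<gamma>: "\<gamma> > 0" and u: "continuous_on {a..t} u" and M: "\<And>s. s \<in> {a..t} \<Longrightarrow> norm (u s) \<le> M" and at: "a \<le> t"
  shows "norm (fint \<gamma> a u t) \<le> M * (t - a) powr \<gamma> / Gamma (\<gamma> + 1)"
proof -
  note I = has_integral_mult_right[OF has_integral_kernel[OF \<gamma> at], of M]
  have G: "Gamma \<gamma> > 0" using \<gamma> by (rule Gamma_real_pos)
  have "norm (integral {a..t} (\<lambda>s. (t - s) powr (\<gamma> - 1) *\<^sub>R u s)) \<le> integral {a..t} (\<lambda>s. M * (t - s) powr (\<gamma> - 1))"
    using M by (intro integral_norm_bound_integral integrable_kernel_continuous \<gamma> u has_integral_integrable[OF I])
      (auto intro!: mult_right_mono simp: mult.commute[of _ "norm _"])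
  also have "\<dots> = M * ((t - a) powr \<gamma> / \<gamma>)" using I by (rule integral_unique)
  finally show ?thesis
    unfolding fint_def Gamma_plus1_pos[OF \<gamma>] using \<gamma> G less_imp_neq[OF G] by (simp add: field_simps)
qed

lemma norm_fint_le_interval:
  fixes u :: "real \<Rightarrow> 'a::banach"
  assumes \<gamma>: "\<gamma> > 0" and u: "continuous_on {a..b} u" and M: "\<And>s. s \<in> {a..b} \<Longrightarrow> norm (u s) \<le> M" and t: "t \<in> {a..b}"
  shows "norm (fint \<gamma> a u t) \<le> (b - a) powr \<gamma> / Gamma (\<gamma> + 1) * M"
proof -
  have "M \<ge> 0" using M[of a] t by (auto intro: order_trans[OF norm_ge_zero])
  have "norm (fint \<gamma> a u t) \<le> M * (t - a) powr \<gamma> / Gamma (\<gamma> + 1)"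
    using t by (intro norm_fint_le \<gamma> M continuous_on_subset[OF u]) auto
  also have "\<dots> \<le> M * (b - a) powr \<gamma> / Gamma (\<gamma> + 1)"
    using t \<gamma> \<open>M \<ge> 0\<close> by (intro divide_right_mono mult_left_mono powr_mono2) (auto intro: less_imp_le Gamma_real_pos)
  finally show ?thesis by (simp add: mult.commute)
qed

lemma fint_powr:
  fixes x :: "'a::banach"
  assumes \<gamma>: "\<gamma> > 0" and p: "p > -1" and at: "a \<le> t"
  shows "fint \<gamma> a (\<lambda>s. (s - a) powr p *\<^sub>R x) t = (Gamma (p + 1) / Gamma (p + 1 + \<gamma>) * (t - a) powr (p + \<gamma>)) *\<^sub>R x"
proof -
  have "((\<lambda>s. ((t - s) powr (\<gamma> - 1) * (s - a) powr p) *\<^sub>R x) has_integral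
           (Beta (p + 1) \<gamma> * (t - a) powr (\<gamma> + p)) *\<^sub>R x) {a..t}"
    by (intro has_integral_scaleR_left has_integral_Beta_kernel assms)
  then have "integral {a..t} (\<lambda>s. (t - s) powr (\<gamma> - 1) *\<^sub>R (s - a) powr p *\<^sub>R x) = (Beta (p + 1) \<gamma> * (t - a) powr (\<gamma> + p)) *\<^sub>R x"
    by (simp add: integral_unique)
  then show ?thesis
    using Gamma_real_pos[OF \<gamma>] by (simp add: fint_def Beta_def add.commute)
qed

lemma fint_monom:
  fixes x :: "'a::banach"
  assumes \<gamma>: "\<gamma> > 0" and at: "a \<le> t"
  shows "fint \<gamma> a (\<lambda>s. (s - a) ^ k *\<^sub>R x) t = (fact k / Gamma (real k + 1 + \<gamma>) * (t - a) powr (real k + \<gamma>)) *\<^sub>R x"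
proof -
  \<comment> \<open>For k = 0 the integrands differ at s = a, where \<open>0 ^ 0 = 1\<close> but
    \<open>0 powr 0 = 0\<close>.\<close>
  have "fint \<gamma> a (\<lambda>s. (s - a) ^ k *\<^sub>R x) t = fint \<gamma> a (\<lambda>s. (s - a) powr (real k) *\<^sub>R x) t"
    unfolding fint_def
    by (intro arg_cong[where f="scaleR _"] integral_spike[of "{a}"]) (auto simp: powr_realpow)
  also have "\<dots> = (Gamma (real k + 1) / Gamma (real k + 1 + \<gamma>) * (t - a) powr (real k + \<gamma>)) *\<^sub>R x"
    by (rule fint_powr) (use assms in auto)
  finally show ?thesis by (simp add: Gamma_fact add.commute)
qed

text \<open>Density of the polynomials as an induction rule. In the case \<open>limit\<close> the
  property is available for arbitrarily good uniform approximants, so an operator identity follows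
  once both of its sides are bounded in the sup norm.\<close>

lemma continuous_vec_poly_induct [consumes 2, case_names monom add limit]:
  fixes u :: "real \<Rightarrow> 'a::banach"
  assumes ab: "a \<le> b" and u: "continuous_on {a..b} u"
    and mono: "\<And>k x. P (\<lambda>t. (t - a) ^ k *\<^sub>R x)"
    and add: "\<And>u v. continuous_on {a..b} u \<Longrightarrow> continuous_on {a..b} v \<Longrightarrow> P u \<Longrightarrow> P v \<Longrightarrow> P (\<lambda>t. u t + v t)"
    and lim: "\<And>u. continuous_on {a..b} u \<Longrightarrow>
      (\<And>e. e > 0 \<Longrightarrow> \<exists>p. continuous_on {a..b} p \<and> P p \<and> (\<forall>t\<in>{a..b}. norm (u t - p t) \<le> e)) \<Longrightarrow> P u"
  shows "P u"
proof (rule lim[OF u])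
  fix e :: real assume "e > 0"
  then obtain p where p: "p \<in> vec_poly a" "\<And>t. t \<in> {a..b} \<Longrightarrow> norm (u t - p t) < e"
    using vec_poly_approx[OF ab u] by blast
  have "P p" using p(1)
    by (induction rule: vec_poly.induct) (auto intro: mono add continuous_on_vec_poly)
  then show "\<exists>p. continuous_on {a..b} p \<and> P p \<and> (\<forall>t\<in>{a..b}. norm (u t - p t) \<le> e)"
    using p continuous_on_vec_poly by (metis less_imp_le)
qed

lemma eq_if_norm_diff_le:
  fixes x y :: "'a::real_normed_vector"
  assumes "\<And>e. e > 0 \<Longrightarrow> norm (x - y) \<le> C * e"
  shows "x = y"
proof -
  have "norm (x - y) \<le> e" if "e > 0" for e :: real
  proof -
    have "norm (x - y) \<le> C * (e / (\<bar>C\<bar> + 1))" using that by (intro assms) auto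
    also have "\<dots> \<le> \<bar>C\<bar> * (e / (\<bar>C\<bar> + 1))" using that by (intro mult_right_mono) auto
    also have "\<dots> \<le> e" using that by (simp add: field_simps)
    finally show ?thesis .
  qed
  then have "norm (x - y) \<le> 0" by (rule field_le_epsilon) simp
  then show ?thesis by simp
qed

lemma continuous_on_uniform_approx:
  fixes f :: "'a::topological_space \<Rightarrow> 'b::metric_space"
  assumes "\<And>e. e > 0 \<Longrightarrow> \<exists>p. continuous_on S p \<and> (\<forall>t\<in>S. dist (p t) (f t) < e)"
  shows "continuous_on S f"
proof -
  have "\<forall>n. \<exists>p. continuous_on S p \<and> (\<forall>t\<in>S. dist (p t) (f t) < inverse (real (Suc n)))"
    using assms by simp
  then obtain p where p: "\<And>n. continuous_on S (p n)" "\<And>n t. t \<in> S \<Longrightarrow> dist (p n t) (f t) < inverse (real (Suc n))"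
    by metis
  have "uniform_limit S p f sequentially"
  proof (rule uniform_limitI)
    fix e :: real assume "e > 0"
    then have "\<forall>\<^sub>F n in sequentially. inverse (real (Suc n)) < e"
      using order_tendstoD(2)[OF LIMSEQ_inverse_real_of_nat] by simp
    then show "\<forall>\<^sub>F n in sequentially. \<forall>t\<in>S. dist (p n t) (f t) < e"
      by eventually_elim (use p(2) in \<open>blast intro: less_trans\<close>)
  qed
  then show ?thesis by (rule uniform_limit_theorem[rotated]) (use p in auto)
qed

text \<open>Monomials are mapped to explicit powers, and \<open>norm_fint_le_interval\<close> makes
  the operator bounded in the sup norm, so uniform limits are respected. This avoids estimating the
  singular kernel directly.\<close>

lemma continuous_on_fint:
  fixes u :: "real \<Rightarrow> 'a::banach"
  assumes \<gamma>: "\<gamma> > 0" and ab: "a \<le> b" and u: "continuous_on {a..b} u"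
  shows "continuous_on {a..b} (fint \<gamma> a u)"
  using ab u
proof (induction rule: continuous_vec_poly_induct)
  case (monom k x)
  have "continuous_on {a..b} (\<lambda>t. (fact k / Gamma (real k + 1 + \<gamma>) * (t - a) powr (real k + \<gamma>)) *\<^sub>R x)"
    using \<gamma> by (intro continuous_on_scaleR continuous_on_mult continuous_on_powr' continuous_intros) auto
  then show ?case by (rule continuous_on_eq) (use \<gamma> in \<open>auto simp: fint_monom\<close>)
next
  case (add u v)
  then have "continuous_on {a..b} (\<lambda>t. fint \<gamma> a u t + fint \<gamma> a v t)" by (intro continuous_intros)
  then show ?case
    by (rule continuous_on_eq, subst fint_add[OF \<gamma>]) (auto intro: continuous_on_subset[OF add(1)] continuous_on_subset[OF add(2)])
next
  case (limit u)
  define C where "C = (b - a) powr \<gamma> / Gamma (\<gamma> + 1)"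
  have C: "C \<ge> 0" using \<gamma> by (simp add: C_def Gamma_real_pos less_imp_le)
  show ?case
  proof (rule continuous_on_uniform_approx)
    fix e :: real assume e: "e > 0"
    have "e / (C + 1) > 0" using e C by simp
    from limit(2)[OF this] obtain p where p: "continuous_on {a..b} p" "continuous_on {a..b} (fint \<gamma> a p)"
      "\<And>t. t \<in> {a..b} \<Longrightarrow> norm (u t - p t) \<le> e / (C + 1)" by blast
    have "dist (fint \<gamma> a p t) (fint \<gamma> a u t) < e" if t: "t \<in> {a..b}" for t
    proof -
      have "dist (fint \<gamma> a p t) (fint \<gamma> a u t) = norm (fint \<gamma> a (\<lambda>s. u s - p s) t)"
        using t by (subst fint_diff[OF \<gamma>]) (auto simp: dist_norm norm_minus_commute intro: continuous_on_subset[OF limit(1)] continuous_on_subset[OF p(1)])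
      also have "\<dots> \<le> C * (e / (C + 1))" unfolding C_def
        by (rule norm_fint_le_interval) (use \<gamma> t p in \<open>auto simp: C_def intro!: continuous_intros limit(1)\<close>)
      also have "\<dots> < e" using e C by (simp add: field_simps)
      finally show ?thesis .
    qed
    then show "\<exists>p. continuous_on {a..b} p \<and> (\<forall>t\<in>{a..b}. dist (p t) (fint \<gamma> a u t) < e)"
      using p by blast
  qed
qed

text \<open>On a monomial the Gamma factor in the denominator of the inner integral cancels the one
  in the numerator of the outer. Density then replaces the exchange of two vector-valued
  integrations.\<close>

lemma fint_fint:
  fixes u :: "real \<Rightarrow> 'a::banach"
  assumes \<gamma>: "\<gamma> > 0" and \<delta>: "\<delta> > 0" and u: "continuous_on {a..b} u" and t: "t \<in> {a..b}"
  shows "fint \<gamma> a (fint \<delta> a u) t = fint (\<gamma> + \<delta>) a u t"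
proof -
  have ab: "a \<le> b" using t by simp
  have "\<forall>t\<in>{a..b}. fint \<gamma> a (fint \<delta> a u) t = fint (\<gamma> + \<delta>) a u t"
    using ab u
  proof (induction rule: continuous_vec_poly_induct)
    case (monom k x)
    show ?case
    proof
      fix t assume t: "t \<in> {a..b}"
      define c where "c = fact k / Gamma (real k + 1 + \<delta>)"
      have G: "Gamma (real k + 1 + \<delta>) > 0" using \<delta> by (intro Gamma_real_pos) auto
      have "fint \<gamma> a (fint \<delta> a (\<lambda>t. (t - a) ^ k *\<^sub>R x)) t = fint \<gamma> a (\<lambda>s. (s - a) powr (real k + \<delta>) *\<^sub>R (c *\<^sub>R x)) t"
        using \<delta> by (intro fint_cong) (simp add: fint_monom c_def mult.commute)
      also have "\<dots> = (Gamma (real k + \<delta> + 1) / Gamma (real k + \<delta> + 1 + \<gamma>) * (t - a) powr (real k + \<delta> + \<gamma>)) *\<^sub>R c *\<^sub>R x"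
        using \<gamma> \<delta> t by (intro fint_powr) auto
      also have "\<dots> = (fact k / Gamma (real k + 1 + (\<gamma> + \<delta>)) * (t - a) powr (real k + (\<gamma> + \<delta>))) *\<^sub>R x"
        using G by (simp add: c_def add_ac)
      also have "\<dots> = fint (\<gamma> + \<delta>) a (\<lambda>t. (t - a) ^ k *\<^sub>R x) t"
        using \<gamma> \<delta> t by (subst fint_monom) auto
      finally show "fint \<gamma> a (fint \<delta> a (\<lambda>t. (t - a) ^ k *\<^sub>R x)) t = fint (\<gamma> + \<delta>) a (\<lambda>t. (t - a) ^ k *\<^sub>R x) t" .
    qed
  next
    case (add u v)
    show ?case
    proof
      fix t assume t: "t \<in> {a..b}"
      have c: "continuous_on {a..s} u" "continuous_on {a..s} v" "continuous_on {a..s} (fint \<delta> a u)" "continuous_on {a..s} (fint \<delta> a v)"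
        if "s \<in> {a..t}" for s
        using that t by (auto intro!: continuous_on_fint \<delta> intro: continuous_on_subset[OF add(1)] continuous_on_subset[OF add(2)])
      have "fint \<gamma> a (fint \<delta> a (\<lambda>t. u t + v t)) t = fint \<gamma> a (\<lambda>t. fint \<delta> a u t + fint \<delta> a v t) t"
        using c by (intro fint_cong fint_add \<delta>) auto
      also have "\<dots> = fint (\<gamma> + \<delta>) a (\<lambda>t. u t + v t) t"
        using add(3,4) t c[of t] \<gamma> \<delta> by (simp add: fint_add)
      finally show "fint \<gamma> a (fint \<delta> a (\<lambda>t. u t + v t)) t = fint (\<gamma> + \<delta>) a (\<lambda>t. u t + v t) t" .
    qed
  next
    case (limit u)
    define C where "C \<gamma> = (b - a) powr \<gamma> / Gamma (\<gamma> + 1)" for \<gamma>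
    have C: "C r \<ge> 0" if "r > 0" for r using that by (simp add: C_def Gamma_real_pos less_imp_le)
    show ?case
    proof
      fix t assume t: "t \<in> {a..b}"
      show "fint \<gamma> a (fint \<delta> a u) t = fint (\<gamma> + \<delta>) a u t"
      proof (rule eq_if_norm_diff_le)
        fix e :: real assume "e > 0"
        from limit(2)[OF this] obtain p where p: "continuous_on {a..b} p"
          "fint \<gamma> a (fint \<delta> a p) t = fint (\<gamma> + \<delta>) a p t" "\<And>t. t \<in> {a..b} \<Longrightarrow> norm (u t - p t) \<le> e"
          using t by blast
        have d: "continuous_on {a..b} (\<lambda>s. u s - p s)" by (intro continuous_intros limit(1) p(1))
        have c: "continuous_on {a..s} u" "continuous_on {a..s} p" "continuous_on {a..s} (fint \<delta> a u)" "continuous_on {a..s} (fint \<delta> a p)"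
          if "s \<in> {a..b}" for s
          using that by (auto intro!: continuous_on_fint \<delta> intro: continuous_on_subset[OF limit(1)] continuous_on_subset[OF p(1)])
        have 1: "norm (fint (\<gamma> + \<delta>) a u t - fint (\<gamma> + \<delta>) a p t) \<le> C (\<gamma> + \<delta>) * e"
          using norm_fint_le_interval[OF _ d p(3) t, of "\<gamma> + \<delta>"] \<gamma> \<delta> c[OF t]
          by (simp add: C_def fint_diff)
        have 2: "norm (fint \<delta> a u s - fint \<delta> a p s) \<le> C \<delta> * e" if "s \<in> {a..b}" for s
          using norm_fint_le_interval[OF \<delta> d p(3) that] \<delta> c[OF that]
          by (simp add: C_def fint_diff)
        have "continuous_on {a..b} (\<lambda>s. fint \<delta> a u s - fint \<delta> a p s)"
          by (intro continuous_intros continuous_on_fint \<delta> ab limit(1) p(1))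
        from norm_fint_le_interval[OF \<gamma> this 2 t]
        have 3: "norm (fint \<gamma> a (fint \<delta> a u) t - fint \<gamma> a (fint \<delta> a p) t) \<le> C \<gamma> * (C \<delta> * e)"
          using c[OF t] \<gamma> by (simp add: C_def fint_diff)
        have "fint \<gamma> a (fint \<delta> a u) t - fint (\<gamma> + \<delta>) a u t =
          (fint \<gamma> a (fint \<delta> a u) t - fint \<gamma> a (fint \<delta> a p) t) - (fint (\<gamma> + \<delta>) a u t - fint (\<gamma> + \<delta>) a p t)"
          using p(2) by simp
        also have "norm \<dots> \<le> C \<gamma> * (C \<delta> * e) + C (\<gamma> + \<delta>) * e"
          using norm_triangle_ineq4 add_mono[OF 3 1] order_trans by blast
        finally show "norm (fint \<gamma> a (fint \<delta> a u) t - fint (\<gamma> + \<delta>) a u t) \<le> (C \<gamma> * C \<delta> + C (\<gamma> + \<delta>)) * e"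
          by (simp add: algebra_simps)
      qed
    qed
  qed
  then show ?thesis using t by blast
qed

section \<open>Differentiation and injectivity of fractional integrals\<close>

lemma fint_1: "fint 1 a u t = integral {a..t} u"
proof -
  have "integral {a..t} (\<lambda>s. (t - s) powr (1 - 1) *\<^sub>R u s) = integral {a..t} u"
    by (rule integral_spike[of "{t}"]) auto
  then show ?thesis by (simp add: fint_def)
qed

lemma has_vector_derivative_fint_1:
  fixes u :: "real \<Rightarrow> 'a::banach"
  assumes "continuous_on {a..b} u" "t \<in> {a..b}"
  shows "(fint 1 a u has_vector_derivative u t) (at t within {a..b})"
  using integral_has_vector_derivative[OF assms] by (simp add: fint_1[abs_def])

lemma has_vector_derivative_fint:
  fixes u :: "real \<Rightarrow> 'a::banach"
  assumes \<gamma>: "\<gamma> > 0" and u: "continuous_on {a..b} u" and t: "t \<in> {a..b}"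
  shows "(fint (\<gamma> + 1) a u has_vector_derivative fint \<gamma> a u t) (at t within {a..b})"
proof (rule has_vector_derivative_transform[OF t])
  show "(fint 1 a (fint \<gamma> a u) has_vector_derivative fint \<gamma> a u t) (at t within {a..b})"
    using t by (intro has_vector_derivative_fint_1 continuous_on_fint \<gamma> u) auto
  show "fint (\<gamma> + 1) a u s = fint 1 a (fint \<gamma> a u) s" if "s \<in> {a..b}" for s
    using fint_fint[OF _ \<gamma> u that, of 1] by (simp add: add.commute)
qed

lemma fint_1_derivative:
  fixes F :: "real \<Rightarrow> 'a::banach"
  assumes F: "\<And>s. s \<in> {a..b} \<Longrightarrow> (F has_vector_derivative F' s) (at s within {a..b})" and t: "t \<in> {a..b}"
  shows "F t = F a + fint 1 a F' t"
proof -
  have "(F' has_integral (F t - F a)) {a..t}"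
    using t by (intro fundamental_theorem_of_calculus has_vector_derivative_within_subset[OF F]) auto
  then show ?thesis by (simp add: fint_1 integral_unique)
qed

lemma vector_derivative_unique_within_Icc:
  fixes f :: "real \<Rightarrow> 'a::real_normed_vector"
  assumes "a < b" "t \<in> {a..b}"
    "(f has_vector_derivative x) (at t within {a..b})" "(f has_vector_derivative y) (at t within {a..b})"
  shows "x = y"
  using vector_derivative_unique_within_closed_interval[of a b t f x y] assms by simp

lemma fint_1_inject:
  fixes u v :: "real \<Rightarrow> 'a::banach"
  assumes ab: "a < b" and u: "continuous_on {a..b} u" and v: "continuous_on {a..b} v"
    and eq: "\<And>t. t \<in> {a..b} \<Longrightarrow> fint 1 a u t = fint 1 a v t" and t: "t \<in> {a..b}"
  shows "u t = v t"
proof (rule vector_derivative_unique_within_Icc[OF ab t])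
  show "(fint 1 a u has_vector_derivative u t) (at t within {a..b})"
    by (rule has_vector_derivative_fint_1[OF u t])
  show "(fint 1 a u has_vector_derivative v t) (at t within {a..b})"
    by (rule has_vector_derivative_transform[OF t _ has_vector_derivative_fint_1[OF v t]]) (use eq in auto)
qed

text \<open>A further fractional integration raises the order to an integer, and an integral of
  integer order is undone by repeated ordinary differentiation.\<close>

lemma fint_inject:
  fixes u v :: "real \<Rightarrow> 'a::banach"
  assumes \<gamma>: "\<gamma> > 0" and ab: "a < b" and u: "continuous_on {a..b} u" and v: "continuous_on {a..b} v"
    and eq: "\<And>t. t \<in> {a..b} \<Longrightarrow> fint \<gamma> a u t = fint \<gamma> a v t" and t: "t \<in> {a..b}"
  shows "u t = v t"
proof -
  obtain n :: nat where n: "real n > \<gamma>" using reals_Archimedean2 by blast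
  have N: "\<forall>t\<in>{a..b}. fint (real (Suc n)) a u t = fint (real (Suc n)) a v t"
  proof
    fix t assume t: "t \<in> {a..b}"
    have "fint (real (Suc n) - \<gamma>) a (fint \<gamma> a u) t = fint (real (Suc n) - \<gamma>) a (fint \<gamma> a v) t"
      using t eq by (rule_tac fint_cong) auto
    then show "fint (real (Suc n)) a u t = fint (real (Suc n)) a v t"
      using fint_fint[OF _ \<gamma> u t, of "real (Suc n) - \<gamma>"] fint_fint[OF _ \<gamma> v t, of "real (Suc n) - \<gamma>"] n
      by simp
  qed
  have "\<forall>t\<in>{a..b}. fint (real (Suc n)) a u t = fint (real (Suc n)) a v t \<Longrightarrow> \<forall>t\<in>{a..b}. u t = v t"
  proof (induction n)
    case 0
    then show ?case using fint_1_inject[OF ab u v] by simp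
  next
    case (Suc n)
    have *: "(1 :: real) + real (Suc n) = real (Suc (Suc n))" by simp
    have "fint (real (Suc n)) a u t = fint (real (Suc n)) a v t" if "t \<in> {a..b}" for t
    proof (rule fint_1_inject[OF ab _ _ _ that])
      fix s assume s: "s \<in> {a..b}"
      show "fint 1 a (fint (real (Suc n)) a u) s = fint 1 a (fint (real (Suc n)) a v) s"
        using fint_fint[of 1 "real (Suc n)" a b u s] fint_fint[of 1 "real (Suc n)" a b v s] u v s Suc.prems
        unfolding * by simp
    qed (use u v ab in \<open>auto intro!: continuous_on_fint\<close>)
    then show ?case using Suc.IH by blast
  qed
  with N t show ?thesis by blast
qed

text \<open>The integral is split at s. As \<beta> is at most 1 the kernel decreases when t moves
  away, so the difference of the two kernels on [a, s] has one sign and its integral is computed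
  exactly; monotonicity of the power leaves (t - s)^\<beta> / \<beta>. The piece on [s, t] has the
  same bound, hence the factor 2.\<close>

lemma fint_Holder:
  fixes u :: "real \<Rightarrow> 'a::banach"
  assumes \<beta>: "0 < \<beta>" "\<beta> \<le> 1" and u: "continuous_on {a..b} u" and M: "\<And>r. r \<in> {a..b} \<Longrightarrow> norm (u r) \<le> M"
    and st: "a \<le> s" "s \<le> t" "t \<le> b"
  shows "norm (fint \<beta> a u t - fint \<beta> a u s) \<le> 2 * M / Gamma (\<beta> + 1) * (t - s) powr \<beta>"
proof (cases "s = t")
  case True
  then show ?thesis by simp
next
  case False
  with st have s_less: "s < t" by simp
  have M0: "M \<ge> 0" using M[of a] st by (auto intro: order_trans[OF norm_ge_zero])
  define k where "k t r = (t - r) powr (\<beta> - 1)" for t r :: real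
  have ut: "continuous_on {a..t} u" using st by (intro continuous_on_subset[OF u]) auto
  have kt: "(\<lambda>r. k t r *\<^sub>R u r) integrable_on {a..t}"
    unfolding k_def by (rule integrable_kernel_continuous[OF \<beta>(1) ut])
  have kt1: "(\<lambda>r. k t r *\<^sub>R u r) integrable_on {a..s}" "(\<lambda>r. k t r *\<^sub>R u r) integrable_on {s..t}"
    using st by (auto intro: integrable_on_subinterval[OF kt])
  have us: "continuous_on {a..s} u" using st by (intro continuous_on_subset[OF u]) auto
  have ks: "(\<lambda>r. k s r *\<^sub>R u r) integrable_on {a..s}"
    unfolding k_def by (rule integrable_kernel_continuous[OF \<beta>(1) us])
  have I1: "(k t has_integral (t - a) powr \<beta> / \<beta>) {a..t}" "(k t has_integral (t - s) powr \<beta> / \<beta>) {s..t}"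
    "(k s has_integral (s - a) powr \<beta> / \<beta>) {a..s}"
    unfolding k_def using has_integral_kernel[OF \<beta>(1)] st by auto
  have I2: "(k t has_integral ((t - a) powr \<beta> / \<beta> - (t - s) powr \<beta> / \<beta>)) {a..s}"
  proof -
    have "k t integrable_on {a..s}" using st by (auto intro: integrable_on_subinterval[OF has_integral_integrable[OF I1(1)]])
    moreover have "integral {a..s} (k t) + integral {s..t} (k t) = integral {a..t} (k t)"
      using st by (intro Henstock_Kurzweil_Integration.integral_combine has_integral_integrable[OF I1(1)]) auto
    ultimately show ?thesis using I1 by (simp add: has_integral_iff)
  qed
  \<comment> \<open>At r = s the convention \<open>0 powr x = 0\<close> gives
    \<open>k s s = 0\<close>, and the inequality \<open>k t r \<le> k s r\<close> fails at this one
    point, so the integrands are changed there.\<close>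
  define g where "g r = (if r = s then 0 else (k t r - k s r) *\<^sub>R u r)" for r
  have "integral {a..s} (\<lambda>r. (k t r - k s r) *\<^sub>R u r) = integral {a..s} g"
    by (rule integral_spike[of "{s}"]) (auto simp: g_def)
  moreover have "norm (integral {a..s} g) \<le> integral {a..s} (\<lambda>r. M * (if r = s then 0 else k s r - k t r))"
  proof (rule integral_norm_bound_integral)
    have "(\<lambda>r. (k t r - k s r) *\<^sub>R u r) integrable_on {a..s}"
      using integrable_diff[OF kt1(1) ks] by (simp add: scaleR_diff_left)
    then show "g integrable_on {a..s}"
      by (rule integrable_spike[of _ _ "{s}"]) (auto simp: g_def)
    have "(\<lambda>r. M * (k s r - k t r)) integrable_on {a..s}"
      using I1(3) I2 by (intro integrable_on_mult_right integrable_diff) (auto simp: has_integral_iff)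
    then show "(\<lambda>r. M * (if r = s then 0 else k s r - k t r)) integrable_on {a..s}"
      by (rule integrable_spike[of _ _ "{s}"]) auto
    fix r assume r: "r \<in> {a..s}"
    show "norm (g r) \<le> M * (if r = s then 0 else k s r - k t r)"
    proof (cases "r = s")
      case False
      then have "k t r \<le> k s r" unfolding k_def using r st \<beta> by (intro powr_mono2') auto
      then have "norm (g r) = (k s r - k t r) * norm (u r)" using False by (simp add: g_def)
      also have "\<dots> \<le> (k s r - k t r) * M" using \<open>k t r \<le> k s r\<close> M r st by (intro mult_left_mono) auto
      finally show ?thesis using False by (simp add: mult.commute)
    qed (simp add: g_def)
  qed
  moreover have "integral {a..s} (\<lambda>r. M * (if r = s then 0 else k s r - k t r)) = integral {a..s} (\<lambda>r. M * (k s r - k t r))"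
    by (rule integral_spike[of "{s}"]) auto
  moreover have "integral {a..s} (\<lambda>r. M * (k s r - k t r)) = M * ((s - a) powr \<beta> / \<beta> - ((t - a) powr \<beta> / \<beta> - (t - s) powr \<beta> / \<beta>))"
    by (intro integral_unique has_integral_mult_right has_integral_diff I1 I2)
  moreover have "\<dots> \<le> M * ((t - s) powr \<beta> / \<beta>)"
  proof -
    have "(s - a) powr \<beta> / \<beta> \<le> (t - a) powr \<beta> / \<beta>"
      using st \<beta> by (intro divide_right_mono powr_mono2) auto
    then show ?thesis using M0 by (intro mult_left_mono) auto
  qed
  ultimately have A: "norm (integral {a..s} (\<lambda>r. (k t r - k s r) *\<^sub>R u r)) \<le> M * ((t - s) powr \<beta> / \<beta>)"
    by (metis (no_types, lifting) order_trans)
  have "norm (integral {s..t} (\<lambda>r. k t r *\<^sub>R u r)) \<le> integral {s..t} (\<lambda>r. M * k t r)"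
    using kt1(2) has_integral_integrable[OF has_integral_mult_right[OF I1(2)]] M st
    by (intro integral_norm_bound_integral) (auto simp: k_def mult.commute[of _ "norm _"] intro!: mult_right_mono)
  also have "\<dots> = M * ((t - s) powr \<beta> / \<beta>)"
    by (intro integral_unique has_integral_mult_right I1)
  finally have B: "norm (integral {s..t} (\<lambda>r. k t r *\<^sub>R u r)) \<le> M * ((t - s) powr \<beta> / \<beta>)" .
  have "integral {a..t} (\<lambda>r. k t r *\<^sub>R u r) - integral {a..s} (\<lambda>r. k s r *\<^sub>R u r) =
      integral {a..s} (\<lambda>r. (k t r - k s r) *\<^sub>R u r) + integral {s..t} (\<lambda>r. k t r *\<^sub>R u r)"
  proof -
    have "integral {a..s} (\<lambda>r. (k t r - k s r) *\<^sub>R u r) = integral {a..s} (\<lambda>r. k t r *\<^sub>R u r) - integral {a..s} (\<lambda>r. k s r *\<^sub>R u r)"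
      unfolding scaleR_diff_left by (rule integral_diff[OF kt1(1) ks])
    then show ?thesis
      unfolding Henstock_Kurzweil_Integration.integral_combine[OF st(1,2) kt, symmetric] by simp
  qed
  then have C: "norm (integral {a..t} (\<lambda>r. k t r *\<^sub>R u r) - integral {a..s} (\<lambda>r. k s r *\<^sub>R u r)) \<le> 2 * (M * ((t - s) powr \<beta> / \<beta>))"
    using norm_triangle_mono[OF A B] by simp
  have G: "Gamma \<beta> > 0" using \<beta> by (intro Gamma_real_pos)
  have "norm (fint \<beta> a u t - fint \<beta> a u s) = (1 / Gamma \<beta>) * norm (integral {a..t} (\<lambda>r. k t r *\<^sub>R u r) - integral {a..s} (\<lambda>r. k s r *\<^sub>R u r))"
    using G by (simp add: fint_def k_def scaleR_diff_right[symmetric])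
  also have "\<dots> \<le> (1 / Gamma \<beta>) * (2 * (M * ((t - s) powr \<beta> / \<beta>)))"
    using G C by (intro mult_left_mono) auto
  also have "\<dots> = 2 * M / Gamma (\<beta> + 1) * (t - s) powr \<beta>"
    unfolding Gamma_plus1_pos[OF \<beta>(1)] by (simp add: mult_ac)
  finally show ?thesis .
qed

lemma tendsto_fint_uniform_limit:
  fixes u :: "real \<Rightarrow> 'a::banach"
  assumes \<gamma>: "\<gamma> > 0" and un: "\<And>n. continuous_on {a..b} (v n)" and lim: "uniform_limit {a..b} v u sequentially"
    and t: "t \<in> {a..b}"
  shows "(\<lambda>n. fint \<gamma> a (v n) t) \<longlonglongrightarrow> fint \<gamma> a u t"
proof (rule tendstoI)
  fix e :: real assume e: "e > 0"
  define C where "C = (b - a) powr \<gamma> / Gamma (\<gamma> + 1)"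
  have C: "C \<ge> 0" using \<gamma> by (simp add: C_def Gamma_real_pos less_imp_le)
  have u: "continuous_on {a..b} u"
    by (rule uniform_limit_theorem[OF _ lim]) (use un in auto)
  have "e / (C + 1) > 0" using e C by simp
  from uniform_limitD[OF lim this] show "\<forall>\<^sub>F n in sequentially. dist (fint \<gamma> a (v n) t) (fint \<gamma> a u t) < e"
  proof eventually_elim
    case (elim n)
    have "dist (fint \<gamma> a (v n) t) (fint \<gamma> a u t) = norm (fint \<gamma> a (\<lambda>s. v n s - u s) t)"
      using t by (subst fint_diff[OF \<gamma>]) (auto simp: dist_norm intro: continuous_on_subset[OF u] continuous_on_subset[OF un])
    also have "\<dots> \<le> C * (e / (C + 1))" unfolding C_def
      by (rule norm_fint_le_interval) (use \<gamma> t elim in \<open>auto simp: C_def dist_norm intro!: continuous_intros u un less_imp_le\<close>)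
    also have "\<dots> < e" using e C by (simp add: field_simps)
    finally show ?case .
  qed
qed

lemma frac_integral_eq_fint:
  fixes u :: "real \<Rightarrow> 'a::banach"
  assumes "\<gamma> > 0" "continuous_on {a..t} u" "a \<le> t"
  shows "frac_integral \<gamma> a u t = fint \<gamma> a u t"
  using Bochner_integral_weighted_continuous[OF integrable_kernel[OF assms(1)] assms(2,3)] assms(1)
  by (simp add: frac_integral_def fint_def)

section \<open>Products of fractional integrals\<close>

text \<open>Integration by parts with the antiderivative (t - s)^(-\<beta>) / \<beta> of the kernel.
  The boundary term at t vanishes, the one at a gives the last summand of the value, and the
  remaining integral is a Beta integral.\<close>

lemma has_integral_Marchaud_powr:
  fixes \<beta> p a t :: real
  assumes \<beta>: "0 < \<beta>" "\<beta> < 1" and p: "p > 0" and at: "a < t"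
  shows "((\<lambda>s. ((t - a) powr p - (s - a) powr p) * (t - s) powr (-1 - \<beta>)) has_integral
     Gamma (1 - \<beta>) / \<beta> * (Gamma (p + 1) / Gamma (p + 1 - \<beta>) * (t - a) powr (p - \<beta>)) - (t - a) powr (p - \<beta>) / \<beta>) {a..t}"
proof -
  define F where "F s = ((t - a) powr p - (s - a) powr p) * (t - s) powr (-\<beta>) / \<beta>" for s
  define F' where "F' s = ((t - a) powr p - (s - a) powr p) * (t - s) powr (-1 - \<beta>)
      - p / \<beta> * ((t - s) powr (- \<beta>) * (s - a) powr (p - 1))" for s
  have "(F' has_integral F t - F a) {a..t}"
  proof (rule fundamental_theorem_of_calculus_interior)
    show "continuous_on {a..t} F"
      unfolding continuous_on_eq_continuous_within
    proof
      fix s assume s: "s \<in> {a..t}"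
      show "continuous (at s within {a..t}) F"
      proof (cases "s = t")
        case False
        have "continuous_on {a..<t} F"
          unfolding F_def using p \<beta> by (intro continuous_on_divide continuous_on_mult continuous_on_powr' continuous_intros) auto
        then have "continuous (at s within {a..<t}) F"
          using s False by (simp add: continuous_on_eq_continuous_within)
        moreover have "at s within {a..<t} = at s within {a..t}"
          using s False by (intro at_within_nhd[of s "{..<t}"]) auto
        ultimately show ?thesis by simp
      next
        case True
        \<comment> \<open>Near t the difference of the powers is of order t - s, so \<open>F\<close>
          is a convergent difference quotient times (t - s)^(1-\<beta>), which tends to 0 because
          \<beta> < 1.\<close>
        have "((\<lambda>s. (s - a) powr p) has_real_derivative p * (t - a) powr (p - 1)) (at t within {a..t})"
          using at by (auto intro!: derivative_eq_intros)
        then have 1: "((\<lambda>s. ((s - a) powr p - (t - a) powr p) / (s - t)) \<longlongrightarrow> p * (t - a) powr (p - 1)) (at t within {a..t})"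
          by (simp add: has_field_derivative_iff)
        have "continuous_on {a..t} (\<lambda>s. (t - s) powr (1 - \<beta>))"
          using \<beta> by (intro continuous_on_powr' continuous_intros) auto
        then have 2: "((\<lambda>s. (t - s) powr (1 - \<beta>)) \<longlongrightarrow> 0) (at t within {a..t})"
          using at unfolding continuous_on_def by (auto dest!: bspec[of _ _ t])
        have "((\<lambda>s. ((s - a) powr p - (t - a) powr p) / (s - t) * (t - s) powr (1 - \<beta>) / \<beta>) \<longlongrightarrow> p * (t - a) powr (p - 1) * 0 / \<beta>) (at t within {a..t})"
          by (intro tendsto_intros 1 2) (use \<beta> in auto)
        moreover have "\<forall>\<^sub>F s in at t within {a..t}. ((s - a) powr p - (t - a) powr p) / (s - t) * (t - s) powr (1 - \<beta>) / \<beta> = F s"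
        proof (unfold eventually_at_filter, intro always_eventually allI impI)
          fix s assume s: "s \<noteq> t" "s \<in> {a..t}"
          have "(t - s) powr (1 - \<beta>) = (t - s) powr (1 + (- \<beta>))" by simp
          also have "\<dots> = (t - s) * (t - s) powr (- \<beta>)" using s unfolding powr_add by simp
          finally have 3: "(t - s) powr (1 - \<beta>) = (t - s) * (t - s) powr (- \<beta>)" .
          have 4: "((s - a) powr p - (t - a) powr p) / (s - t) * (t - s) = (t - a) powr p - (s - a) powr p"
            using s by (simp add: field_simps)
          show "((s - a) powr p - (t - a) powr p) / (s - t) * (t - s) powr (1 - \<beta>) / \<beta> = F s"
            unfolding F_def 3 4[symmetric] by (simp only: mult.assoc)
        qed
        ultimately have "(F \<longlongrightarrow> p * (t - a) powr (p - 1) * 0 / \<beta>) (at t within {a..t})"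
          by (rule Lim_transform_eventually)
        then show ?thesis using True by (simp add: continuous_within F_def)
      qed
    qed
    fix s assume s: "s \<in> {a<..<t}"
    have "((\<lambda>s. (s - a) powr p) has_real_derivative p * (s - a) powr (p - of_nat 1) * (1 - 0)) (at s)"
      using s by (intro DERIV_fun_powr DERIV_diff DERIV_ident DERIV_const) auto
    moreover have "((\<lambda>s. (t - s) powr (- \<beta>)) has_real_derivative - \<beta> * (t - s) powr (- \<beta> - of_nat 1) * (0 - 1)) (at s)"
      using s by (intro DERIV_fun_powr DERIV_diff DERIV_ident DERIV_const) auto
    ultimately have "(F has_real_derivative ((0 - p * (s - a) powr (p - of_nat 1) * (1 - 0)) * (t - s) powr (- \<beta>)
        + - \<beta> * (t - s) powr (- \<beta> - of_nat 1) * (0 - 1) * ((t - a) powr p - (s - a) powr p)) / \<beta>) (at s)"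
      unfolding F_def by (intro DERIV_cdivide DERIV_mult DERIV_diff DERIV_const)
    then have "(F has_real_derivative F' s) (at s)"
      unfolding F'_def using \<beta> by (simp add: add_divide_distrib diff_divide_distrib mult_ac minus_diff_commute[of \<beta> 1])
    then show "(F has_vector_derivative F' s) (at s)"
      by (simp add: has_real_derivative_iff_has_vector_derivative)
  qed (use at in auto)
  moreover have "F t - F a = - ((t - a) powr (p - \<beta>) / \<beta>)"
    using p at by (simp add: F_def powr_add[symmetric])
  ultimately have 1: "(F' has_integral (- ((t - a) powr (p - \<beta>) / \<beta>))) {a..t}" by simp
  have "((\<lambda>s. (t - s) powr (- \<beta>) * (s - a) powr (p - 1)) has_integral Beta p (1 - \<beta>) * (t - a) powr (p - \<beta>)) {a..t}"
    using has_integral_Beta_kernel[of "1 - \<beta>" "p - 1" a t] \<beta> p at by (simp add: algebra_simps)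
  from has_integral_add[OF 1 has_integral_mult_right[OF this, of "p / \<beta>"]]
  have "((\<lambda>s. ((t - a) powr p - (s - a) powr p) * (t - s) powr (-1 - \<beta>)) has_integral
      (- ((t - a) powr (p - \<beta>) / \<beta>)) + p / \<beta> * (Beta p (1 - \<beta>) * (t - a) powr (p - \<beta>))) {a..t}"
    by (simp add: F'_def)
  moreover have "p / \<beta> * (Beta p (1 - \<beta>) * (t - a) powr (p - \<beta>))
      = Gamma (1 - \<beta>) / \<beta> * (Gamma (p + 1) / Gamma (p + 1 - \<beta>) * (t - a) powr (p - \<beta>))"
    unfolding Gamma_plus1_pos[OF p] by (simp add: Beta_def algebra_simps)
  ultimately show ?thesis by (simp add: algebra_simps)
qed

text \<open>
  The last conjunct determines \<open>z\<close>: it is Marchaud's formula for the fractional derivative of a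
  product, rewritten with
  \<open>f\<^sub>t g\<^sub>t - f\<^sub>s g\<^sub>s = (f\<^sub>t - f\<^sub>s) g\<^sub>t + f\<^sub>t (g\<^sub>t - g\<^sub>s) - (f\<^sub>t - f\<^sub>s) (g\<^sub>t - g\<^sub>s)\<close>.
\<close>

definition product_deriv ::
  "('a::banach \<Rightarrow> 'a \<Rightarrow> 'a) \<Rightarrow> real \<Rightarrow> real \<Rightarrow> real \<Rightarrow> (real \<Rightarrow> 'a) \<Rightarrow> (real \<Rightarrow> 'a) \<Rightarrow> (real \<Rightarrow> 'a) \<Rightarrow> bool" where
  "product_deriv mul \<beta> a b u w z \<longleftrightarrow> continuous_on {a..b} z \<and> z a = 0 \<and>
     (\<forall>t\<in>{a..b}. mul (fint \<beta> a u t) (fint \<beta> a w t) = fint \<beta> a z t) \<and>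
     (\<forall>t\<in>{a<..b}. ((\<lambda>s. (t - s) powr (-1 - \<beta>) *\<^sub>R mul (fint \<beta> a u t - fint \<beta> a u s) (fint \<beta> a w t - fint \<beta> a w s))
        has_integral (Gamma (1 - \<beta>) / \<beta>) *\<^sub>R (mul (fint \<beta> a u t) (w t) + mul (u t) (fint \<beta> a w t) - z t)
          - ((t - a) powr (-\<beta>) / \<beta>) *\<^sub>R mul (fint \<beta> a u t) (fint \<beta> a w t)) {a..t})"

text \<open>Passing to the opposite multiplication turns additivity in the left factor into
  additivity in the right one, so only one of the two has to be proved.\<close>

lemma product_deriv_flip:
  "product_deriv (\<lambda>x y. mul y x) \<beta> a b w u z \<longleftrightarrow> product_deriv mul \<beta> a b u w z"
  unfolding product_deriv_def by (simp add: add.commute)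

lemma product_deriv_add_left:
  fixes mul :: "'a::banach \<Rightarrow> 'a \<Rightarrow> 'a"
  assumes \<beta>: "\<beta> > 0" and mul: "bounded_bilinear mul"
    and u: "continuous_on {a..b} u1" "continuous_on {a..b} u2"
    and 1: "product_deriv mul \<beta> a b u1 w z1" and 2: "product_deriv mul \<beta> a b u2 w z2"
  shows "product_deriv mul \<beta> a b (\<lambda>t. u1 t + u2 t) w (\<lambda>t. z1 t + z2 t)"
proof -
  interpret mul: bounded_bilinear mul by fact
  have z: "continuous_on {a..b} z1" "continuous_on {a..b} z2" using 1 2 by (auto simp: product_deriv_def)
  have fu: "fint \<beta> a (\<lambda>t. u1 t + u2 t) t = fint \<beta> a u1 t + fint \<beta> a u2 t" if "t \<in> {a..b}" for t
    using that by (intro fint_add \<beta>) (auto intro: continuous_on_subset[OF u(1)] continuous_on_subset[OF u(2)])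
  have fz: "fint \<beta> a (\<lambda>t. z1 t + z2 t) t = fint \<beta> a z1 t + fint \<beta> a z2 t" if "t \<in> {a..b}" for t
    using that by (intro fint_add \<beta>) (auto intro: continuous_on_subset[OF z(1)] continuous_on_subset[OF z(2)])
  show ?thesis
    unfolding product_deriv_def
  proof (intro conjI ballI)
    show "continuous_on {a..b} (\<lambda>t. z1 t + z2 t)" using z by (intro continuous_intros)
    show "z1 a + z2 a = 0" using 1 2 by (simp add: product_deriv_def)
    fix t assume t: "t \<in> {a..b}"
    then show "mul (fint \<beta> a (\<lambda>t. u1 t + u2 t) t) (fint \<beta> a w t) = fint \<beta> a (\<lambda>t. z1 t + z2 t) t"
      using 1 2 by (simp add: fu fz product_deriv_def mul.add_left)
  next
    fix t assume t: "t \<in> {a<..b}"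
    let ?k = "\<lambda>s. (t - s) powr (-1 - \<beta>)"
    have A: "((\<lambda>s. ?k s *\<^sub>R mul (fint \<beta> a u1 t - fint \<beta> a u1 s) (fint \<beta> a w t - fint \<beta> a w s)
        + ?k s *\<^sub>R mul (fint \<beta> a u2 t - fint \<beta> a u2 s) (fint \<beta> a w t - fint \<beta> a w s)) has_integral
        ((Gamma (1 - \<beta>) / \<beta>) *\<^sub>R (mul (fint \<beta> a u1 t) (w t) + mul (u1 t) (fint \<beta> a w t) - z1 t)
          - ((t - a) powr (-\<beta>) / \<beta>) *\<^sub>R mul (fint \<beta> a u1 t) (fint \<beta> a w t)) +
        ((Gamma (1 - \<beta>) / \<beta>) *\<^sub>R (mul (fint \<beta> a u2 t) (w t) + mul (u2 t) (fint \<beta> a w t) - z2 t)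
          - ((t - a) powr (-\<beta>) / \<beta>) *\<^sub>R mul (fint \<beta> a u2 t) (fint \<beta> a w t))) {a..t}" (is "(?f has_integral ?I) _")
      using 1 2 t by (intro has_integral_add) (auto simp: product_deriv_def)
    have B: "?I = (Gamma (1 - \<beta>) / \<beta>) *\<^sub>R (mul (fint \<beta> a (\<lambda>t. u1 t + u2 t) t) (w t) + mul (u1 t + u2 t) (fint \<beta> a w t) - (z1 t + z2 t))
          - ((t - a) powr (-\<beta>) / \<beta>) *\<^sub>R mul (fint \<beta> a (\<lambda>t. u1 t + u2 t) t) (fint \<beta> a w t)"
      using t by (simp add: fu mul.add_left scaleR_add_right scaleR_diff_right)
    have C: "?f s = ?k s *\<^sub>R mul (fint \<beta> a (\<lambda>t. u1 t + u2 t) t - fint \<beta> a (\<lambda>t. u1 t + u2 t) s) (fint \<beta> a w t - fint \<beta> a w s)"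
      if "s \<in> {a..t}" for s
      using that t by (simp add: fu mul.add_left mul.diff_left scaleR_add_right scaleR_diff_right)
    show "((\<lambda>s. ?k s *\<^sub>R mul (fint \<beta> a (\<lambda>t. u1 t + u2 t) t - fint \<beta> a (\<lambda>t. u1 t + u2 t) s) (fint \<beta> a w t - fint \<beta> a w s))
        has_integral (Gamma (1 - \<beta>) / \<beta>) *\<^sub>R (mul (fint \<beta> a (\<lambda>t. u1 t + u2 t) t) (w t) + mul (u1 t + u2 t) (fint \<beta> a w t) - (z1 t + z2 t))
          - ((t - a) powr (-\<beta>) / \<beta>) *\<^sub>R mul (fint \<beta> a (\<lambda>t. u1 t + u2 t) t) (fint \<beta> a w t)) {a..t}"
      unfolding B[symmetric] by (rule has_integral_eq[OF C A])
  qed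
qed

text \<open>Both fractional integrals are multiples of powers, with exponents p and q, and so is
  their product, with exponent p + q. The density \<open>z\<close> is its derivative of order
  \<beta>, again a multiple of a power, and the last conjunct is a combination of three Marchaud
  integrals of powers.\<close>

lemma product_deriv_monom:
  fixes mul :: "'a::banach \<Rightarrow> 'a \<Rightarrow> 'a"
  assumes \<beta>: "0 < \<beta>" "\<beta> < 1" and mul: "bounded_bilinear mul"
  shows "\<exists>z. product_deriv mul \<beta> a b (\<lambda>t. (t - a) ^ k *\<^sub>R x) (\<lambda>t. (t - a) ^ l *\<^sub>R y) z"
proof -
  interpret mul: bounded_bilinear mul by fact
  define p q where "p = real k + \<beta>" and "q = real l + \<beta>"
  have pq: "p > 0" "q > 0" using \<beta> by (auto simp: p_def q_def)
  \<comment> \<open>\<open>c n\<close> is the coefficient of \<open>J^\<beta>\<close> on (t - a)^n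
    and \<open>D r\<close> that of the derivative of order \<beta> on (t - a)^r; they are reciprocal
    at r = n + \<beta>.\<close>
  define c where "c n = fact n / Gamma (real n + 1 + \<beta>)" for n :: nat
  define A where "A = c k * c l"
  define D where "D r = Gamma (r + 1) / Gamma (r + 1 - \<beta>)" for r
  define z where "z t = (A * D (p + q) * (t - a) powr (p + q - \<beta>)) *\<^sub>R mul x y" for t
  have Gpos: "Gamma (p + q + 1 - \<beta>) > 0" "Gamma (p + q + 1) > 0"
    using \<beta> by (auto intro!: Gamma_real_pos simp: p_def q_def)
  have cD: "c n * D (real n + \<beta>) = 1" for n
  proof -
    have "Gamma (real n + 1 + \<beta>) > 0" using \<beta> by (intro Gamma_real_pos) auto
    moreover have "Gamma (real n + 1) = fact n" using Gamma_fact[of n, where 'a=real] by (simp add: add.commute)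
    ultimately show ?thesis by (simp add: c_def D_def add_ac)
  qed
  have cDk: "c k * D p = 1" "c l * D q = 1" using cD[of k] cD[of l] by (simp_all add: p_def q_def)
  have fu: "fint \<beta> a (\<lambda>t. (t - a) ^ k *\<^sub>R x) t = (c k * (t - a) powr p) *\<^sub>R x"
    and fw: "fint \<beta> a (\<lambda>t. (t - a) ^ l *\<^sub>R y) t = (c l * (t - a) powr q) *\<^sub>R y" if "a \<le> t" for t
    using \<beta> that by (auto simp: fint_monom c_def p_def q_def)
  have fz: "fint \<beta> a z t = (A * (t - a) powr (p + q)) *\<^sub>R mul x y" if "a \<le> t" for t
  proof -
    have "fint \<beta> a z t = fint \<beta> a (\<lambda>s. (s - a) powr (p + q - \<beta>) *\<^sub>R ((A * D (p + q)) *\<^sub>R mul x y)) t"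
      by (intro fint_cong) (simp add: z_def mult.commute)
    also have "\<dots> = (Gamma (p + q - \<beta> + 1) / Gamma (p + q - \<beta> + 1 + \<beta>) * (t - a) powr (p + q - \<beta> + \<beta>)) *\<^sub>R (A * D (p + q)) *\<^sub>R mul x y"
      using \<beta> that by (intro fint_powr) (auto simp: p_def q_def)
    also have "Gamma (p + q - \<beta> + 1) / Gamma (p + q - \<beta> + 1 + \<beta>) = 1 / D (p + q)"
      by (simp add: D_def algebra_simps)
    finally show ?thesis using Gpos by (simp add: D_def)
  qed
  have "product_deriv mul \<beta> a b (\<lambda>t. (t - a) ^ k *\<^sub>R x) (\<lambda>t. (t - a) ^ l *\<^sub>R y) z"
    unfolding product_deriv_def
  proof (intro conjI ballI)
    show "continuous_on {a..b} z"
      unfolding z_def using \<beta> by (intro continuous_on_scaleR continuous_on_mult continuous_on_powr' continuous_intros) (auto simp: p_def q_def)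
    show "z a = 0" by (simp add: z_def)
    fix t assume t: "t \<in> {a..b}"
    then show "mul (fint \<beta> a (\<lambda>t. (t - a) ^ k *\<^sub>R x) t) (fint \<beta> a (\<lambda>t. (t - a) ^ l *\<^sub>R y) t) = fint \<beta> a z t"
      by (simp add: fu fw fz A_def mul.scaleR_left mul.scaleR_right powr_add mult_ac)
  next
    fix t assume t: "t \<in> {a<..b}"
    define T where "T = t - a"
    have T: "T > 0" using t by (simp add: T_def)
    define G where "G = Gamma (1 - \<beta>) / \<beta>"
    define M where "M r = G * (D r * T powr (r - \<beta>)) - T powr (r - \<beta>) / \<beta>" for r
    have M: "((\<lambda>s. (T powr r - (s - a) powr r) * (t - s) powr (-1 - \<beta>)) has_integral M r) {a..t}" if "r > 0" for r
      using has_integral_Marchaud_powr[OF \<beta> that, of a t] t by (simp add: M_def G_def D_def T_def)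
    \<comment> \<open>With S = s - a: (T^p - S^p)(T^q - S^q) = T^q (T^p - S^p) + T^p (T^q - S^q) -
      (T^(p+q) - S^(p+q)).\<close>
    have "((\<lambda>s. T powr q * ((T powr p - (s - a) powr p) * (t - s) powr (-1 - \<beta>)) + T powr p * ((T powr q - (s - a) powr q) * (t - s) powr (-1 - \<beta>))
        - (T powr (p + q) - (s - a) powr (p + q)) * (t - s) powr (-1 - \<beta>)) has_integral T powr q * M p + T powr p * M q - M (p + q)) {a..t}"
      using pq by (intro has_integral_diff has_integral_add has_integral_mult_right M) auto
    then have "((\<lambda>s. (t - s) powr (-1 - \<beta>) * ((T powr p - (s - a) powr p) * (T powr q - (s - a) powr q))) has_integral T powr q * M p + T powr p * M q - M (p + q)) {a..t}"
      by (rule has_integral_eq[rotated]) (simp add: powr_add algebra_simps)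
    from has_integral_scaleR_left[OF has_integral_mult_right[OF this, of A], of "mul x y"]
    have I: "((\<lambda>s. (A * ((t - s) powr (-1 - \<beta>) * ((T powr p - (s - a) powr p) * (T powr q - (s - a) powr q)))) *\<^sub>R mul x y) has_integral
       (A * (T powr q * M p + T powr p * M q - M (p + q))) *\<^sub>R mul x y) {a..t}" .
    have e1: "T powr q * T powr (p - \<beta>) = T powr (p + q - \<beta>)" "T powr p * T powr (q - \<beta>) = T powr (p + q - \<beta>)"
      using T by (simp_all add: powr_add[symmetric] algebra_simps)
    have e2: "T ^ k = T powr (p - \<beta>)" "T ^ l = T powr (q - \<beta>)" using T by (simp_all add: p_def q_def powr_realpow)
    have "A * (T powr q * M p + T powr p * M q - M (p + q)) =
       A * (G * (D p + D q - D (p + q)) * T powr (p + q - \<beta>) - T powr (p + q - \<beta>) / \<beta>)"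
      unfolding M_def e1[symmetric] e1(2)[symmetric]
      by (simp add: algebra_simps e1)
    also have "\<dots> = G * (c k * c l * D p * T powr (p + q - \<beta>) + c k * c l * D q * T powr (p + q - \<beta>) - A * D (p + q) * T powr (p + q - \<beta>)) - A * (T powr (p + q - \<beta>) / \<beta>)"
      by (simp add: A_def algebra_simps)
    also have "c k * c l * D p * T powr (p + q - \<beta>) = c l * T powr q * T ^ k"
      using cDk e1 e2 by (metis mult.assoc mult.commute mult_1)
    also have "c k * c l * D q * T powr (p + q - \<beta>) = c k * T powr p * T ^ l"
      using cDk e1 e2 by (metis mult.assoc mult.commute mult_1)
    also have "A * (T powr (p + q - \<beta>) / \<beta>) = T powr (-\<beta>) / \<beta> * (c k * T powr p * (c l * T powr q))"
      using T by (simp add: A_def powr_add powr_diff powr_minus field_simps)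
    finally have J: "A * (T powr q * M p + T powr p * M q - M (p + q)) = 
       G * (c l * T powr q * T ^ k + c k * T powr p * T ^ l - A * D (p + q) * T powr (p + q - \<beta>)) - T powr (-\<beta>) / \<beta> * (c k * T powr p * (c l * T powr q))" .
    show "((\<lambda>s. (t - s) powr (-1 - \<beta>) *\<^sub>R mul (fint \<beta> a (\<lambda>t. (t - a) ^ k *\<^sub>R x) t - fint \<beta> a (\<lambda>t. (t - a) ^ k *\<^sub>R x) s)
           (fint \<beta> a (\<lambda>t. (t - a) ^ l *\<^sub>R y) t - fint \<beta> a (\<lambda>t. (t - a) ^ l *\<^sub>R y) s))
        has_integral (Gamma (1 - \<beta>) / \<beta>) *\<^sub>R (mul (fint \<beta> a (\<lambda>t. (t - a) ^ k *\<^sub>R x) t) ((t - a) ^ l *\<^sub>R y) + mul ((t - a) ^ k *\<^sub>R x) (fint \<beta> a (\<lambda>t. (t - a) ^ l *\<^sub>R y) t) - z t)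
          - ((t - a) powr (-\<beta>) / \<beta>) *\<^sub>R mul (fint \<beta> a (\<lambda>t. (t - a) ^ k *\<^sub>R x) t) (fint \<beta> a (\<lambda>t. (t - a) ^ l *\<^sub>R y) t)) {a..t}"
    proof (rule has_integral_eq_rhs[OF has_integral_eq[OF _ I] sym])
      fix s assume s: "s \<in> {a..t}"
      show "(A * ((t - s) powr (-1 - \<beta>) * ((T powr p - (s - a) powr p) * (T powr q - (s - a) powr q)))) *\<^sub>R mul x y =
        (t - s) powr (-1 - \<beta>) *\<^sub>R mul (fint \<beta> a (\<lambda>t. (t - a) ^ k *\<^sub>R x) t - fint \<beta> a (\<lambda>t. (t - a) ^ k *\<^sub>R x) s)
           (fint \<beta> a (\<lambda>t. (t - a) ^ l *\<^sub>R y) t - fint \<beta> a (\<lambda>t. (t - a) ^ l *\<^sub>R y) s)"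
        using s t unfolding T_def
        by (simp add: fu fw A_def scaleR_diff_left[symmetric] right_diff_distrib[symmetric] mul.scaleR_left mul.scaleR_right mult_ac)
    next
      show "(A * (T powr q * M p + T powr p * M q - M (p + q))) *\<^sub>R mul x y =
       (Gamma (1 - \<beta>) / \<beta>) *\<^sub>R (mul (fint \<beta> a (\<lambda>t. (t - a) ^ k *\<^sub>R x) t) ((t - a) ^ l *\<^sub>R y) + mul ((t - a) ^ k *\<^sub>R x) (fint \<beta> a (\<lambda>t. (t - a) ^ l *\<^sub>R y) t) - z t)
          - ((t - a) powr (-\<beta>) / \<beta>) *\<^sub>R mul (fint \<beta> a (\<lambda>t. (t - a) ^ k *\<^sub>R x) t) (fint \<beta> a (\<lambda>t. (t - a) ^ l *\<^sub>R y) t)"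
        unfolding J using t
        by (simp add: fu fw z_def T_def[symmetric] G_def[symmetric] mul.scaleR_left mul.scaleR_right scaleR_add_left scaleR_diff_left scaleR_add_right scaleR_diff_right algebra_simps)
    qed
  qed
  then show ?thesis by blast
qed

lemma product_deriv_vec_poly:
  fixes mul :: "'a::banach \<Rightarrow> 'a \<Rightarrow> 'a"
  assumes \<beta>: "0 < \<beta>" "\<beta> < 1" and mul: "bounded_bilinear mul" and u: "u \<in> vec_poly a" and w: "w \<in> vec_poly a"
  shows "\<exists>z. product_deriv mul \<beta> a b u w z"
  using u
proof (induction rule: vec_poly.induct)
  case (vec_poly_monom k x)
  show ?case using w
  proof (induction rule: vec_poly.induct)
    case (vec_poly_monom l y)
    show ?case by (rule product_deriv_monom[OF \<beta> mul])
  next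
    case (vec_poly_add w1 w2)
    then obtain z1 z2 where z: "product_deriv mul \<beta> a b (\<lambda>t. (t - a) ^ k *\<^sub>R x) w1 z1" "product_deriv mul \<beta> a b (\<lambda>t. (t - a) ^ k *\<^sub>R x) w2 z2"
      by blast
    note flip = product_deriv_flip[where mul = mul]
    have "product_deriv (\<lambda>x y. mul y x) \<beta> a b (\<lambda>t. w1 t + w2 t) (\<lambda>t. (t - a) ^ k *\<^sub>R x) (\<lambda>t. z1 t + z2 t)"
      by (rule product_deriv_add_left[OF \<beta>(1) bounded_bilinear.flip[OF mul] continuous_on_vec_poly[OF vec_poly_add.hyps(1)]
          continuous_on_vec_poly[OF vec_poly_add.hyps(2)] flip[THEN iffD2, OF z(1)] flip[THEN iffD2, OF z(2)]])
    then have "product_deriv mul \<beta> a b (\<lambda>t. (t - a) ^ k *\<^sub>R x) (\<lambda>t. w1 t + w2 t) (\<lambda>t. z1 t + z2 t)"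
      by (rule flip[THEN iffD1])
    then show ?case by blast
  qed
next
  case (vec_poly_add u1 u2)
  then obtain z1 z2 where "product_deriv mul \<beta> a b u1 w z1" "product_deriv mul \<beta> a b u2 w z2" by blast
  then have "product_deriv mul \<beta> a b (\<lambda>t. u1 t + u2 t) w (\<lambda>t. z1 t + z2 t)"
    using vec_poly_add.hyps by (intro product_deriv_add_left \<beta> mul continuous_on_vec_poly)
  then show ?case by blast
qed

text \<open>Marchaud's formula is solved for \<open>z t\<close>. Hoelder continuity makes the
  integrand at most a constant times (t - s)^(2\<beta> - 1 - \<beta>) = (t - s)^(\<beta> - 1), which
  is integrable. The constant does not depend on the polynomials, so the estimate survives a
  limit.\<close>

lemma norm_product_deriv_le:
  fixes mul :: "'a::banach \<Rightarrow> 'a \<Rightarrow> 'a"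
  assumes \<beta>: "0 < \<beta>" "\<beta> < 1" and mul: "bounded_bilinear mul" and ab: "a < b"
  obtains K where "K \<ge> 0" "\<And>u w z U W t. continuous_on {a..b} u \<Longrightarrow> continuous_on {a..b} w \<Longrightarrow> product_deriv mul \<beta> a b u w z \<Longrightarrow>
     (\<And>t. t \<in> {a..b} \<Longrightarrow> norm (u t) \<le> U) \<Longrightarrow> (\<And>t. t \<in> {a..b} \<Longrightarrow> norm (w t) \<le> W) \<Longrightarrow> t \<in> {a..b} \<Longrightarrow> norm (z t) \<le> K * (U * W)"
proof -
  interpret mul: bounded_bilinear mul by fact
  obtain B where B: "B > 0" "\<And>x y. norm (mul x y) \<le> norm x * norm y * B" using mul.pos_bounded by blast
  define L where "L = (b - a) powr \<beta>"
  define g where "g = Gamma (\<beta> + 1)"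
  define H where "H = 2 / g"
  define C where "C = L / g"
  define G where "G = Gamma (1 - \<beta>) / \<beta>"
  have g: "g > 0" unfolding g_def using \<beta> by (intro Gamma_real_pos) auto
  have G: "G > 0" unfolding G_def using \<beta> by (intro divide_pos_pos Gamma_real_pos) auto
  have L: "L \<ge> 0" by (simp add: L_def)
  have C: "C \<ge> 0" using L g by (simp add: C_def)
  \<comment> \<open>The first term comes from the two mixed products, the second from the boundary
    term and the third from the Hoelder integral; the last two carry the factor 1 / \<open>G\<close>
    from solving for \<open>z t\<close>.\<close>
  define K where "K = 2 * B * C + (B * C / g / \<beta> + B * H\<^sup>2 * (L / \<beta>)) / G"
  have K: "K \<ge> 0" using B C g L G \<beta> by (auto simp: K_def intro!: add_nonneg_nonneg divide_nonneg_nonneg mult_nonneg_nonneg)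
  have "norm (z t) \<le> K * (U * W)"
    if u: "continuous_on {a..b} u" and w: "continuous_on {a..b} w" and z: "product_deriv mul \<beta> a b u w z"
      and U: "\<And>t. t \<in> {a..b} \<Longrightarrow> norm (u t) \<le> U" and W: "\<And>t. t \<in> {a..b} \<Longrightarrow> norm (w t) \<le> W" and t: "t \<in> {a..b}"
    for u w z U W t
  proof -
    have UW: "U \<ge> 0" "W \<ge> 0" using U[of a] W[of a] ab by (auto intro: order_trans[OF norm_ge_zero])
    show ?thesis
    proof (cases "t = a")
      \<comment> \<open>Marchaud's formula is stated only for t > a; at a the value is fixed by
        \<open>z a = 0\<close>.\<close>
      case True
      then show ?thesis using z K UW by (simp add: product_deriv_def)
    next
      case False
      then have t': "t \<in> {a<..b}" using t by auto
      define k where "k s = (t - s) powr (-1 - \<beta>)" for s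
      define fu fw where "fu = fint \<beta> a u" and "fw = fint \<beta> a w"
      define R where "R s = k s *\<^sub>R mul (fu t - fu s) (fw t - fw s)" for s
      define S where "S = (t - a) powr \<beta>"
      have S: "0 < S" "S \<le> L" unfolding S_def L_def using t' \<beta> by (auto intro!: powr_mono2)
      have bound: "norm (mul x y) \<le> B * (X * Y)" if "norm x \<le> X" "norm y \<le> Y" for x y X Y
      proof -
        have "norm x * norm y * B \<le> X * Y * B"
          using that B(1) by (intro mult_right_mono mult_mono) (auto intro: order_trans[OF norm_ge_zero])
        then show ?thesis using B(2)[of x y] by (simp add: mult_ac)
      qed
      have nf: "norm (fu t) \<le> U * S / g" "norm (fw t) \<le> W * S / g"
        unfolding fu_def fw_def S_def g_def using t U W \<beta>(1)
        by (auto intro!: norm_fint_le continuous_on_subset[OF u] continuous_on_subset[OF w])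
      have "U * S / g \<le> U * C" "W * S / g \<le> W * C" 
        using S UW g by (auto simp: C_def intro!: divide_right_mono mult_left_mono)
      then have nf': "norm (fu t) \<le> U * C" "norm (fw t) \<le> W * C" using nf by auto
      have I: "(R has_integral G *\<^sub>R (mul (fu t) (w t) + mul (u t) (fw t) - z t) - ((t - a) powr (-\<beta>) / \<beta>) *\<^sub>R mul (fu t) (fw t)) {a..t}"
        using z t' unfolding product_deriv_def R_def[abs_def] k_def G_def fu_def fw_def by blast
      have J: "((\<lambda>s. B * H\<^sup>2 * (U * W) * (t - s) powr (\<beta> - 1)) has_integral B * H\<^sup>2 * (U * W) * (S / \<beta>)) {a..t}"
        unfolding S_def using \<beta> t by (intro has_integral_mult_right has_integral_kernel) auto
      have "norm (integral {a..t} R) \<le> integral {a..t} (\<lambda>s. B * H\<^sup>2 * (U * W) * (t - s) powr (\<beta> - 1))"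
      proof (rule integral_norm_bound_integral)
        fix s assume s: "s \<in> {a..t}"
        have "norm (fu t - fu s) \<le> 2 * U / g * (t - s) powr \<beta>" "norm (fw t - fw s) \<le> 2 * W / g * (t - s) powr \<beta>"
          unfolding fu_def fw_def g_def
          by (rule fint_Holder[OF \<beta>(1) less_imp_le[OF \<beta>(2)] u U] fint_Holder[OF \<beta>(1) less_imp_le[OF \<beta>(2)] w W];
              use s t in simp)+
        from bound[OF this] have "norm (R s) \<le> k s * (B * (2 * U / g * (t - s) powr \<beta> * (2 * W / g * (t - s) powr \<beta>)))"
          unfolding R_def norm_scaleR k_def abs_of_nonneg[OF powr_ge_zero] by (intro mult_left_mono) auto
        also have "\<dots> = B * H\<^sup>2 * (U * W) * (k s * ((t - s) powr \<beta> * (t - s) powr \<beta>))"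
          by (simp add: H_def power2_eq_square)
        also have "k s * ((t - s) powr \<beta> * (t - s) powr \<beta>) = (t - s) powr (\<beta> - 1)"
          by (simp add: k_def powr_add[symmetric])
        finally show "norm (R s) \<le> B * H\<^sup>2 * (U * W) * (t - s) powr (\<beta> - 1)" .
      qed (use I J in \<open>auto simp: has_integral_iff\<close>)
      also have "\<dots> = B * H\<^sup>2 * (U * W) * (S / \<beta>)" using J by (rule integral_unique)
      also have "\<dots> \<le> B * H\<^sup>2 * (U * W) * (L / \<beta>)"
        using S B UW \<beta> by (intro mult_left_mono divide_right_mono) auto
      finally have 1: "norm (integral {a..t} R) \<le> B * H\<^sup>2 * (U * W) * (L / \<beta>)" .
      have "norm (((t - a) powr (-\<beta>) / \<beta>) *\<^sub>R mul (fu t) (fw t)) = norm (mul (fu t) (fw t)) / S / \<beta>"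
        using \<beta> t' by (simp add: S_def powr_minus divide_inverse mult_ac)
      \<comment> \<open>One factor keeps its local bound proportional to \<open>S\<close>, which
        cancels the singular weight; the other takes the global bound.\<close>
      also have "\<dots> \<le> B * (U * S / g * (W * C)) / S / \<beta>"
        using S \<beta> by (intro divide_right_mono bound nf nf') auto
      also have "\<dots> = B * C / g / \<beta> * (U * W)" using S by simp
      finally have 2: "norm (((t - a) powr (-\<beta>) / \<beta>) *\<^sub>R mul (fu t) (fw t)) \<le> B * C / g / \<beta> * (U * W)" .
      have 3: "norm (mul (fu t) (w t)) \<le> B * (U * C * W)" "norm (mul (u t) (fw t)) \<le> B * (U * (W * C))"
        using U W t by (auto intro!: bound nf')
      define Q where "Q = ((t - a) powr (-\<beta>) / \<beta>) *\<^sub>R mul (fu t) (fw t)"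
      have "G *\<^sub>R z t = G *\<^sub>R (mul (fu t) (w t) + mul (u t) (fw t)) - (integral {a..t} R + Q)"
        using integral_unique[OF I] by (simp add: Q_def scaleR_diff_right)
      then have "z t = (1 / G) *\<^sub>R (G *\<^sub>R (mul (fu t) (w t) + mul (u t) (fw t)) - (integral {a..t} R + Q))"
        using G by (metis less_irrefl nonzero_eq_divide_eq scaleR_one scaleR_scaleR)
      then have "z t = (mul (fu t) (w t) + mul (u t) (fw t)) - (1 / G) *\<^sub>R (integral {a..t} R + Q)"
        using G by (simp add: scaleR_diff_right)
      then have "norm (z t) \<le> norm (mul (fu t) (w t) + mul (u t) (fw t)) + norm ((1 / G) *\<^sub>R (integral {a..t} R + Q))"
        by (metis norm_triangle_ineq4)
      also have "\<dots> \<le> (B * (U * C * W) + B * (U * (W * C))) + (1 / G) * (B * H\<^sup>2 * (U * W) * (L / \<beta>) + B * C / g / \<beta> * (U * W))"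
      proof (rule add_mono)
        show "norm (mul (fu t) (w t) + mul (u t) (fw t)) \<le> B * (U * C * W) + B * (U * (W * C))"
          using 3 by (rule norm_triangle_mono)
        have "norm (integral {a..t} R + Q) \<le> B * H\<^sup>2 * (U * W) * (L / \<beta>) + B * C / g / \<beta> * (U * W)"
          using 1 2 unfolding Q_def by (rule norm_triangle_mono)
        then show "norm ((1 / G) *\<^sub>R (integral {a..t} R + Q)) \<le> (1 / G) * (B * H\<^sup>2 * (U * W) * (L / \<beta>) + B * C / g / \<beta> * (U * W))"
          using G by (simp add: divide_right_mono)
      qed
      also have "\<dots> = K * (U * W)"
        by (simp add: K_def algebra_simps add_divide_distrib)
      finally show ?thesis .
    qed
  qed
  with K show ?thesis by (rule that)
qed

lemma fint_1_mult:
  fixes mul :: "'a::banach \<Rightarrow> 'a \<Rightarrow> 'a"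
  assumes mul: "bounded_bilinear mul" and ab: "a \<le> b" and u: "continuous_on {a..b} u" and w: "continuous_on {a..b} w"
    and t: "t \<in> {a..b}"
  shows "mul (fint 1 a u t) (fint 1 a w t) = fint 1 a (\<lambda>t. mul (fint 1 a u t) (w t) + mul (u t) (fint 1 a w t)) t"
proof -
  interpret mul: bounded_bilinear mul by fact
  have "((\<lambda>t. mul (fint 1 a u t) (fint 1 a w t)) has_vector_derivative mul (fint 1 a u s) (w s) + mul (u s) (fint 1 a w s)) (at s within {a..b})"
    if "s \<in> {a..b}" for s
    by (intro mul.has_vector_derivative has_vector_derivative_fint_1 u w that)
  from fint_1_derivative[OF this t] show ?thesis by (simp add: mul.zero_left)
qed

lemma uniform_limit_dist_bound:
  fixes f :: "nat \<Rightarrow> 'b \<Rightarrow> 'a::metric_space"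
  assumes "d \<longlonglongrightarrow> 0" "\<And>n t. t \<in> S \<Longrightarrow> dist (f n t) (l t) < d n"
  shows "uniform_limit S f l sequentially"
proof (rule uniform_limitI)
  fix e :: real assume "e > 0"
  from order_tendstoD(2)[OF assms(1) this] show "\<forall>\<^sub>F n in sequentially. \<forall>x\<in>S. dist (f n x) (l x) < e"
  proof eventually_elim
    case (elim n)
    show ?case using assms(2) elim by (blast intro: less_trans)
  qed
qed

text \<open>Polynomial approximants of \<open>u\<close> and \<open>w\<close> have densities
  \<open>z n\<close> that form a uniform Cauchy sequence, because the bound for polynomials applies
  to the differences of the approximants as well.\<close>

theorem fint_mult:
  fixes mul :: "'a::banach \<Rightarrow> 'a \<Rightarrow> 'a"
  assumes \<beta>: "0 < \<beta>" "\<beta> \<le> 1" and mul: "bounded_bilinear mul" and ab: "a < b"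
  shows "\<exists>K\<ge>0. \<forall>u w U W. continuous_on {a..b} u \<longrightarrow> continuous_on {a..b} w \<longrightarrow>
     (\<forall>t\<in>{a..b}. norm (u t) \<le> U) \<longrightarrow> (\<forall>t\<in>{a..b}. norm (w t) \<le> W) \<longrightarrow>
     (\<exists>z. continuous_on {a..b} z \<and> (\<forall>t\<in>{a..b}. mul (fint \<beta> a u t) (fint \<beta> a w t) = fint \<beta> a z t) \<and>
       (\<forall>t\<in>{a..b}. norm (z t) \<le> K * (U * W)))"
proof (cases "\<beta> = 1")
  \<comment> \<open>Gamma has a pole at 1 - \<beta> = 0, so order one is settled by the ordinary
    product rule.\<close>
  case True
  interpret mul: bounded_bilinear mul by fact
  obtain B where B: "B > 0" "\<And>x y. norm (mul x y) \<le> norm x * norm y * B" using mul.pos_bounded by blast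
  define K where "K = 2 * B * (b - a)"
  have "\<exists>z. continuous_on {a..b} z \<and> (\<forall>t\<in>{a..b}. mul (fint 1 a u t) (fint 1 a w t) = fint 1 a z t) \<and>
       (\<forall>t\<in>{a..b}. norm (z t) \<le> K * (U * W))"
    if u: "continuous_on {a..b} u" and w: "continuous_on {a..b} w"
      and U: "\<forall>t\<in>{a..b}. norm (u t) \<le> U" and W: "\<forall>t\<in>{a..b}. norm (w t) \<le> W" for u w U W
  proof (intro exI[of _ "\<lambda>t. mul (fint 1 a u t) (w t) + mul (u t) (fint 1 a w t)"] conjI ballI)
    have c: "continuous_on {a..b} (fint 1 a u)" "continuous_on {a..b} (fint 1 a w)"
      using ab u w by (auto intro!: continuous_on_fint)
    show "continuous_on {a..b} (\<lambda>t. mul (fint 1 a u t) (w t) + mul (u t) (fint 1 a w t))"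
      by (intro continuous_intros mul.continuous_on u w c)
    show "mul (fint 1 a u t) (fint 1 a w t) = fint 1 a (\<lambda>t. mul (fint 1 a u t) (w t) + mul (u t) (fint 1 a w t)) t"
      if "t \<in> {a..b}" for t
      using fint_1_mult[OF mul _ u w that] ab by simp
    fix t assume t: "t \<in> {a..b}"
    have UW: "U \<ge> 0" "W \<ge> 0" using bspec[OF U, of a] bspec[OF W, of a] ab by (auto intro: order_trans[OF norm_ge_zero])
    have "norm (fint 1 a u t) \<le> (b - a) * U" "norm (fint 1 a w t) \<le> (b - a) * W"
      using norm_fint_le_interval[of 1 a b u U t] norm_fint_le_interval[of 1 a b w W t] u w U W t ab
      by (auto simp: Gamma_plus1_pos[of 1, simplified])
    then have "norm (mul (fint 1 a u t) (w t)) \<le> (b - a) * U * W * B" "norm (mul (u t) (fint 1 a w t)) \<le> U * ((b - a) * W) * B"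
      using U W UW t B(1) ab by (auto intro!: order_trans[OF B(2)] mult_right_mono mult_mono)
    then have "norm (mul (fint 1 a u t) (w t) + mul (u t) (fint 1 a w t)) \<le> (b - a) * U * W * B + U * ((b - a) * W) * B"
      by (rule norm_triangle_mono)
    also have "\<dots> = K * (U * W)" by (simp add: K_def)
    finally show "norm (mul (fint 1 a u t) (w t) + mul (u t) (fint 1 a w t)) \<le> K * (U * W)" .
  qed
  moreover have "K \<ge> 0" using B ab by (simp add: K_def)
  ultimately show ?thesis unfolding True by blast
next
  case False
  with \<beta> have \<beta>1: "\<beta> < 1" by simp
  interpret mul: bounded_bilinear mul by fact
  obtain K where K0: "K \<ge> 0" and K: "\<And>u w z U W t. continuous_on {a..b} u \<Longrightarrow> continuous_on {a..b} w \<Longrightarrow> product_deriv mul \<beta> a b u w z \<Longrightarrow>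
     (\<And>t. t \<in> {a..b} \<Longrightarrow> norm (u t) \<le> U) \<Longrightarrow> (\<And>t. t \<in> {a..b} \<Longrightarrow> norm (w t) \<le> W) \<Longrightarrow> t \<in> {a..b} \<Longrightarrow> norm (z t) \<le> K * (U * W)"
    by (fact norm_product_deriv_le[OF \<beta>(1) \<beta>1 mul ab])
  have "\<exists>z. continuous_on {a..b} z \<and> (\<forall>t\<in>{a..b}. mul (fint \<beta> a u t) (fint \<beta> a w t) = fint \<beta> a z t) \<and>
       (\<forall>t\<in>{a..b}. norm (z t) \<le> K * (U * W))"
    if u: "continuous_on {a..b} u" and w: "continuous_on {a..b} w"
      and U: "\<forall>t\<in>{a..b}. norm (u t) \<le> U" and W: "\<forall>t\<in>{a..b}. norm (w t) \<le> W" for u w U W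
  proof -
    have UW: "U \<ge> 0" "W \<ge> 0" using bspec[OF U, of a] bspec[OF W, of a] ab by (auto intro: order_trans[OF norm_ge_zero])
    define d where "d n = inverse (real (Suc n))" for n
    \<comment> \<open>Errors of at most 1 make \<open>U + 1\<close> and \<open>W + 1\<close> bounds
      for all approximants at once.\<close>
    have d: "0 < d n" "d n \<le> 1" for n by (auto simp: d_def field_simps)
    have d0: "d \<longlonglongrightarrow> 0" unfolding d_def by (rule LIMSEQ_inverse_real_of_nat)
    have "\<forall>n. \<exists>p. p \<in> vec_poly a \<and> (\<forall>t\<in>{a..b}. norm (u t - p t) < d n)"
      using vec_poly_approx[of a b u] ab u d by (metis less_imp_le)
    then obtain p where p: "\<And>n. p n \<in> vec_poly a" "\<And>n t. t \<in> {a..b} \<Longrightarrow> norm (u t - p n t) < d n" by metis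
    have "\<forall>n. \<exists>q. q \<in> vec_poly a \<and> (\<forall>t\<in>{a..b}. norm (w t - q t) < d n)"
      using vec_poly_approx[of a b w] ab w d by (metis less_imp_le)
    then obtain q where q: "\<And>n. q n \<in> vec_poly a" "\<And>n t. t \<in> {a..b} \<Longrightarrow> norm (w t - q n t) < d n" by metis
    note cont = continuous_on_vec_poly[OF p(1), of "{a..b}"] continuous_on_vec_poly[OF q(1), of "{a..b}"]
    have pU: "norm (p n t) \<le> U + d n" if "t \<in> {a..b}" for n t
      using norm_triangle_sub[of "p n t" "u t"] p(2)[OF that, of n] bspec[OF U that] by (simp add: norm_minus_commute)
    have qW: "norm (q n t) \<le> W + d n" if "t \<in> {a..b}" for n t
      using norm_triangle_sub[of "q n t" "w t"] q(2)[OF that, of n] bspec[OF W that] by (simp add: norm_minus_commute)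
    have "\<forall>n. \<exists>z. product_deriv mul \<beta> a b (p n) (q n) z"
      using product_deriv_vec_poly[OF \<beta>(1) \<beta>1 mul p(1) q(1)] by blast
    then obtain z where z: "\<And>n. product_deriv mul \<beta> a b (p n) (q n) (z n)" by metis
    have zc: "continuous_on {a..b} (z n)" and zeq: "t \<in> {a..b} \<Longrightarrow> mul (fint \<beta> a (p n) t) (fint \<beta> a (q n) t) = fint \<beta> a (z n) t" for n t
      using z[of n] by (auto simp: product_deriv_def)
    have zdiff: "norm (z m t - z n t) \<le> K * (d m + d n) * (U + W + 2)" if t: "t \<in> {a..b}" for m n t
    proof -
      have vp: "(\<lambda>t. p m t - p n t) \<in> vec_poly a" "(\<lambda>t. q m t - q n t) \<in> vec_poly a" by (intro vec_poly_diff p q)+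
      note vpc = continuous_on_vec_poly[OF vp(1), of "{a..b}"] continuous_on_vec_poly[OF vp(2), of "{a..b}"]
      obtain y1 where y1: "product_deriv mul \<beta> a b (\<lambda>t. p m t - p n t) (q m) y1"
        using product_deriv_vec_poly[OF \<beta>(1) \<beta>1 mul vp(1) q(1)] by blast
      obtain y2 where y2: "product_deriv mul \<beta> a b (p n) (\<lambda>t. q m t - q n t) y2"
        using product_deriv_vec_poly[OF \<beta>(1) \<beta>1 mul p(1) vp(2)] by blast
      have yc: "continuous_on {a..b} y1" "continuous_on {a..b} y2" using y1 y2 by (auto simp: product_deriv_def)
      have dp: "norm (p m t - p n t) \<le> d m + d n" if "t \<in> {a..b}" for t
      proof -
        have "norm (p m t - p n t) = norm ((u t - p n t) - (u t - p m t))" by simp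
        also have "\<dots> \<le> norm (u t - p n t) + norm (u t - p m t)" by (rule norm_triangle_ineq4)
        finally show ?thesis using p(2)[OF that, of m] p(2)[OF that, of n] by linarith
      qed
      have dq: "norm (q m t - q n t) \<le> d m + d n" if "t \<in> {a..b}" for t
      proof -
        have "norm (q m t - q n t) = norm ((w t - q n t) - (w t - q m t))" by simp
        also have "\<dots> \<le> norm (w t - q n t) + norm (w t - q m t)" by (rule norm_triangle_ineq4)
        finally show ?thesis using q(2)[OF that, of m] q(2)[OF that, of n] by linarith
      qed
      \<comment> \<open>Both sides have the same fractional integral, by splitting the difference of
        the products as in the product rule. Injectivity transfers the identity to the
        densities.\<close>
      have "z m t - z n t = y1 t + y2 t"
      proof (rule fint_inject[OF \<beta>(1) ab _ _ _ t])
        show "continuous_on {a..b} (\<lambda>t. z m t - z n t)" "continuous_on {a..b} (\<lambda>t. y1 t + y2 t)"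
          by (intro continuous_intros zc yc)+
        fix s assume s: "s \<in> {a..b}"
        have sub: "continuous_on {a..b} f \<Longrightarrow> continuous_on {a..s} f" for f :: "real \<Rightarrow> 'a"
          using s by (auto intro: continuous_on_subset)
        have "fint \<beta> a (\<lambda>t. z m t - z n t) s = fint \<beta> a (z m) s - fint \<beta> a (z n) s"
          by (intro fint_diff \<beta> sub zc)
        also have "\<dots> = mul (fint \<beta> a (p m) s) (fint \<beta> a (q m) s) - mul (fint \<beta> a (p n) s) (fint \<beta> a (q n) s)"
          using s by (simp add: zeq)
        also have "\<dots> = mul (fint \<beta> a (p m) s - fint \<beta> a (p n) s) (fint \<beta> a (q m) s) + mul (fint \<beta> a (p n) s) (fint \<beta> a (q m) s - fint \<beta> a (q n) s)"
          by (simp add: mul.diff_left mul.diff_right)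
        also have "fint \<beta> a (p m) s - fint \<beta> a (p n) s = fint \<beta> a (\<lambda>t. p m t - p n t) s"
          by (intro fint_diff[symmetric] \<beta> sub cont)
        also have "fint \<beta> a (q m) s - fint \<beta> a (q n) s = fint \<beta> a (\<lambda>t. q m t - q n t) s"
          by (intro fint_diff[symmetric] \<beta> sub cont)
        also have "mul (fint \<beta> a (\<lambda>t. p m t - p n t) s) (fint \<beta> a (q m) s) = fint \<beta> a y1 s"
          using y1 s by (simp add: product_deriv_def)
        also have "mul (fint \<beta> a (p n) s) (fint \<beta> a (\<lambda>t. q m t - q n t) s) = fint \<beta> a y2 s"
          using y2 s by (simp add: product_deriv_def)
        also have "fint \<beta> a y1 s + fint \<beta> a y2 s = fint \<beta> a (\<lambda>t. y1 t + y2 t) s"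
          by (intro fint_add[symmetric] \<beta> sub yc)
        finally show "fint \<beta> a (\<lambda>t. z m t - z n t) s = fint \<beta> a (\<lambda>t. y1 t + y2 t) s" .
      qed
      also have "norm \<dots> \<le> K * ((d m + d n) * (W + 1)) + K * ((U + 1) * (d m + d n))"
      proof (rule norm_triangle_mono)
        show "norm (y1 t) \<le> K * ((d m + d n) * (W + 1))"
          by (rule K[OF vpc(1) cont(2) y1 dp order_trans[OF qW add_left_mono[OF d(2)]] t])
        show "norm (y2 t) \<le> K * ((U + 1) * (d m + d n))"
          by (rule K[OF cont(1) vpc(2) y2 order_trans[OF pU add_left_mono[OF d(2)]] dq t])
      qed
      also have "\<dots> = K * (d m + d n) * (U + W + 2)" by (simp add: algebra_simps)
      finally show ?thesis .
    qed
    have "uniformly_Cauchy_on {a..b} z"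
      unfolding uniformly_Cauchy_on_def
    proof (intro allI impI)
      fix e :: real assume e: "e > 0"
      define c where "c = 2 * K * (U + W + 2)"
      have c: "c \<ge> 0" using K0 UW by (simp add: c_def)
      have "e / (c + 1) > 0" using e c by simp
      from order_tendstoD(2)[OF d0 this] obtain N where N: "\<And>n. n \<ge> N \<Longrightarrow> d n < e / (c + 1)"
        by (auto simp: eventually_sequentially)
      have "dist (z m t) (z n t) < e" if "t \<in> {a..b}" "m \<ge> N" "n \<ge> N" for t m n
      proof -
        have "dist (z m t) (z n t) \<le> K * (d m + d n) * (U + W + 2)" using zdiff[OF that(1)] by (simp add: dist_norm)
        also have "\<dots> \<le> K * (e / (c + 1) + e / (c + 1)) * (U + W + 2)"
          using N[OF that(2)] N[OF that(3)] K0 UW by (intro mult_right_mono mult_left_mono add_mono) auto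
        also have "\<dots> = c * (e / (c + 1))" by (simp add: c_def algebra_simps)
        also have "\<dots> < e" using e c by (simp add: field_simps)
        finally show ?thesis .
      qed
      then show "\<exists>M. \<forall>x\<in>{a..b}. \<forall>m\<ge>M. \<forall>n\<ge>M. dist (z m x) (z n x) < e" by blast
    qed
    then obtain y where y: "uniform_limit {a..b} z y sequentially"
      using Cauchy_uniformly_convergent unfolding uniformly_convergent_on_def by blast
    have pu: "uniform_limit {a..b} p u sequentially" and qw: "uniform_limit {a..b} q w sequentially"
      using p(2) q(2) by (auto intro!: uniform_limit_dist_bound[OF d0] simp: dist_norm norm_minus_commute)
    show ?thesis
    proof (intro exI[of _ y] conjI ballI)
      show "continuous_on {a..b} y" by (rule uniform_limit_theorem[OF _ y]) (use zc in auto)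
      fix t assume t: "t \<in> {a..b}"
      have "(\<lambda>n. mul (fint \<beta> a (p n) t) (fint \<beta> a (q n) t)) \<longlonglongrightarrow> mul (fint \<beta> a u t) (fint \<beta> a w t)"
        by (intro mul.tendsto tendsto_fint_uniform_limit[where b = b] \<beta> cont pu qw t)
      moreover have "(\<lambda>n. fint \<beta> a (z n) t) \<longlonglongrightarrow> fint \<beta> a y t"
        by (intro tendsto_fint_uniform_limit[where b = b] \<beta> zc y t)
      ultimately show "mul (fint \<beta> a u t) (fint \<beta> a w t) = fint \<beta> a y t"
        using t by (simp add: zeq LIMSEQ_unique)
      \<comment> \<open>The bound is kept in terms of \<open>d n\<close>, and not of 1, so that the
        limit yields exactly \<open>K * (U * W)\<close>.\<close>
      have zn: "norm (z n t) \<le> K * ((U + d n) * (W + d n))" for n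
        by (rule K[OF cont z pU qW t])
      have "(\<lambda>n. norm (z n t)) \<longlonglongrightarrow> norm (y t)"
        using tendsto_uniform_limitI[OF y t] by (rule tendsto_norm)
      moreover have "(\<lambda>n. K * ((U + d n) * (W + d n))) \<longlonglongrightarrow> K * ((U + 0) * (W + 0))"
        by (intro tendsto_intros d0)
      ultimately show "norm (y t) \<le> K * (U * W)"
        using LIMSEQ_le[of "\<lambda>n. norm (z n t)" _ "\<lambda>n. K * ((U + d n) * (W + d n))"] zn by auto
    qed
  qed
  with K0 show ?thesis by blast
qed

section \<open>Test functions\<close>

text \<open>An existential form of repeated differentiability: sums, products and compositions are
  handled by induction without formulas for iterated \<open>deriv\<close>. \<open>smooth_iff\<close>
  gives the form used by \<open>test_function\<close>.\<close>

primrec times_diff :: "nat \<Rightarrow> (real \<Rightarrow> real) \<Rightarrow> bool" where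
  "times_diff 0 f \<longleftrightarrow> True"
| "times_diff (Suc n) f \<longleftrightarrow> (\<exists>f'. (\<forall>x. (f has_real_derivative f' x) (at x)) \<and> times_diff n f')"

definition smooth :: "(real \<Rightarrow> real) \<Rightarrow> bool" where
  "smooth f \<longleftrightarrow> (\<forall>n. times_diff n f)"

lemma times_diff_SucD: "times_diff (Suc n) f \<Longrightarrow> times_diff n f"
  by (induction n arbitrary: f) auto

lemma times_diff_add: "times_diff n f \<Longrightarrow> times_diff n g \<Longrightarrow> times_diff n (\<lambda>x. f x + g x)"
proof (induction n arbitrary: f g)
  case (Suc n)
  then obtain f' g' where "\<forall>x. (f has_real_derivative f' x) (at x)" "times_diff n f'"
    "\<forall>x. (g has_real_derivative g' x) (at x)" "times_diff n g'" by auto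
  then have "(\<forall>x. ((\<lambda>x. f x + g x) has_real_derivative f' x + g' x) (at x)) \<and> times_diff n (\<lambda>x. f' x + g' x)"
    using Suc.IH by (auto intro!: DERIV_add)
  then show ?case by auto
qed simp

lemma times_diff_mult: "times_diff n f \<Longrightarrow> times_diff n g \<Longrightarrow> times_diff n (\<lambda>x. f x * g x)"
proof (induction n arbitrary: f g)
  case (Suc n)
  then obtain f' g' where *: "\<forall>x. (f has_real_derivative f' x) (at x)" "times_diff n f'"
    "\<forall>x. (g has_real_derivative g' x) (at x)" "times_diff n g'" by auto
  then have "\<forall>x. ((\<lambda>x. f x * g x) has_real_derivative f' x * g x + g' x * f x) (at x)"
    by (auto intro!: DERIV_mult)
  moreover have "times_diff n (\<lambda>x. f' x * g x + g' x * f x)"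
    by (intro times_diff_add Suc.IH * times_diff_SucD[OF Suc.prems(1)] times_diff_SucD[OF Suc.prems(2)])
  ultimately show ?case by (auto intro!: exI[of _ "\<lambda>x. f' x * g x + g' x * f x"])
qed simp

lemma times_diff_const: "times_diff n (\<lambda>x. c)"
  by (induction n arbitrary: c) (auto intro!: exI[of _ "\<lambda>x. 0"])

lemma times_diff_affine: "times_diff n f \<Longrightarrow> times_diff n (\<lambda>x. f (c * x + d))"
proof (induction n arbitrary: f)
  case (Suc n)
  then obtain f' where f: "\<And>x. (f has_real_derivative f' x) (at x)" "times_diff n f'" by auto
  have "((\<lambda>x. f (c * x + d)) has_real_derivative f' (c * x + d) * (c * 1 + 0)) (at x)" for x
    by (rule DERIV_chain2[OF f(1)]) (intro DERIV_add DERIV_cmult DERIV_ident DERIV_const)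
  moreover have "times_diff n (\<lambda>x. f' (c * x + d) * (c * 1 + 0))"
    by (rule times_diff_mult[OF Suc.IH[OF f(2)] times_diff_const])
  ultimately show ?case by (auto intro!: exI[of _ "\<lambda>x. f' (c * x + d) * (c * 1 + 0)"])
qed simp

lemma smooth_iff: "smooth f \<longleftrightarrow> (\<forall>n x. (deriv ^^ n) f field_differentiable at x)"
proof
  assume f: "smooth f"
  have "times_diff (Suc n) f \<Longrightarrow> (deriv ^^ n) f field_differentiable at x" for n x
  proof (induction n arbitrary: f)
    case 0
    then show ?case by (auto simp: field_differentiable_def)
  next
    case (Suc n)
    then obtain f' where "\<And>x. (f has_real_derivative f' x) (at x)" "times_diff (Suc n) f'" by auto
    moreover from this have "deriv f = f'" using DERIV_imp_deriv by blast
    ultimately show ?case using Suc.IH[of f'] by (simp only: funpow_Suc_right o_def)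
  qed
  with f show "\<forall>n x. (deriv ^^ n) f field_differentiable at x" by (auto simp: smooth_def simp del: times_diff.simps)
next
  assume f: "\<forall>n x. (deriv ^^ n) f field_differentiable at x"
  have "times_diff n ((deriv ^^ m) f)" for n m
  proof (induction n arbitrary: m)
    case (Suc n)
    have "\<forall>x. ((deriv ^^ m) f has_real_derivative (deriv ^^ Suc m) f x) (at x)"
      using f by (auto simp: field_differentiable_derivI)
    then show ?case using Suc.IH[of "Suc m"] by auto
  qed simp
  from this[of _ 0] show "smooth f" by (simp add: smooth_def)
qed

lemma smooth_has_real_derivative:
  assumes "smooth f"
  shows "((deriv ^^ n) f has_real_derivative (deriv ^^ Suc n) f x) (at x)"
  using assms by (simp add: smooth_iff field_differentiable_derivI)

lemma continuous_on_smooth_deriv: "smooth f \<Longrightarrow> continuous_on S ((deriv ^^ n) f)"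
  by (rule DERIV_continuous_on[OF DERIV_subset[OF smooth_has_real_derivative]]) auto

lemma smooth_lincomb:
  assumes "smooth f" "smooth g"
  shows "smooth (\<lambda>x. f x + c * g x)"
  using assms by (auto simp: smooth_def intro!: times_diff_add times_diff_mult times_diff_const)

lemma deriv_lincomb:
  assumes "smooth f" "smooth g"
  shows "(deriv ^^ n) (\<lambda>x. f x + c * g x) = (\<lambda>x. (deriv ^^ n) f x + c * (deriv ^^ n) g x)"
proof (induction n)
  case (Suc n)
  have "deriv (\<lambda>x. (deriv ^^ n) f x + c * (deriv ^^ n) g x) x = (deriv ^^ Suc n) f x + c * (deriv ^^ Suc n) g x" for x
    by (intro DERIV_imp_deriv DERIV_add DERIV_cmult smooth_has_real_derivative assms)
  then show ?case by (intro ext) (simp add: Suc.IH)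
qed simp

text \<open>The functions p(1/x) e^(-1/x), extended by 0 to the left. The polynomial parameter
  closes the family under differentiation: with y = 1/x, the derivative belongs to y^2 (p -
  p').\<close>

definition exp_germ :: "real poly \<Rightarrow> real \<Rightarrow> real" where
  "exp_germ p x = (if x > 0 then poly p (1 / x) * exp (- (1 / x)) else 0)"

lemma tendsto_poly_exp_minus: "((\<lambda>y. poly p y * exp (- y)) \<longlongrightarrow> 0) (at_top :: real filter)"
proof -
  have "((\<lambda>y. \<Sum>i\<le>degree p. coeff p i * (y ^ i / exp y)) \<longlongrightarrow> 0) at_top"
    by (intro tendsto_null_sum tendsto_mult_right_zero tendsto_power_div_exp_0)
  moreover have "(\<Sum>i\<le>degree p. coeff p i * (y ^ i / exp y)) = poly p y * exp (- y)" for y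
    by (simp add: poly_altdef sum_distrib_right exp_minus divide_inverse mult.assoc)
  ultimately show ?thesis by simp
qed

lemma exp_germ_has_real_derivative:
  "(exp_germ p has_real_derivative exp_germ ([:0, 0, 1:] * (p - pderiv p)) x) (at x)"
proof -
  consider "x < 0" | "x > 0" | "x = 0" by linarith
  then show ?thesis
  proof cases
    case 1
    have "((\<lambda>x. 0) has_real_derivative exp_germ ([:0, 0, 1:] * (p - pderiv p)) x) (at x)"
      using 1 by (simp add: exp_germ_def)
    then show ?thesis
      by (rule has_field_derivative_transform_within_open[of _ _ _ "{..<0}"])
        (use 1 in \<open>auto simp: exp_germ_def\<close>)
  next
    case 2
    have "((\<lambda>x. poly p (1 / x) * exp (- (1 / x))) has_real_derivative
        exp_germ ([:0, 0, 1:] * (p - pderiv p)) x) (at x)"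
      using 2 by (auto intro!: derivative_eq_intros DERIV_chain2[OF poly_DERIV] simp: exp_germ_def field_simps)
    then show ?thesis
      by (rule has_field_derivative_transform_within_open[of _ _ _ "{0<..}"])
        (use 2 in \<open>auto simp: exp_germ_def\<close>)
  next
    case 3
    \<comment> \<open>Under y = 1/h the difference quotient from the right becomes y p(y) e^(-y),
      again a polynomial times a decaying exponential.\<close>
    have "((\<lambda>h. (exp_germ p h - exp_germ p 0) / (h - 0)) \<longlongrightarrow> 0) (at 0)"
    proof (rule filterlim_split_at)
      have "\<forall>\<^sub>F h in at_left 0. 0 = (exp_germ p h - exp_germ p 0) / (h - 0)"
        by (auto simp: eventually_at_filter exp_germ_def)
      then show "((\<lambda>h. (exp_germ p h - exp_germ p 0) / (h - 0)) \<longlongrightarrow> 0) (at_left 0)"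
        by (rule Lim_transform_eventually[OF tendsto_const])
      have "\<forall>\<^sub>F y in at_top. poly ([:0, 1:] * p) y * exp (- y) = (exp_germ p (inverse y) - exp_germ p 0) / (inverse y - 0)"
        using eventually_gt_at_top[of 0] by eventually_elim (auto simp: exp_germ_def field_simps)
      then show "((\<lambda>h. (exp_germ p h - exp_germ p 0) / (h - 0)) \<longlongrightarrow> 0) (at_right 0)"
        unfolding filterlim_at_right_to_top by (rule Lim_transform_eventually[OF tendsto_poly_exp_minus])
    qed
    then show ?thesis using 3 by (simp add: has_field_derivative_iff exp_germ_def)
  qed
qed

lemma smooth_exp_germ: "smooth (exp_germ p)"
proof -
  have "times_diff n (exp_germ p)" for n
  proof (induction n arbitrary: p)
    case (Suc n)
    then show ?case using exp_germ_has_real_derivative by (auto simp del: mult_pCons_left)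
  qed simp
  then show ?thesis by (simp add: smooth_def)
qed

definition bump :: "real \<Rightarrow> real \<Rightarrow> real \<Rightarrow> real" where
  "bump c d x = exp_germ 1 (x - c) * exp_germ 1 (d - x)"

lemma smooth_bump: "smooth (bump c d)"
proof -
  have "times_diff n (\<lambda>x. exp_germ 1 (1 * x + - c) * exp_germ 1 ((-1) * x + d))" for n
    using smooth_exp_germ by (intro times_diff_mult times_diff_affine) (auto simp: smooth_def)
  then show ?thesis by (simp add: smooth_def bump_def[abs_def])
qed

lemma bump_nonneg: "bump c d x \<ge> 0" and bump_pos: "c < x \<Longrightarrow> x < d \<Longrightarrow> bump c d x > 0"
  and bump_eq_0: "x \<notin> {c..d} \<Longrightarrow> bump c d x = 0"
  by (auto simp: bump_def exp_germ_def)

section \<open>Test functions on an open interval and their antiderivatives\<close>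

lemma test_functionI:
  assumes "smooth \<phi>" "a < c" "d < b" and zero: "\<And>x. x \<notin> {c..d} \<Longrightarrow> \<phi> x = 0"
  shows "test_function a b \<phi>"
proof -
  have sub: "closure {x. \<phi> x \<noteq> 0} \<subseteq> {c..d}"
    by (rule closure_minimal) (use zero in \<open>blast, simp\<close>)
  then have "bounded (closure {x. \<phi> x \<noteq> 0})" using bounded_subset[OF bounded_closed_interval] by blast
  then have "compact (closure {x. \<phi> x \<noteq> 0})" by (simp add: compact_eq_bounded_closed)
  moreover have "{c..d} \<subseteq> {a<..<b}" using assms by auto
  ultimately show ?thesis using assms(1) sub by (auto simp: test_function_def smooth_iff)
qed

text \<open>The topological support is traded for one interval [c, d] inside (a, b), on which
  integration by parts is convenient. For \<phi> = 0 a degenerate interval at the midpoint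
  serves.\<close>

lemma test_functionE:
  assumes ab: "a < b" and \<phi>: "test_function a b \<phi>"
  obtains c d where "smooth \<phi>" "a < c" "c \<le> d" "d < b" "\<And>x. x \<notin> {c..d} \<Longrightarrow> \<phi> x = 0"
proof -
  define S where "S = closure {x. \<phi> x \<noteq> 0}"
  have S: "compact S" "S \<subseteq> {a<..<b}" and smooth: "smooth \<phi>" using \<phi> by (auto simp: test_function_def S_def smooth_iff)
  have zero: "\<phi> x = 0" if "x \<notin> S" for x using that closure_subset[of "{x. \<phi> x \<noteq> 0}"] by (auto simp: S_def)
  show ?thesis
  proof (cases "S = {}")
    case True
    show ?thesis by (rule that[of "(a + b) / 2" "(a + b) / 2"]) (use ab smooth zero True in auto)
  next
    case False
    obtain c where c: "c \<in> S" "\<And>x. x \<in> S \<Longrightarrow> c \<le> x" using compact_attains_inf[OF S(1) False] by blast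
    obtain d where d: "d \<in> S" "\<And>x. x \<in> S \<Longrightarrow> x \<le> d" using compact_attains_sup[OF S(1) False] by blast
    show ?thesis by (rule that[of c d]) (use c d S smooth zero in auto)
  qed
qed

lemma deriv_eq_0_outside:
  fixes \<phi> :: "real \<Rightarrow> real"
  assumes "\<And>x. x \<notin> {c..d} \<Longrightarrow> \<phi> x = 0" "x \<notin> {c..d}"
  shows "(deriv ^^ n) \<phi> x = 0"
  using assms(2)
proof (induction n arbitrary: x)
  case (Suc n)
  have "((deriv ^^ n) \<phi> has_real_derivative 0) (at x)"
  proof (rule has_field_derivative_transform_within_open[of "\<lambda>x. 0" _ _ "- {c..d}"])
    show "open (- {c..d})" by (intro open_Compl closed_atLeastAtMost)
  qed (use Suc in auto)
  then show ?case by (simp add: DERIV_imp_deriv)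
qed (use assms in simp)

lemma test_function_lincomb:
  assumes ab: "a < b" and "test_function a b \<phi>" "test_function a b \<psi>"
  shows "test_function a b (\<lambda>x. \<phi> x + k * \<psi> x)"
proof -
  obtain c d where 1: "smooth \<phi>" "a < c" "d < b" "\<And>x. x \<notin> {c..d} \<Longrightarrow> \<phi> x = 0"
    using test_functionE[OF ab assms(2)] by metis
  obtain c' d' where 2: "smooth \<psi>" "a < c'" "d' < b" "\<And>x. x \<notin> {c'..d'} \<Longrightarrow> \<psi> x = 0"
    using test_functionE[OF ab assms(3)] by metis
  have "\<phi> x + k * \<psi> x = 0" if "x \<notin> {min c c'..max d d'}" for x
  proof -
    have "x \<notin> {c..d}" "x \<notin> {c'..d'}" using that by auto
    then show ?thesis using 1(4) 2(4) by simp
  qed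
  then show ?thesis
    using 1 2 by (intro test_functionI[of _ _ "min c c'" "max d d'"] smooth_lincomb) auto
qed

text \<open>The mean value zero is exactly what makes the antiderivative starting at
  \<open>a\<close> vanish again to the right of the support.\<close>

lemma test_function_antiderivative:
  assumes ab: "a < b" and \<eta>: "test_function a b \<eta>" and int: "integral {a..b} \<eta> = 0"
  obtains \<Phi> where "test_function a b \<Phi>" "deriv \<Phi> = \<eta>"
proof -
  obtain c d where cd: "smooth \<eta>" "a < c" "c \<le> d" "d < b" "\<And>x. x \<notin> {c..d} \<Longrightarrow> \<eta> x = 0"
    using test_functionE[OF ab \<eta>] by blast
  define \<Phi> where "\<Phi> x = integral {a..x} \<eta>" for x
  have cont: "continuous_on S \<eta>" for S using continuous_on_smooth_deriv[OF cd(1), of S 0] by simp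
  have left: "\<Phi> x = 0" if "x < c" for x
  proof -
    have "integral {a..x} \<eta> = integral {a..x} (\<lambda>_. 0)"
      using that by (intro integral_cong cd(5)) auto
    then show ?thesis by (simp add: \<Phi>_def)
  qed
  have right: "\<Phi> x = 0" if "x > d" for x
  proof -
    \<comment> \<open>One of \<open>m\<close> and \<open>M\<close> is \<open>b\<close>, where the
      integral is known to be 0; this covers x on either side of \<open>b\<close>.\<close>
    define m M where "m = min x b" and "M = max x b"
    have "integral {m..M} \<eta> = integral {m..M} (\<lambda>_. 0)"
      using that cd by (intro integral_cong cd(5)) (auto simp: m_def)
    moreover have "integral {a..m} \<eta> + integral {m..M} \<eta> = integral {a..M} \<eta>"
      using that cd ab by (intro Henstock_Kurzweil_Integration.integral_combine integrable_continuous_real cont) (auto simp: m_def M_def)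
    ultimately have "integral {a..m} \<eta> = integral {a..M} \<eta>" by simp
    then show ?thesis using int by (auto simp: m_def M_def \<Phi>_def min_def max_def split: if_splits)
  qed
  have D: "(\<Phi> has_real_derivative \<eta> x) (at x)" for x
  proof (cases "x < c")
    case True
    have "(\<Phi> has_real_derivative 0) (at x)"
      by (rule has_field_derivative_transform_within_open[of "\<lambda>x. 0" _ _ "{..<c}"]) (use True left in auto)
    then show ?thesis using cd(5)[of x] True by simp
  next
    case False
    have "(\<Phi> has_real_derivative \<eta> x) (at x within {a..x + 1})"
      unfolding \<Phi>_def using False cd by (intro integral_has_real_derivative cont) auto
    moreover have "at x within {a..x + 1} = at x"
      using False cd by (intro at_within_interior) auto
    ultimately show ?thesis by simp
  qed
  then have "times_diff n \<Phi>" for n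
    using cd(1) by (cases n) (auto simp: smooth_def)
  then have "test_function a b \<Phi>"
    by (intro test_functionI[of _ _ c d] cd) (use left right in \<open>auto simp: smooth_def\<close>)
  moreover have "deriv \<Phi> = \<eta>" using D DERIV_imp_deriv by blast
  ultimately show ?thesis by (rule that)
qed

section \<open>Weak derivatives of continuous functions\<close>

text \<open>Integration by parts, one derivative at a time. Boundary terms vanish because all
  derivatives of \<phi> are zero at a and b. The successive derivatives are an explicit family
  \<open>H\<close>, so that fractional integrals can be inserted.\<close>

lemma integral_deriv_test_function:
  fixes H :: "nat \<Rightarrow> real \<Rightarrow> 'a::banach"
  assumes ab: "a < b" and \<phi>: "test_function a b \<phi>"
    and G: "\<And>j t. j < m \<Longrightarrow> t \<in> {a..b} \<Longrightarrow> (H j has_vector_derivative H (Suc j) t) (at t within {a..b})"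
    and c: "continuous_on {a..b} (H m)"
  shows "integral {a..b} (\<lambda>s. (deriv ^^ m) \<phi> s *\<^sub>R H 0 s) = (- 1) ^ m *\<^sub>R integral {a..b} (\<lambda>s. \<phi> s *\<^sub>R H m s)"
proof -
  obtain c d where cd: "smooth \<phi>" "a < c" "c \<le> d" "d < b" "\<And>x. x \<notin> {c..d} \<Longrightarrow> \<phi> x = 0"
    using test_functionE[OF ab \<phi>] by blast
  have cont: "continuous_on {a..b} (H j)" if "j \<le> m" for j
  proof (cases "j = m")
    case False
    then show ?thesis using G[of j] that by (intro continuous_on_vector_derivative[of _ _ "H (Suc j)"]) auto
  qed (use c in simp)
  have "integral {a..b} (\<lambda>s. (deriv ^^ m) \<phi> s *\<^sub>R H 0 s) = (- 1) ^ j *\<^sub>R integral {a..b} (\<lambda>s. (deriv ^^ (m - j)) \<phi> s *\<^sub>R H j s)"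
    if "j \<le> m" for j
    using that
  proof (induction j)
    case (Suc j)
    define n where "n = m - Suc j"
    have mj: "m - j = Suc n" using Suc.prems by (simp add: n_def)
    have "((\<lambda>s. (deriv ^^ n) \<phi> s *\<^sub>R H (Suc j) s + (deriv ^^ Suc n) \<phi> s *\<^sub>R H j s) has_integral
       ((deriv ^^ n) \<phi> b *\<^sub>R H j b - (deriv ^^ n) \<phi> a *\<^sub>R H j a)) {a..b}"
    proof (rule fundamental_theorem_of_calculus[where f = "\<lambda>s. (deriv ^^ n) \<phi> s *\<^sub>R H j s"])
      fix x assume x: "x \<in> {a..b}"
      show "((\<lambda>s. (deriv ^^ n) \<phi> s *\<^sub>R H j s) has_vector_derivative (deriv ^^ n) \<phi> x *\<^sub>R H (Suc j) x + (deriv ^^ Suc n) \<phi> x *\<^sub>R H j x) (at x within {a..b})"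
        using x Suc.prems DERIV_subset[OF smooth_has_real_derivative[OF cd(1)]]
        by (intro has_vector_derivative_scaleR G) auto
    qed (use ab in simp)
    moreover have "(deriv ^^ n) \<phi> b = 0" "(deriv ^^ n) \<phi> a = 0"
      using cd by (auto intro!: deriv_eq_0_outside[of c d])
    ultimately have "integral {a..b} (\<lambda>s. (deriv ^^ n) \<phi> s *\<^sub>R H (Suc j) s + (deriv ^^ Suc n) \<phi> s *\<^sub>R H j s) = 0"
      by (simp add: integral_unique)
    moreover have "integral {a..b} (\<lambda>s. (deriv ^^ n) \<phi> s *\<^sub>R H (Suc j) s + (deriv ^^ Suc n) \<phi> s *\<^sub>R H j s)
      = integral {a..b} (\<lambda>s. (deriv ^^ n) \<phi> s *\<^sub>R H (Suc j) s) + integral {a..b} (\<lambda>s. (deriv ^^ Suc n) \<phi> s *\<^sub>R H j s)"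
      using Suc.prems by (intro integral_add integrable_continuous_real continuous_on_scaleR continuous_on_smooth_deriv cd(1) cont) auto
    ultimately have "integral {a..b} (\<lambda>s. (deriv ^^ Suc n) \<phi> s *\<^sub>R H j s) = - integral {a..b} (\<lambda>s. (deriv ^^ n) \<phi> s *\<^sub>R H (Suc j) s)"
      by (simp add: add_eq_0_iff)
    then show ?case using Suc unfolding mj n_def[symmetric] by simp
  qed simp
  from this[of m] show ?thesis by simp
qed

lemma power_over_fact_has_real_derivative:
  "((\<lambda>t. (t - a) ^ Suc n / fact (Suc n)) has_real_derivative (t - a) ^ n / fact n) (at t within S)"
proof -
  have "((\<lambda>t. (t - a) ^ Suc n / fact (Suc n)) has_real_derivative (1 + real n) * ((1 - 0) * (t - a) ^ n) / fact (Suc n)) (at t within S)"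
    by (intro DERIV_cdivide DERIV_power_Suc DERIV_diff DERIV_ident DERIV_const)
  moreover have "fact (Suc n) = (1 + real n) * fact n" by simp
  then have "(1 + real n) * ((1 - 0) * (t - a) ^ n) / fact (Suc n) = (t - a) ^ n / fact n"
    by (simp only:) (simp add: add_nonneg_eq_0_iff)
  ultimately show ?thesis by simp
qed

lemma integral_scaleR_const:
  fixes f :: "real \<Rightarrow> real" and c :: "'a::banach"
  assumes "f integrable_on S"
  shows "integral S (\<lambda>s. f s *\<^sub>R c) = integral S f *\<^sub>R c"
  by (rule integral_unique[OF has_integral_scaleR_left[OF integrable_integral[OF assms]]])

lemma integral_bump_pos:
  assumes "a \<le> c" "c < d" "d \<le> b"
  shows "integral {a..b} (bump c d) > 0"
proof -
  have cont: "continuous_on {a..b} (bump c d)" using continuous_on_smooth_deriv[OF smooth_bump, of _ 0] by simp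
  have "bump c d ((c + d) / 2) > 0" using assms by (intro bump_pos) auto
  moreover have "(c + d) / 2 \<in> {a..b}" using assms by auto
  ultimately have "integral {a..b} (bump c d) \<noteq> 0"
    using assms by (subst integral_eq_0_iff[OF cont]) (auto simp: bump_nonneg intro!: bexI[of _ "(c + d) / 2"])
  moreover have "integral {a..b} (bump c d) \<ge> 0"
    by (intro integral_nonneg integrable_continuous_real cont bump_nonneg)
  ultimately show ?thesis by simp
qed

text \<open>A bump concentrated near t gives (integral of \<phi>) h(t) = integral of \<phi>(s) (h(t)
  - h(s)), which is at most e times the integral of \<phi>. The end points follow by
  continuity.\<close>

lemma eq_0_if_test_integrals_0:
  fixes h :: "real \<Rightarrow> 'a::banach"
  assumes ab: "a < b" and h: "continuous_on {a..b} h"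
    and int: "\<And>\<phi>. test_function a b \<phi> \<Longrightarrow> integral {a..b} (\<lambda>s. \<phi> s *\<^sub>R h s) = 0" and t: "t \<in> {a..b}"
  shows "h t = 0"
proof -
  have "h t = 0" if t: "t \<in> {a<..<b}" for t
  proof -
    have "norm (h t) \<le> e" if e: "e > 0" for e
    proof -
      obtain r where r: "r > 0" "\<And>s. s \<in> {a..b} \<Longrightarrow> dist s t < r \<Longrightarrow> dist (h s) (h t) < e"
        using h t e unfolding continuous_on_iff by (metis atLeastAtMost_iff greaterThanLessThan_iff less_imp_le)
      \<comment> \<open>The halves keep the closed support strictly inside both (a, b) and the ball
        of radius \<open>r\<close> around t.\<close>
      define q where "q = min (r / 2) (min ((t - a) / 2) ((b - t) / 2))"
      have q: "q > 0" "q < r" "a < t - q" "t + q < b" using t r(1) by (auto simp: q_def min_def field_simps)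
      define \<phi> where "\<phi> = bump (t - q) (t + q)"
      have test: "test_function a b \<phi>"
        unfolding \<phi>_def using q by (intro test_functionI[of _ _ "t - q" "t + q"] smooth_bump bump_eq_0)
      have cont: "continuous_on {a..b} \<phi>" unfolding \<phi>_def using continuous_on_smooth_deriv[OF smooth_bump, of _ 0] by simp
      have pos: "integral {a..b} \<phi> > 0" unfolding \<phi>_def using q by (intro integral_bump_pos) auto
      have "integral {a..b} (\<lambda>s. \<phi> s *\<^sub>R (h t - h s)) = integral {a..b} (\<lambda>s. \<phi> s *\<^sub>R h t) - integral {a..b} (\<lambda>s. \<phi> s *\<^sub>R h s)"
        unfolding scaleR_diff_right
        by (intro integral_diff integrable_continuous_real continuous_intros cont h)
      also have "\<dots> = integral {a..b} \<phi> *\<^sub>R h t"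
        using int[OF test] integrable_continuous_real[OF cont] by (simp add: integral_scaleR_const)
      finally have "integral {a..b} \<phi> * norm (h t) = norm (integral {a..b} (\<lambda>s. \<phi> s *\<^sub>R (h t - h s)))"
        using pos by simp
      also have "\<dots> \<le> integral {a..b} (\<lambda>s. e * \<phi> s)"
      proof (intro integral_norm_bound_integral integrable_continuous_real continuous_intros cont h)
        fix s assume s: "s \<in> {a..b}"
        show "norm (\<phi> s *\<^sub>R (h t - h s)) \<le> e * \<phi> s"
        proof (cases "s \<in> {t - q..t + q}")
          case True
          then have "dist s t < r" using q by (auto simp: dist_real_def)
          then have "norm (h t - h s) \<le> e" using r(2)[OF s] by (simp add: dist_norm norm_minus_commute)
          then show ?thesis using bump_nonneg[of "t - q" "t + q" s] by (simp add: \<phi>_def mult.commute mult_right_mono)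
        next
          case False
          then show ?thesis using bump_eq_0[OF False] by (simp add: \<phi>_def)
        qed
      qed
      also have "\<dots> = integral {a..b} \<phi> * e" by simp
      finally show ?thesis using pos by simp
    qed
    then have "norm (h t) \<le> 0" by (rule field_le_epsilon) simp
    then show ?thesis by simp
  qed
  moreover have "continuous_on (closure {a<..<b}) h" using h ab by simp
  ultimately show ?thesis
    using continuous_constant_on_closure[of "{a<..<b}" h 0 t] t ab by simp
qed

text \<open>Subtracting from a test function a multiple of one fixed bump \<psi> leaves a derivative
  of a test function. Hence the functional \<phi> |-> integral of \<phi>^(m) h only sees the mean of
  \<phi>. A monomial of degree m induces the same functional, and removing it from \<open>h\<close>
  reduces the order by one.\<close>

lemma du_Bois_Reymond:
  fixes h :: "real \<Rightarrow> 'a::banach"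
  assumes ab: "a < b" and h: "continuous_on {a..b} h"
    and int: "\<And>\<phi>. test_function a b \<phi> \<Longrightarrow> integral {a..b} (\<lambda>s. (deriv ^^ m) \<phi> s *\<^sub>R h s) = 0"
  shows "\<exists>c. \<forall>t\<in>{a..b}. h t = (\<Sum>j<m. (t - a) ^ j *\<^sub>R c j)"
  using h int
proof (induction m arbitrary: h)
  case 0
  have "h t = 0" if "t \<in> {a..b}" for t
    by (rule eq_0_if_test_integrals_0[OF ab 0(1) _ that]) (use 0(2) in simp)
  then show ?case by simp
next
  case (Suc m)
  define c d where "c = a + (b - a) / 3" and "d = a + 2 * (b - a) / 3"
  have cd: "a < c" "c < d" "d < b" using ab by (auto simp: c_def d_def field_simps)
  define I where "I = integral {a..b} (bump c d)"
  have I: "I > 0" unfolding I_def using cd by (intro integral_bump_pos) auto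
  define \<psi> where "\<psi> = bump c d"
  have \<psi>: "test_function a b \<psi>" unfolding \<psi>_def using cd by (intro test_functionI[of _ _ c d] smooth_bump bump_eq_0)
  have smooth: "smooth \<phi>" if "test_function a b \<phi>" for \<phi>
    using that by (simp add: test_function_def smooth_iff)
  have cont: "continuous_on {a..b} ((deriv ^^ n) \<phi>)" if "test_function a b \<phi>" for \<phi> n
    using smooth[OF that] by (rule continuous_on_smooth_deriv)
  define C where "C = (1 / I) *\<^sub>R integral {a..b} (\<lambda>s. (deriv ^^ m) \<psi> s *\<^sub>R h s)"
  have key: "integral {a..b} (\<lambda>s. (deriv ^^ m) \<phi> s *\<^sub>R h s) = integral {a..b} \<phi> *\<^sub>R C" if \<phi>: "test_function a b \<phi>" for \<phi>
  proof -
    \<comment> \<open>This k gives \<eta> integral zero, so \<eta> has an antiderivative that is a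
      test function.\<close>
    define k where "k = - integral {a..b} \<phi> / I"
    define \<eta> where "\<eta> x = \<phi> x + k * \<psi> x" for x
    have "test_function a b \<eta>" unfolding \<eta>_def by (rule test_function_lincomb[OF ab \<phi> \<psi>])
    moreover have "integral {a..b} \<eta> = integral {a..b} \<phi> + k * I"
      unfolding \<eta>_def I_def \<psi>_def[symmetric] using cont[OF \<phi>, of 0] cont[OF \<psi>, of 0]
      by (subst integral_add) (auto intro!: integrable_continuous_real continuous_intros)
    then have "integral {a..b} \<eta> = 0" using I by (simp add: k_def)
    ultimately obtain \<Phi> where \<Phi>: "test_function a b \<Phi>" "deriv \<Phi> = \<eta>"
      by (rule test_function_antiderivative[OF ab])
    have "(deriv ^^ Suc m) \<Phi> = (deriv ^^ m) \<eta>" using \<Phi>(2) by (simp only: funpow_Suc_right o_def)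
    also have "\<dots> = (\<lambda>x. (deriv ^^ m) \<phi> x + k * (deriv ^^ m) \<psi> x)"
      unfolding \<eta>_def by (rule deriv_lincomb[OF smooth[OF \<phi>] smooth[OF \<psi>]])
    finally have "0 = integral {a..b} (\<lambda>s. ((deriv ^^ m) \<phi> s + k * (deriv ^^ m) \<psi> s) *\<^sub>R h s)"
      using Suc.prems(2)[OF \<Phi>(1)] by (simp only:)
    also have "\<dots> = integral {a..b} (\<lambda>s. (deriv ^^ m) \<phi> s *\<^sub>R h s) + integral {a..b} (\<lambda>s. k *\<^sub>R (deriv ^^ m) \<psi> s *\<^sub>R h s)"
      unfolding scaleR_add_left scaleR_scaleR[symmetric]
      by (intro integral_add integrable_continuous_real continuous_intros cont \<phi> \<psi> Suc.prems)
    also have "integral {a..b} (\<lambda>s. k *\<^sub>R (deriv ^^ m) \<psi> s *\<^sub>R h s) = k *\<^sub>R integral {a..b} (\<lambda>s. (deriv ^^ m) \<psi> s *\<^sub>R h s)"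
      by (rule integral_cmul)
    also have "\<dots> = - (integral {a..b} \<phi> *\<^sub>R C)"
      by (simp add: k_def C_def)
    finally show ?thesis by simp
  qed
  \<comment> \<open>\<open>H j\<close> is the j-th derivative of (-1)^m C (t - a)^m / m!; the sign
    offsets the one produced by m integrations by parts.\<close>
  define H where "H j t = ((- 1) ^ m * ((t - a) ^ (m - j) / fact (m - j))) *\<^sub>R C" for j t
  have H: "(H j has_vector_derivative H (Suc j) t) (at t within {a..b})" if "j < m" for j t
  proof -
    obtain n where n: "m - j = Suc n" "m - Suc j = n" using \<open>j < m\<close> by (metis Suc_diff_Suc)
    have "((\<lambda>t. (- 1) ^ m * ((t - a) ^ Suc n / fact (Suc n))) has_real_derivative (- 1) ^ m * ((t - a) ^ n / fact n)) (at t within {a..b})"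
      by (intro DERIV_cmult power_over_fact_has_real_derivative)
    then show ?thesis
      unfolding H_def n by (intro has_vector_derivative_scaleR[where g'=0, simplified]) auto
  qed
  have Hc: "continuous_on {a..b} (H j)" for j unfolding H_def by (intro continuous_intros) auto
  have "\<exists>c. \<forall>t\<in>{a..b}. h t - H 0 t = (\<Sum>j<m. (t - a) ^ j *\<^sub>R c j)"
  proof (rule Suc.IH)
    show "continuous_on {a..b} (\<lambda>t. h t - H 0 t)" by (intro continuous_intros Suc.prems Hc)
    fix \<phi> assume \<phi>: "test_function a b \<phi>"
    have "integral {a..b} (\<lambda>s. (deriv ^^ m) \<phi> s *\<^sub>R (h s - H 0 s)) = integral {a..b} (\<lambda>s. (deriv ^^ m) \<phi> s *\<^sub>R h s) - integral {a..b} (\<lambda>s. (deriv ^^ m) \<phi> s *\<^sub>R H 0 s)"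
      unfolding scaleR_diff_right by (intro integral_diff integrable_continuous_real continuous_intros cont \<phi> Suc.prems Hc)
    also have "integral {a..b} (\<lambda>s. (deriv ^^ m) \<phi> s *\<^sub>R H 0 s) = (- 1) ^ m *\<^sub>R integral {a..b} (\<lambda>s. \<phi> s *\<^sub>R H m s)"
      by (rule integral_deriv_test_function[where H = H, OF ab \<phi> H Hc])
    also have "integral {a..b} (\<lambda>s. \<phi> s *\<^sub>R H m s) = integral {a..b} (\<lambda>s. \<phi> s *\<^sub>R ((- 1) ^ m *\<^sub>R C))"
      by (simp add: H_def)
    also have "\<dots> = integral {a..b} \<phi> *\<^sub>R ((- 1) ^ m *\<^sub>R C)"
      using integrable_continuous_real[OF cont[OF \<phi>, of 0]] by (simp add: integral_scaleR_const)
    finally show "integral {a..b} (\<lambda>s. (deriv ^^ m) \<phi> s *\<^sub>R (h s - H 0 s)) = 0"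
      using key[OF \<phi>] by (simp add: power_add[symmetric] mult_2[symmetric])
  qed
  then obtain c where c: "\<And>t. t \<in> {a..b} \<Longrightarrow> h t - H 0 t = (\<Sum>j<m. (t - a) ^ j *\<^sub>R c j)" by blast
  show ?case
  proof (intro exI[of _ "c(m := ((- 1) ^ m / fact m) *\<^sub>R C)"] ballI)
    fix t assume "t \<in> {a..b}"
    from c[OF this] have "h t = (\<Sum>j<m. (t - a) ^ j *\<^sub>R c j) + H 0 t" by (simp add: algebra_simps)
    then show "h t = (\<Sum>j<Suc m. (t - a) ^ j *\<^sub>R (c(m := ((- 1) ^ m / fact m) *\<^sub>R C)) j)"
      by (simp add: H_def mult.commute)
  qed
qed

lemma has_weak_deriv_continuous_iff:
  fixes g v :: "real \<Rightarrow> 'a::banach"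
  assumes ab: "a < b" and g: "continuous_on {a..b} g" and v: "continuous_on {a..b} v"
  shows "has_weak_deriv n a b g v \<longleftrightarrow> (\<forall>\<phi>. test_function a b \<phi> \<longrightarrow>
     integral {a..b} (\<lambda>s. (deriv ^^ n) \<phi> s *\<^sub>R g s) = (- 1) ^ n *\<^sub>R integral {a..b} (\<lambda>s. \<phi> s *\<^sub>R v s))"
proof -
  have "Bochner_integral (lebesgue_on {a..b}) (\<lambda>s. (deriv ^^ k) \<phi> s *\<^sub>R f s) = integral {a..b} (\<lambda>s. (deriv ^^ k) \<phi> s *\<^sub>R f s)"
    if "test_function a b \<phi>" "continuous_on {a..b} f" for \<phi> k and f :: "real \<Rightarrow> 'a"
  proof -
    have "smooth \<phi>" using that(1) by (simp add: test_function_def smooth_iff)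
    then show ?thesis
      using ab that(2) by (intro Bochner_integral_weighted_continuous integrable_lebesgue_on_continuous continuous_on_smooth_deriv) auto
  qed
  from this this[of _ _ 0] show ?thesis
    unfolding has_weak_deriv_def using locally_Bochner_integrable_continuous g v by auto
qed

lemma has_weak_deriv_cong:
  fixes g v :: "real \<Rightarrow> 'a::banach"
  assumes eq: "\<And>t. t \<in> {a..b} \<Longrightarrow> g t = g' t"
  shows "has_weak_deriv n a b g v \<longleftrightarrow> has_weak_deriv n a b g' v"
proof -
  have "locally_Bochner_integrable a b g \<longleftrightarrow> locally_Bochner_integrable a b g'"
    unfolding locally_Bochner_integrable_def Bochner_integrable_def
    using eq by (intro all_cong1 imp_cong refl arg_cong[where f=Ex] ext has_Bochner_cong) auto
  moreover have "Bochner_integral (lebesgue_on {a..b}) (\<lambda>s. (deriv ^^ n) \<phi> s *\<^sub>R g s) = Bochner_integral (lebesgue_on {a..b}) (\<lambda>s. (deriv ^^ n) \<phi> s *\<^sub>R g' s)" for \<phi>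
    using eq by (intro Bochner_integral_cong) auto
  ultimately show ?thesis unfolding has_weak_deriv_def by simp
qed

section \<open>Characterization of fractional derivatives\<close>

text \<open>The derivatives are named explicitly, so that chains can be combined, shifted and
  prolonged by fractional integrals before they are identified with \<open>ivl_deriv\<close>. On
  [a, b] a chain is determined by its entry 0 (\<open>deriv_chain_unique\<close>).\<close>

definition deriv_chain :: "nat \<Rightarrow> real \<Rightarrow> real \<Rightarrow> (nat \<Rightarrow> real \<Rightarrow> 'a::real_normed_vector) \<Rightarrow> bool" where
  "deriv_chain k a b F \<longleftrightarrow>
     (\<forall>j<k. \<forall>t\<in>{a..b}. (F j has_vector_derivative F (Suc j) t) (at t within {a..b})) \<and> continuous_on {a..b} (F k)"

lemma deriv_chainD:
  "deriv_chain k a b F \<Longrightarrow> j < k \<Longrightarrow> t \<in> {a..b} \<Longrightarrow> (F j has_vector_derivative F (Suc j) t) (at t within {a..b})"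
  by (simp add: deriv_chain_def)

lemma deriv_chain_continuous: "deriv_chain k a b F \<Longrightarrow> j \<le> k \<Longrightarrow> continuous_on {a..b} (F j)"
  by (cases "j = k") (auto simp: deriv_chain_def intro!: continuous_on_vector_derivative[of _ _ "F (Suc j)"])

lemma deriv_chain_Suc: "deriv_chain (Suc k) a b F \<Longrightarrow> deriv_chain k a b (\<lambda>j. F (Suc j))"
  by (simp add: deriv_chain_def)

lemma deriv_chain_diff:
  "deriv_chain k a b F \<Longrightarrow> deriv_chain k a b G \<Longrightarrow> deriv_chain k a b (\<lambda>j t. F j t - G j t)"
  by (auto simp: deriv_chain_def intro!: has_vector_derivative_diff continuous_intros)

lemma deriv_chain_unique:
  assumes ab: "a < b" and F: "deriv_chain k a b F" and G: "deriv_chain k a b G"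
    and eq: "\<And>t. t \<in> {a..b} \<Longrightarrow> F 0 t = G 0 t" and j: "j \<le> k" and t: "t \<in> {a..b}"
  shows "F j t = G j t"
  using j t
proof (induction j arbitrary: t)
  case (Suc j)
  show ?case
  proof (rule vector_derivative_unique_within_Icc[OF ab Suc.prems(2)])
    show "(F j has_vector_derivative F (Suc j) t) (at t within {a..b})"
      using Suc.prems by (intro deriv_chainD[OF F]) auto
    show "(F j has_vector_derivative G (Suc j) t) (at t within {a..b})"
      by (rule has_vector_derivative_transform[OF Suc.prems(2) _ deriv_chainD[OF G]]) (use Suc in auto)
  qed
qed (use eq in simp)

lemma deriv_chain_fint:
  fixes v :: "real \<Rightarrow> 'a::banach"
  assumes "0 < \<beta>" "a \<le> b" "continuous_on {a..b} v"
  shows "deriv_chain k a b (\<lambda>j. fint (\<beta> + real (k - j)) a v)"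
  unfolding deriv_chain_def
proof (intro conjI allI impI ballI)
  fix j t assume j: "j < k" and t: "t \<in> {a..b}"
  have "\<beta> + real (k - j) = (\<beta> + real (k - Suc j)) + 1" using j by (simp add: of_nat_diff)
  then show "(fint (\<beta> + real (k - j)) a v has_vector_derivative fint (\<beta> + real (k - Suc j)) a v t) (at t within {a..b})"
    using has_vector_derivative_fint[of "\<beta> + real (k - Suc j)" a b v t] assms t by simp
qed (use assms in \<open>auto intro: continuous_on_fint\<close>)

text \<open>The induction runs down from the top derivative, the only one known at the start. Each
  integration raises the order by one, and the zero initial values leave no constants.\<close>

lemma deriv_chain_integrate:
  fixes v :: "real \<Rightarrow> 'a::banach"
  assumes F: "deriv_chain k a b F" and \<beta>: "\<beta> > 0" and v: "continuous_on {a..b} v"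
    and Fk: "\<And>t. t \<in> {a..b} \<Longrightarrow> F k t = fint \<beta> a v t" and zero: "\<And>j. j \<le> k \<Longrightarrow> F j a = 0" and t: "t \<in> {a..b}" and i: "i \<le> k"
  shows "F (k - i) t = fint (\<beta> + real i) a v t"
  using i t
proof (induction i arbitrary: t)
  case (Suc i)
  have e: "Suc (k - Suc i) = k - i" using Suc.prems by simp
  have "F (k - Suc i) t = F (k - Suc i) a + fint 1 a (F (k - i)) t"
    using fint_1_derivative[of a b "F (k - Suc i)" "F (k - i)" t] deriv_chainD[OF F, of "k - Suc i"] Suc.prems
    unfolding e by simp
  also have "F (k - Suc i) a = 0" by (rule zero) simp
  also have "fint 1 a (F (k - i)) t = fint 1 a (fint (\<beta> + real i) a v) t"
    using Suc by (intro fint_cong) auto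
  also have "\<dots> = fint (\<beta> + real (Suc i)) a v t"
    using fint_fint[of 1 "\<beta> + real i" a b v t] \<beta> v Suc.prems by (simp add: add_ac)
  finally show ?case by simp
qed (use Fk in simp)

text \<open>The first derivative behaves like \<beta> c_0 (t - a)^(\<beta> - 1) near a, which is
  unbounded unless c_0 = 0. With that term gone, the derivative is a sum of the same shape with one
  term fewer, and the induction continues.\<close>

lemma powr_sum_coeff_0:
  fixes c :: "nat \<Rightarrow> 'a::banach"
  assumes ab: "a < b" and \<beta>: "0 < \<beta>" "\<beta> < 1"
    and F: "deriv_chain m a b F" and F0: "\<And>t. t \<in> {a..b} \<Longrightarrow> F 0 t = (\<Sum>j<m. (t - a) powr (real j + \<beta>) *\<^sub>R c j)"
    and j: "j < m"
  shows "c j = 0"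
  using F F0 j
proof (induction m arbitrary: F c j)
  case (Suc n)
  define S where "S t = (\<Sum>j<Suc n. ((real j + \<beta>) * (t - a) powr (real j + \<beta> - 1)) *\<^sub>R c j)" for t
  have F1: "F 1 t = S t" if t: "t \<in> {a<..b}" for t
  proof -
    have t': "t \<in> {a..b}" using t by auto
    show ?thesis
    proof (rule vector_derivative_unique_within_Icc[OF ab t'])
      show "(F 0 has_vector_derivative F 1 t) (at t within {a..b})"
        using deriv_chainD[OF Suc.prems(1), of 0 t] t' by simp
      have d: "((\<lambda>t. (t - a) powr (real j + \<beta>)) has_real_derivative (real j + \<beta>) * (t - a) powr (real j + \<beta> - 1)) (at t within {a..b})" for j
      proof -
        have "((\<lambda>t. (t - a) powr (real j + \<beta>)) has_real_derivative (real j + \<beta>) * (t - a) powr (real j + \<beta> - of_nat 1) * (1 - 0)) (at t)"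
          using t by (intro DERIV_fun_powr DERIV_diff DERIV_ident DERIV_const) auto
        then show ?thesis by (auto intro: DERIV_subset)
      qed
      have "((\<lambda>t. \<Sum>j<Suc n. (t - a) powr (real j + \<beta>) *\<^sub>R c j) has_vector_derivative S t) (at t within {a..b})"
        unfolding S_def
        using has_vector_derivative_scaleR[OF d has_vector_derivative_const]
        by (intro has_vector_derivative_sum) simp
      then show "(F 0 has_vector_derivative S t) (at t within {a..b})"
        by (rule has_vector_derivative_transform[OF t' _, rotated]) (use Suc.prems(2) in simp)
    qed
  qed
  have F1c: "continuous_on {a..b} (F 1)" by (rule deriv_chain_continuous[OF Suc.prems(1)]) simp
  have mem: "a \<in> {a..b}" using ab by simp
  have nb: "at a within {a<..b} \<noteq> bot"
  proof -
    have "{a<..b} - {a} = {a<..b}" by auto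
    then show ?thesis using ab by (simp add: trivial_limit_within islimpt_in_closure)
  qed
  \<comment> \<open>The product (t - a)^(1-\<beta>) F_1(t) tends to 0 because F_1 is continuous, and
    to \<beta> c_0 by the explicit formula; comparing the limits gives c_0 = 0.\<close>
  have "((\<lambda>t. (t - a) powr (1 - \<beta>) *\<^sub>R F 1 t) \<longlongrightarrow> (a - a) powr (1 - \<beta>) *\<^sub>R F 1 a) (at a within {a..b})"
  proof -
    have "continuous_on {a..b} (\<lambda>t. (t - a) powr (1 - \<beta>) *\<^sub>R F 1 t)"
      using \<beta> by (intro continuous_on_scaleR continuous_on_powr' continuous_intros F1c) auto
    from bspec[OF this[unfolded continuous_on_def] mem] show ?thesis .
  qed
  then have "((\<lambda>t. (t - a) powr (1 - \<beta>) *\<^sub>R F 1 t) \<longlongrightarrow> 0) (at a within {a..b})" by simp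
  then have l1: "((\<lambda>t. (t - a) powr (1 - \<beta>) *\<^sub>R F 1 t) \<longlongrightarrow> 0) (at a within {a<..b})"
    by (rule tendsto_within_subset) auto
  have "((\<lambda>t. \<Sum>j<Suc n. ((real j + \<beta>) * (t - a) ^ j) *\<^sub>R c j) \<longlongrightarrow> (\<Sum>j<Suc n. ((real j + \<beta>) * (a - a) ^ j) *\<^sub>R c j)) (at a within {a<..b})"
    by (intro tendsto_intros)
  moreover have "(\<Sum>j<Suc n. ((real j + \<beta>) * (a - a) ^ j) *\<^sub>R c j) = \<beta> *\<^sub>R c 0"
    by (subst sum.lessThan_Suc_shift) simp
  moreover have "\<forall>\<^sub>F t in at a within {a<..b}. (\<Sum>j<Suc n. ((real j + \<beta>) * (t - a) ^ j) *\<^sub>R c j) = (t - a) powr (1 - \<beta>) *\<^sub>R F 1 t"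
    unfolding eventually_at_filter
  proof (intro always_eventually allI impI)
    fix t assume t: "t \<noteq> a" "t \<in> {a<..b}"
    have "(t - a) powr (1 - \<beta>) * ((real j + \<beta>) * (t - a) powr (real j + \<beta> - 1)) = (real j + \<beta>) * (t - a) ^ j" for j
    proof -
      have "(t - a) powr (1 - \<beta>) * (t - a) powr (real j + \<beta> - 1) = (t - a) ^ j"
        using t by (simp add: powr_add[symmetric] powr_realpow)
      then show ?thesis by (metis mult.left_commute)
    qed
    then show "(\<Sum>j<Suc n. ((real j + \<beta>) * (t - a) ^ j) *\<^sub>R c j) = (t - a) powr (1 - \<beta>) *\<^sub>R F 1 t"
      unfolding F1[OF t(2)] S_def scaleR_sum_right scaleR_scaleR by (simp only:)
  qed
  ultimately have l2: "((\<lambda>t. (t - a) powr (1 - \<beta>) *\<^sub>R F 1 t) \<longlongrightarrow> \<beta> *\<^sub>R c 0) (at a within {a<..b})"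
    by (simp add: Lim_transform_eventually)
  have c0: "c 0 = 0" using tendsto_unique[OF nb l1 l2] \<beta> by simp
  \<comment> \<open>Lowering the exponent j + \<beta> by one and reindexing gives i + \<beta> again,
    with coefficients rescaled by nonzero factors.\<close>
  define T where "T t = (\<Sum>i<n. (t - a) powr (real i + \<beta>) *\<^sub>R ((real (Suc i) + \<beta>) *\<^sub>R c (Suc i)))" for t
  have ST: "S t = T t" for t
    unfolding S_def T_def sum.lessThan_Suc_shift by (simp add: c0 algebra_simps)
  have Tc: "continuous_on {a..b} T"
    unfolding T_def using \<beta> by (intro continuous_on_sum continuous_on_scaleR continuous_on_powr' continuous_intros) auto
  have cl: "closure {a<..b} = {a..b}" using ab by simp
  have FT: "F (Suc 0) t = T t" if "t \<in> {a..b}" for t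
  proof -
    \<comment> \<open>The formula for the derivative is only known for t > a; continuity of both
      sides extends it to a.\<close>
    have "continuous_on (closure {a<..b}) (\<lambda>t. F 1 t - T t)"
      unfolding cl by (intro continuous_intros F1c Tc)
    then have "F 1 t - T t = 0"
      by (rule continuous_constant_on_closure) (use F1 ST that in \<open>auto simp: cl\<close>)
    then show ?thesis by simp
  qed
  have "(real (Suc i) + \<beta>) *\<^sub>R c (Suc i) = 0" if "i < n" for i
    by (rule Suc.IH[OF deriv_chain_Suc[OF Suc.prems(1)] _ that]) (simp add: FT T_def)
  then have "c (Suc i) = 0" if "i < n" for i
  proof -
    have "real (Suc i) + \<beta> \<noteq> 0" using \<beta> by linarith
    moreover have "(real (Suc i) + \<beta>) *\<^sub>R c (Suc i) = 0"
      using \<open>\<And>i. i < n \<Longrightarrow> (real (Suc i) + \<beta>) *\<^sub>R c (Suc i) = 0\<close> that .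
    ultimately show ?thesis by (simp del: of_nat_Suc)
  qed
  with c0 Suc.prems(3) show ?case by (cases j) auto
qed simp

lemma deriv_chain_polynomial_last_const:
  fixes c :: "nat \<Rightarrow> 'a::banach"
  assumes ab: "a < b" and F: "deriv_chain k a b F"
    and F0: "\<And>t. t \<in> {a..b} \<Longrightarrow> F 0 t = (\<Sum>j<Suc k. (t - a) ^ j *\<^sub>R c j)" and t: "t \<in> {a..b}"
  shows "F k t = F k a"
  using F F0
proof (induction k arbitrary: F c)
  case 0
  then show ?case using t ab by simp
next
  case (Suc k)
  have "F (Suc 0) s = (\<Sum>j<Suc k. (s - a) ^ j *\<^sub>R (real (Suc j) *\<^sub>R c (Suc j)))" if s: "s \<in> {a..b}" for s
  proof (rule vector_derivative_unique_within_Icc[OF ab s])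
    show "(F 0 has_vector_derivative F (Suc 0) s) (at s within {a..b})"
      using s by (intro deriv_chainD[OF Suc.prems(1)]) auto
    have "((\<lambda>t. (t - a) ^ Suc j *\<^sub>R c (Suc j)) has_vector_derivative (s - a) ^ j *\<^sub>R (real (Suc j) *\<^sub>R c (Suc j))) (at s within {a..b})" for j
    proof -
      have "((\<lambda>t. (t - a) ^ Suc j) has_real_derivative (1 + real j) * ((1 - 0) * (s - a) ^ j)) (at s within {a..b})"
        by (intro DERIV_power_Suc DERIV_diff DERIV_ident DERIV_const)
      from has_vector_derivative_scaleR[OF this has_vector_derivative_const[of "c (Suc j)"]]
      show ?thesis by (simp add: mult.commute)
    qed
    then have "((\<lambda>t. (t - a) ^ 0 *\<^sub>R c 0 + (\<Sum>j<Suc k. (t - a) ^ Suc j *\<^sub>R c (Suc j))) has_vector_derivative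
        0 + (\<Sum>j<Suc k. (s - a) ^ j *\<^sub>R (real (Suc j) *\<^sub>R c (Suc j)))) (at s within {a..b})"
      by (intro has_vector_derivative_add has_vector_derivative_sum) auto
    then have d: "((\<lambda>t. \<Sum>j<Suc (Suc k). (t - a) ^ j *\<^sub>R c j) has_vector_derivative
        (\<Sum>j<Suc k. (s - a) ^ j *\<^sub>R (real (Suc j) *\<^sub>R c (Suc j)))) (at s within {a..b})"
      by (simp only: sum.lessThan_Suc_shift[of _ "Suc k"] add_0)
    show "(F 0 has_vector_derivative (\<Sum>j<Suc k. (s - a) ^ j *\<^sub>R (real (Suc j) *\<^sub>R c (Suc j)))) (at s within {a..b})"
      by (rule has_vector_derivative_transform[OF s _ d]) (rule Suc.prems(2))
  qed
  from Suc.IH[OF deriv_chain_Suc[OF Suc.prems(1)] this] show ?case .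
qed

lemma integral_deriv_test_function_fint:
  fixes v :: "real \<Rightarrow> 'a::banach"
  assumes ab: "a < b" and v: "continuous_on {a..b} v" and \<phi>: "test_function a b \<phi>"
  shows "integral {a..b} (\<lambda>s. (deriv ^^ Suc k) \<phi> s *\<^sub>R fint (real (Suc k)) a v s) = (- 1) ^ Suc k *\<^sub>R integral {a..b} (\<lambda>s. \<phi> s *\<^sub>R v s)"
proof -
  \<comment> \<open>The chain of fractional integrals ends at order 1; one more differentiation
    gives \<open>v\<close>, which is appended as the last entry.\<close>
  define H where "H j = (if j = Suc k then v else fint (1 + real (k - j)) a v)" for j
  have "(H j has_vector_derivative H (Suc j) t) (at t within {a..b})" if j: "j < Suc k" and t: "t \<in> {a..b}" for j t
  proof (cases "j = k")
    case True
    then show ?thesis using has_vector_derivative_fint_1[OF v t] by (simp add: H_def)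
  next
    case False
    then show ?thesis using deriv_chainD[OF deriv_chain_fint[of 1 a b v k], of j t] j t ab v by (simp add: H_def)
  qed
  from integral_deriv_test_function[where H = H, OF ab \<phi> this, of "Suc k"] v show ?thesis
    by (simp add: H_def add.commute)
qed

text \<open>\<open>fint (real (Suc k)) a v\<close> has the same weak derivative \<open>v\<close>, so
  the difference is annihilated by all (k+1)-st derivatives of test functions.\<close>

lemma weak_deriv_polynomial:
  fixes g v :: "real \<Rightarrow> 'a::banach"
  assumes ab: "a < b" and g: "continuous_on {a..b} g" and v: "continuous_on {a..b} v"
    and wd: "has_weak_deriv (Suc k) a b g v"
  shows "\<exists>c. \<forall>t\<in>{a..b}. g t - fint (real (Suc k)) a v t = (\<Sum>j<Suc k. (t - a) ^ j *\<^sub>R c j)"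
proof (rule du_Bois_Reymond[OF ab])
  have J: "continuous_on {a..b} (fint (real (Suc k)) a v)" using ab v by (intro continuous_on_fint) auto
  show "continuous_on {a..b} (\<lambda>t. g t - fint (real (Suc k)) a v t)" by (intro continuous_intros g J)
  fix \<phi> assume \<phi>: "test_function a b \<phi>"
  then have c: "continuous_on {a..b} ((deriv ^^ Suc k) \<phi>)"
    by (intro continuous_on_smooth_deriv) (simp add: test_function_def smooth_iff)
  have "integral {a..b} (\<lambda>s. (deriv ^^ Suc k) \<phi> s *\<^sub>R (g s - fint (real (Suc k)) a v s))
    = integral {a..b} (\<lambda>s. (deriv ^^ Suc k) \<phi> s *\<^sub>R g s) - integral {a..b} (\<lambda>s. (deriv ^^ Suc k) \<phi> s *\<^sub>R fint (real (Suc k)) a v s)"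
    unfolding scaleR_diff_right by (intro integral_diff integrable_continuous_real continuous_on_scaleR c g J)
  also have "\<dots> = 0"
    using wd \<phi> unfolding has_weak_deriv_continuous_iff[OF ab g v] integral_deriv_test_function_fint[OF ab v \<phi>] by simp
  finally show "integral {a..b} (\<lambda>s. (deriv ^^ Suc k) \<phi> s *\<^sub>R (g s - fint (real (Suc k)) a v s)) = 0" .
qed

lemma fint_sum_monom:
  fixes c :: "nat \<Rightarrow> 'a::banach"
  assumes \<gamma>: "\<gamma> > 0" and at: "a \<le> t"
  shows "fint \<gamma> a (\<lambda>s. \<Sum>j<n. (s - a) ^ j *\<^sub>R c j) t = (\<Sum>j<n. (t - a) powr (real j + \<gamma>) *\<^sub>R ((fact j / Gamma (real j + 1 + \<gamma>)) *\<^sub>R c j))"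
proof (induction n)
  case 0
  then show ?case by (simp add: fint_def)
next
  case (Suc n)
  then show ?case
    unfolding sum.lessThan_Suc using \<gamma> at
    by (subst fint_add) (auto intro!: continuous_intros simp: fint_monom mult.commute)
qed

lemma ceil_nat_eq: "0 < \<beta> \<Longrightarrow> \<beta> \<le> 1 \<Longrightarrow> ceil_nat (real k + \<beta>) = Suc k"
proof -
  assume "0 < \<beta>" "\<beta> \<le> 1"
  then have "\<lceil>real k + \<beta>\<rceil> = int k + 1" by (intro ceiling_unique) auto
  then show ?thesis by simp
qed

text \<open>From left to right, \<open>J^\<beta>\<close> is applied to the polynomial identity of
  \<open>weak_deriv_polynomial\<close>. It turns \<open>g\<close> into an ordinary antiderivative of
  \<open>F 0\<close>, whose smoothness is known, and the polynomial into noninteger powers, to which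
  \<open>powr_sum_coeff_0\<close> applies.\<close>

lemma has_RL_deriv_nonint_iff:
  fixes v :: "real \<Rightarrow> 'a::banach"
  assumes ab: "a < b" and \<beta>: "0 < \<beta>" "\<beta> < 1" and F: "deriv_chain k a b F" and v: "continuous_on {a..b} v"
  shows "has_RL_deriv (real k + \<beta>) a b (F 0) v \<longleftrightarrow> (\<forall>t\<in>{a..b}. F k t = fint \<beta> a v t) \<and> (\<forall>j\<le>k. F j a = 0)"
proof -
  have Fc: "continuous_on {a..b} (F j)" if "j \<le> k" for j using deriv_chain_continuous[OF F that] .
  define g where "g = fint (1 - \<beta>) a (F 0)"
  have gc: "continuous_on {a..b} g" unfolding g_def using \<beta> ab Fc by (intro continuous_on_fint) auto
  have Jc: "continuous_on {a..b} (fint r a v)" if "r > 0" for r using that ab v by (intro continuous_on_fint) auto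
  have e: "real (Suc k) - (real k + \<beta>) = 1 - \<beta>" by simp
  have "frac_integral (1 - \<beta>) a (F 0) t = g t" if "t \<in> {a..b}" for t
    unfolding g_def using that \<beta> by (intro frac_integral_eq_fint continuous_on_subset[OF Fc]) auto
  then have "has_RL_deriv (real k + \<beta>) a b (F 0) v \<longleftrightarrow> has_weak_deriv (Suc k) a b g v"
    unfolding has_RL_deriv_def ceil_nat_eq[OF \<beta>(1) less_imp_le[OF \<beta>(2)]] e by (rule has_weak_deriv_cong)
  also have "\<dots> \<longleftrightarrow> (\<forall>t\<in>{a..b}. F k t = fint \<beta> a v t) \<and> (\<forall>j\<le>k. F j a = 0)"
  proof
    assume "has_weak_deriv (Suc k) a b g v"
    from weak_deriv_polynomial[OF ab gc v this] obtain c where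
      c: "\<And>t. t \<in> {a..b} \<Longrightarrow> g t - fint (real (Suc k)) a v t = (\<Sum>j<Suc k. (t - a) ^ j *\<^sub>R c j)" by blast
    define c' where "c' j = (fact j / Gamma (real j + 1 + \<beta>)) *\<^sub>R c j" for j
    \<comment> \<open>The derivatives of \<open>fint 1 a (F 0)\<close> minus a fractional integral
      of \<open>v\<close>; the index of \<open>F\<close> lags by one because
      \<open>fint 1 a (F 0)\<close> is an antiderivative of \<open>F 0\<close>.\<close>
    define H where "H j = (case j of 0 \<Rightarrow> (\<lambda>t. fint 1 a (F 0) t - fint (real (Suc k) + \<beta>) a v t)
      | Suc i \<Rightarrow> (\<lambda>t. F i t - fint (\<beta> + real (k - i)) a v t))" for j
    have H0: "H 0 t = (\<Sum>j<Suc k. (t - a) powr (real j + \<beta>) *\<^sub>R c' j)" if t: "t \<in> {a..b}" for t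
    proof -
      have sub: "continuous_on {a..b} f \<Longrightarrow> continuous_on {a..t} f" for f :: "real \<Rightarrow> 'a"
        using t by (auto intro: continuous_on_subset)
      have "fint \<beta> a (\<lambda>s. g s - fint (real (Suc k)) a v s) t = fint \<beta> a g t - fint \<beta> a (fint (real (Suc k)) a v) t"
        by (intro fint_diff \<beta> sub gc Jc) simp
      also have "fint \<beta> a g t = fint 1 a (F 0) t"
        unfolding g_def using fint_fint[of \<beta> "1 - \<beta>" a b "F 0" t] \<beta> Fc t by simp
      also have "fint \<beta> a (fint (real (Suc k)) a v) t = fint (real (Suc k) + \<beta>) a v t"
        using fint_fint[of \<beta> "real (Suc k)" a b v t] \<beta> v t by (simp add: add.commute)
      finally have "H 0 t = fint \<beta> a (\<lambda>s. g s - fint (real (Suc k)) a v s) t" by (simp add: H_def)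
      also have "\<dots> = fint \<beta> a (\<lambda>s. \<Sum>j<Suc k. (s - a) ^ j *\<^sub>R c j) t"
        by (rule fint_cong) (use c t in auto)
      also have "\<dots> = (\<Sum>j<Suc k. (t - a) powr (real j + \<beta>) *\<^sub>R c' j)"
        unfolding c'_def using t by (intro fint_sum_monom \<beta>) auto
      finally show ?thesis .
    qed
    have Hchain: "deriv_chain (Suc k) a b H"
      unfolding deriv_chain_def
    proof (intro conjI allI impI ballI)
      show "continuous_on {a..b} (H (Suc k))"
        unfolding H_def using \<beta> by (simp add: continuous_intros Fc Jc)
      fix j t assume j: "j < Suc k" and t: "t \<in> {a..b}"
      show "(H j has_vector_derivative H (Suc j) t) (at t within {a..b})"
      proof (cases j)
        case 0
        have "(fint (\<beta> + real k + 1) a v has_vector_derivative fint (\<beta> + real k) a v t) (at t within {a..b})"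
          using \<beta> by (intro has_vector_derivative_fint v t) auto
        then show ?thesis
          unfolding 0 H_def by (auto intro!: has_vector_derivative_diff has_vector_derivative_fint_1 Fc t simp: add_ac)
      next
        case (Suc i)
        then show ?thesis
          using deriv_chainD[OF deriv_chain_diff[OF F deriv_chain_fint[OF \<beta>(1) less_imp_le[OF ab] v, of k]], of i t] j t
          by (simp add: H_def)
      qed
    qed
    have "c' j = 0" if "j < Suc k" for j
      by (rule powr_sum_coeff_0[OF ab \<beta> Hchain H0 that])
    then have "H 0 t = 0" if "t \<in> {a..b}" for t using H0[OF that] by simp
    moreover have "deriv_chain (Suc k) a b (\<lambda>j t. 0 :: 'a)" by (simp add: deriv_chain_def)
    \<comment> \<open>Vanishing of \<open>H 0\<close> passes to all its derivatives, and
      \<open>H (Suc i) = 0\<close> expresses \<open>F i\<close> as a fractional integral; at t = a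
      this gives the initial values.\<close>
    ultimately have HZ: "H j t = 0" if "j \<le> Suc k" "t \<in> {a..b}" for j t
      using deriv_chain_unique[OF ab Hchain] that by blast
    have FJ: "F i t = fint (\<beta> + real (k - i)) a v t" if "i \<le> k" "t \<in> {a..b}" for i t
      using HZ[of "Suc i" t] that by (simp add: H_def)
    show "(\<forall>t\<in>{a..b}. F k t = fint \<beta> a v t) \<and> (\<forall>j\<le>k. F j a = 0)"
      using FJ[of k] FJ[of _ a] ab by simp
  next
    assume A: "(\<forall>t\<in>{a..b}. F k t = fint \<beta> a v t) \<and> (\<forall>j\<le>k. F j a = 0)"
    have F0: "F 0 t = fint (\<beta> + real k) a v t" if "t \<in> {a..b}" for t
      using deriv_chain_integrate[OF F \<beta>(1) v, of t k] A that by simp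
    have gJ: "g t = fint (real (Suc k)) a v t" if t: "t \<in> {a..b}" for t
    proof -
      have "g t = fint (1 - \<beta>) a (fint (\<beta> + real k) a v) t"
        unfolding g_def by (rule fint_cong) (use F0 t in auto)
      also have "\<dots> = fint (real (Suc k)) a v t"
        using fint_fint[of "1 - \<beta>" "\<beta> + real k" a b v t] \<beta> v t by simp
      finally show ?thesis .
    qed
    show "has_weak_deriv (Suc k) a b g v"
      unfolding has_weak_deriv_continuous_iff[OF ab gc v]
    proof (intro allI impI)
      fix \<phi> assume \<phi>: "test_function a b \<phi>"
      have "integral {a..b} (\<lambda>s. (deriv ^^ Suc k) \<phi> s *\<^sub>R g s) = integral {a..b} (\<lambda>s. (deriv ^^ Suc k) \<phi> s *\<^sub>R fint (real (Suc k)) a v s)"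
        by (rule integral_cong) (simp add: gJ)
      then show "integral {a..b} (\<lambda>s. (deriv ^^ Suc k) \<phi> s *\<^sub>R g s) = (- 1) ^ Suc k *\<^sub>R integral {a..b} (\<lambda>s. \<phi> s *\<^sub>R v s)"
        unfolding integral_deriv_test_function_fint[OF ab v \<phi>] .
    qed
  qed
  finally show ?thesis .
qed

text \<open>For integer order no fractional integration precedes the weak derivative. The
  undetermined polynomial has degree at most k, so its k-th derivative is a constant, and the
  initial values stay free.\<close>

lemma has_RL_deriv_int_iff:
  fixes v :: "real \<Rightarrow> 'a::banach"
  assumes ab: "a < b" and F: "deriv_chain k a b F" and v: "continuous_on {a..b} v"
  shows "has_RL_deriv (real k + 1) a b (F 0) v \<longleftrightarrow> (\<forall>t\<in>{a..b}. F k t = F k a + fint 1 a v t)"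
proof -
  have Fc: "continuous_on {a..b} (F j)" if "j \<le> k" for j using deriv_chain_continuous[OF F that] .
  have e: "real (Suc k) - (real k + 1) = 0" by simp
  have "has_RL_deriv (real k + 1) a b (F 0) v \<longleftrightarrow> has_weak_deriv (Suc k) a b (F 0) v"
    unfolding has_RL_deriv_def ceil_nat_eq[OF zero_less_one order_refl] e by (rule has_weak_deriv_cong) (simp add: frac_integral_def)
  also have "\<dots> \<longleftrightarrow> (\<forall>t\<in>{a..b}. F k t = F k a + fint 1 a v t)"
  proof
    assume "has_weak_deriv (Suc k) a b (F 0) v"
    from weak_deriv_polynomial[OF ab Fc v this] obtain c where
      c: "\<And>t. t \<in> {a..b} \<Longrightarrow> F 0 t - fint (1 + real k) a v t = (\<Sum>j<Suc k. (t - a) ^ j *\<^sub>R c j)" by (auto simp: add.commute)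
    have E: "F k t - fint (1 + real (k - k)) a v t = F k a - fint (1 + real (k - k)) a v a" if "t \<in> {a..b}" for t
      using deriv_chain_polynomial_last_const[OF ab deriv_chain_diff[OF F deriv_chain_fint[of 1, OF zero_less_one less_imp_le[OF ab] v, of k]] _ that] c
      by simp
    show "\<forall>t\<in>{a..b}. F k t = F k a + fint 1 a v t"
    proof
      fix t assume "t \<in> {a..b}"
      from E[OF this] show "F k t = F k a + fint 1 a v t" by (simp add: diff_eq_eq)
    qed
  next
    assume A: "\<forall>t\<in>{a..b}. F k t = F k a + fint 1 a v t"
    define H where "H j = (if j = Suc k then v else F j)" for j
    have "(H j has_vector_derivative H (Suc j) t) (at t within {a..b})" if j: "j < Suc k" and t: "t \<in> {a..b}" for j t
    proof (cases "j = k")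
      case True
      have "((\<lambda>t. F k a + fint 1 a v t) has_vector_derivative 0 + v t) (at t within {a..b})"
        by (intro has_vector_derivative_add has_vector_derivative_const has_vector_derivative_fint_1 v t)
      then have "(F k has_vector_derivative 0 + v t) (at t within {a..b})"
        by (rule has_vector_derivative_transform[OF t _, rotated]) (use A in blast)
      then show ?thesis using True by (simp add: H_def)
    next
      case False
      then show ?thesis using deriv_chainD[OF F, of j t] j t by (simp add: H_def)
    qed
    from integral_deriv_test_function[where H = H, OF ab _ this, of _ "Suc k"] v
    show "has_weak_deriv (Suc k) a b (F 0) v"
      unfolding has_weak_deriv_continuous_iff[OF ab Fc[OF le0] v] by (simp add: H_def)
  qed
  finally show ?thesis .
qed

lemma has_RL_deriv_iff:
  fixes v :: "real \<Rightarrow> 'a::banach"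
  assumes ab: "a < b" and \<beta>: "0 < \<beta>" "\<beta> \<le> 1" and F: "deriv_chain k a b F" and v: "continuous_on {a..b} v"
  shows "has_RL_deriv (real k + \<beta>) a b (F 0) v \<longleftrightarrow>
    (\<forall>t\<in>{a..b}. F k t = F k a + fint \<beta> a v t) \<and> (\<beta> < 1 \<longrightarrow> (\<forall>j\<le>k. F j a = 0))"
proof (cases "\<beta> = 1")
  case True
  then show ?thesis using has_RL_deriv_int_iff[OF ab F v] by simp
next
  case False
  then have "\<beta> < 1" using \<beta> by simp
  then show ?thesis using has_RL_deriv_nonint_iff[OF ab \<beta>(1) _ F v] by auto
qed

text \<open>Removing the Taylor polynomial makes all initial values up to order k vanish, so the
  extra condition of the Riemann-Liouville case holds automatically, and the k-th derivative changes
  only by its value at a.\<close>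

lemma has_caputo_deriv_iff:
  fixes v :: "real \<Rightarrow> 'a::banach"
  assumes ab: "a < b" and \<beta>: "0 < \<beta>" "\<beta> \<le> 1" and v: "continuous_on {a..b} v"
    and F: "deriv_chain k a b (\<lambda>j. ivl_deriv a b j f)"
  shows "has_caputo_deriv (real k + \<beta>) a b f v \<longleftrightarrow>
    (\<forall>t\<in>{a..b}. ivl_deriv a b k f t = ivl_deriv a b k f a + fint \<beta> a v t)"
proof -
  define x where "x j = ivl_deriv a b j f a" for j
  \<comment> \<open>The i-th derivative of the Taylor polynomial is the Taylor sum of the shifted
    coefficients; \<open>T k\<close> consists of the single constant \<open>x k\<close>.\<close>
  define T where "T i t = (\<Sum>j<Suc k - i. ((t - a) ^ j / fact j) *\<^sub>R x (i + j))" for i t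
  have Ta: "T i a = x i" if "i \<le> k" for i
  proof -
    have "Suc k - i = Suc (k - i)" using that by simp
    then show ?thesis unfolding T_def by (simp only: sum.lessThan_Suc_shift) simp
  qed
  have T: "deriv_chain k a b T"
    unfolding deriv_chain_def
  proof (intro conjI allI impI ballI)
    show "continuous_on {a..b} (T k)" unfolding T_def by (intro continuous_intros) auto
    fix i t assume i: "i < k" and t: "t \<in> {a..b}"
    have n: "Suc k - i = Suc (Suc k - Suc i)" using i by simp
    have "((\<lambda>t. ((t - a) ^ Suc j / fact (Suc j)) *\<^sub>R x (i + Suc j)) has_vector_derivative ((t - a) ^ j / fact j) *\<^sub>R x (Suc i + j)) (at t within {a..b})" for j
      using has_vector_derivative_scaleR[OF power_over_fact_has_real_derivative[of a j t "{a..b}"] has_vector_derivative_const[of "x (i + Suc j)"]]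
      by simp
    then have "((\<lambda>t. ((t - a) ^ 0 / fact 0) *\<^sub>R x (i + 0) + (\<Sum>j<Suc k - Suc i. ((t - a) ^ Suc j / fact (Suc j)) *\<^sub>R x (i + Suc j)))
       has_vector_derivative 0 + (\<Sum>j<Suc k - Suc i. ((t - a) ^ j / fact j) *\<^sub>R x (Suc i + j))) (at t within {a..b})"
      by (intro has_vector_derivative_add has_vector_derivative_sum) auto
    then show "(T i has_vector_derivative T (Suc i) t) (at t within {a..b})"
      unfolding T_def[abs_def] n[THEN arg_cong[where f = lessThan]] by (simp only: sum.lessThan_Suc_shift add_0)
  qed
  have Tk: "T k t = x k" for t by (simp add: T_def)
  have "has_caputo_deriv (real k + \<beta>) a b f v \<longleftrightarrow> has_RL_deriv (real k + \<beta>) a b (\<lambda>t. ivl_deriv a b 0 f t - T 0 t) v"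
    unfolding has_caputo_deriv_def ceil_nat_eq[OF \<beta>] taylor_poly_def T_def x_def by simp
  also have "\<dots> \<longleftrightarrow> (\<forall>t\<in>{a..b}. ivl_deriv a b k f t - T k t = ivl_deriv a b k f a - T k a + fint \<beta> a v t) \<and>
      (\<beta> < 1 \<longrightarrow> (\<forall>j\<le>k. ivl_deriv a b j f a - T j a = 0))"
    using has_RL_deriv_iff[OF ab \<beta> deriv_chain_diff[OF F T] v] by simp
  also have "\<dots> \<longleftrightarrow> (\<forall>t\<in>{a..b}. ivl_deriv a b k f t = ivl_deriv a b k f a + fint \<beta> a v t)"
    by (simp add: Ta Tk x_def[symmetric] algebra_simps)
  finally show ?thesis .
qed

section \<open>Chains and the classical derivatives on the interval\<close>

lemma Ck_space_iff_deriv_chain: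
  "f \<in> Ck_space k a b \<longleftrightarrow> (\<forall>t. t \<notin> {a..b} \<longrightarrow> f t = 0) \<and> deriv_chain k a b (\<lambda>j. ivl_deriv a b j f)"
  unfolding Ck_space_def deriv_chain_def by (auto simp: vector_derivative_works)

text \<open>\<open>ivl_deriv\<close> is built from the choice-based
  \<open>vector_derivative\<close>. Uniqueness of derivatives within [a, b], also at the end points,
  identifies it with any explicitly given chain.\<close>

lemma deriv_chain_ivl_deriv:
  fixes F :: "nat \<Rightarrow> real \<Rightarrow> 'a::real_normed_vector"
  assumes ab: "a < b" and F: "deriv_chain k a b F" and f: "\<And>t. t \<in> {a..b} \<Longrightarrow> f t = F 0 t"
  shows "deriv_chain k a b (\<lambda>j. ivl_deriv a b j f)" and "\<And>j t. j \<le> k \<Longrightarrow> t \<in> {a..b} \<Longrightarrow> ivl_deriv a b j f t = F j t"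
proof -
  have D: "(ivl_deriv a b j f has_vector_derivative F (Suc j) t) (at t within {a..b})"
    if "j < k" "t \<in> {a..b}" "\<And>t. t \<in> {a..b} \<Longrightarrow> ivl_deriv a b j f t = F j t" for j t
    by (rule has_vector_derivative_transform[OF that(2) _ deriv_chainD[OF F that(1,2)]]) (rule that(3))
  show eq: "ivl_deriv a b j f t = F j t" if "j \<le> k" "t \<in> {a..b}" for j t
    using that
  proof (induction j arbitrary: t)
    case (Suc j)
    have D: "(ivl_deriv a b j f has_vector_derivative F (Suc j) t) (at t within {a..b})"
      using Suc by (intro D) auto
    then have "ivl_deriv a b j f differentiable (at t within {a..b})" by (rule differentiableI_vector)
    from vector_derivative_unique_within_Icc[OF ab Suc.prems(2) vector_derivative_works[THEN iffD1, OF this] D]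
    show ?case by simp
  qed (use f in simp)
  show "deriv_chain k a b (\<lambda>j. ivl_deriv a b j f)"
    unfolding deriv_chain_def
  proof (intro conjI allI impI ballI)
    fix j t assume "j < k" "t \<in> {a..b}"
    then show "(ivl_deriv a b j f has_vector_derivative ivl_deriv a b (Suc j) f t) (at t within {a..b})"
      using D[of j t] eq[of "Suc j" t] eq[of j] by simp
  next
    show "continuous_on {a..b} (ivl_deriv a b k f)"
      by (rule continuous_on_eq[OF deriv_chain_continuous[OF F order_refl]]) (simp add: eq)
  qed
qed

section \<open>Functions whose highest derivative is a constant plus a fractional integral\<close>

definition sup_norm :: "real \<Rightarrow> real \<Rightarrow> (real \<Rightarrow> 'a::real_normed_vector) \<Rightarrow> real" where
  "sup_norm a b f = (SUP t\<in>{a..b}. norm (f t))"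

lemma norm_le_sup_norm:
  assumes "continuous_on {a..b} f" "t \<in> {a..b}"
  shows "norm (f t) \<le> sup_norm a b f"
proof -
  have "compact ((\<lambda>t. norm (f t)) ` {a..b})"
    using assms by (intro compact_continuous_image continuous_intros) auto
  then have "bdd_above ((\<lambda>t. norm (f t)) ` {a..b})"
    by (intro bounded_imp_bdd_above compact_imp_bounded)
  then show ?thesis unfolding sup_norm_def using assms(2) by (intro cSUP_upper) auto
qed

lemma sup_norm_le:
  assumes "a \<le> b" "\<And>t. t \<in> {a..b} \<Longrightarrow> norm (f t) \<le> M"
  shows "sup_norm a b f \<le> M"
  unfolding sup_norm_def using assms by (intro cSUP_least) auto

lemma sup_norm_cong:
  assumes "\<And>t. t \<in> {a..b} \<Longrightarrow> f t = g t"
  shows "sup_norm a b f = sup_norm a b g"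
  unfolding sup_norm_def using assms by (intro SUP_cong) auto

lemma sup_norm_nonneg: "a \<le> b \<Longrightarrow> continuous_on {a..b} f \<Longrightarrow> 0 \<le> sup_norm a b f"
  using norm_le_sup_norm[of a b f a] norm_ge_zero[of "f a"] by (simp del: norm_ge_zero)

lemma sup_norm_triangle:
  assumes "a \<le> b" "continuous_on {a..b} f" "continuous_on {a..b} g"
  shows "sup_norm a b (\<lambda>t. f t + g t) \<le> sup_norm a b f + sup_norm a b g"
  using assms by (intro sup_norm_le norm_triangle_mono norm_le_sup_norm)

text \<open>The map \<open>h\<close> stands for multiplication by a scalar of the field 'k, which
  may be complex; only its effect on norms enters.\<close>

lemma sup_norm_scale:
  assumes ab: "a \<le> b" and f: "continuous_on {a..b} f" and h: "\<And>x. norm (h x) = c * norm x"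
  shows "sup_norm a b (\<lambda>t. h (f t)) = c * sup_norm a b f"
proof -
  show ?thesis
  proof (cases "c > 0")
    case True
    show ?thesis
    proof (rule antisym)
      show "sup_norm a b (\<lambda>t. h (f t)) \<le> c * sup_norm a b f"
        using True by (intro sup_norm_le ab) (auto simp: h intro!: mult_left_mono norm_le_sup_norm f)
      have "norm (f t) \<le> sup_norm a b (\<lambda>t. h (f t)) / c" if "t \<in> {a..b}" for t
      proof -
        have "c * norm (f t) \<le> sup_norm a b (\<lambda>t. h (f t))"
          unfolding h[symmetric] sup_norm_def
        proof (rule cSUP_upper[OF that])
          have "compact ((\<lambda>t. c * norm (f t)) ` {a..b})"
            using f by (intro compact_continuous_image continuous_intros) auto
          then show "bdd_above ((\<lambda>t. norm (h (f t))) ` {a..b})"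
            unfolding h by (intro bounded_imp_bdd_above compact_imp_bounded)
        qed
        then show ?thesis using True by (simp add: field_simps)
      qed
      then have "sup_norm a b f \<le> sup_norm a b (\<lambda>t. h (f t)) / c" by (intro sup_norm_le ab)
      then show "c * sup_norm a b f \<le> sup_norm a b (\<lambda>t. h (f t))" using True by (simp add: field_simps)
    qed
  next
    case False
    \<comment> \<open>A nonpositive ratio of norms is zero unless the space is trivial, and both
      cases give 0 on each side.\<close>
    have z: "c * norm x = 0" for x :: 'a
      using h[of x] norm_ge_zero[of "h x"] False
      by (metis mult_nonpos_nonneg norm_ge_zero not_less order_antisym)
    then have 0: "c = 0 \<or> (\<forall>x::'a. x = 0)" by auto
    have "sup_norm a b (\<lambda>t. h (f t)) = (SUP t\<in>{a..b}. 0)"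
      unfolding sup_norm_def h z ..
    also have "\<dots> = 0" using ab by simp
    also have "\<dots> = c * sup_norm a b f"
    proof (cases "c = 0")
      case False
      then have "f t = 0" for t using 0 by simp
      then show ?thesis using ab by (simp add: sup_norm_def)
    qed simp
    finally show ?thesis .
  qed
qed

text \<open>One relation for both spaces: \<open>z\<close> is \<open>\<beta> < 1\<close> for the
  Riemann-Liouville space and \<open>False\<close> for the Caputo space. The function
  \<open>v\<close> is the fractional derivative in either case.\<close>

definition frac_repr :: "bool \<Rightarrow> real \<Rightarrow> nat \<Rightarrow> real \<Rightarrow> real \<Rightarrow> (real \<Rightarrow> 'a::banach) \<Rightarrow> (real \<Rightarrow> 'a) \<Rightarrow> bool" where
  "frac_repr z \<beta> k a b f v \<longleftrightarrow> f \<in> Ck_space k a b \<and> continuous_on {a..b} v \<and>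
     (\<forall>t\<in>{a..b}. ivl_deriv a b k f t = ivl_deriv a b k f a + fint \<beta> a v t) \<and>
     (z \<longrightarrow> (\<forall>j\<le>k. ivl_deriv a b j f a = 0))"

definition frac_norm :: "nat \<Rightarrow> real \<Rightarrow> real \<Rightarrow> (real \<Rightarrow> 'a::banach) \<Rightarrow> (real \<Rightarrow> 'a) \<Rightarrow> real" where
  "frac_norm k a b f v = (\<Sum>j\<le>k. sup_norm a b (ivl_deriv a b j f)) + sup_norm a b v"

lemma frac_reprI:
  fixes F :: "nat \<Rightarrow> real \<Rightarrow> 'a::banach"
  assumes ab: "a < b" and F: "deriv_chain k a b F" and f: "\<And>t. t \<in> {a..b} \<Longrightarrow> f t = F 0 t" "\<And>t. t \<notin> {a..b} \<Longrightarrow> f t = 0"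
    and v: "continuous_on {a..b} v" and eq: "\<And>t. t \<in> {a..b} \<Longrightarrow> F k t = F k a + fint \<beta> a v t"
    and zero: "\<And>j. z \<Longrightarrow> j \<le> k \<Longrightarrow> F j a = 0"
  shows "frac_repr z \<beta> k a b f v" and "\<And>j t. j \<le> k \<Longrightarrow> t \<in> {a..b} \<Longrightarrow> ivl_deriv a b j f t = F j t"
    and "frac_norm k a b f v = (\<Sum>j\<le>k. sup_norm a b (F j)) + sup_norm a b v"
proof -
  note D = deriv_chain_ivl_deriv[OF ab F f(1)]
  show e: "\<And>j t. j \<le> k \<Longrightarrow> t \<in> {a..b} \<Longrightarrow> ivl_deriv a b j f t = F j t" by (rule D(2))
  have "a \<in> {a..b}" using ab by simp
  then have "ivl_deriv a b k f t = ivl_deriv a b k f a + fint \<beta> a v t" if "t \<in> {a..b}" for t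
    using eq[OF that] e[OF order_refl that] e[OF order_refl, of a] by simp
  moreover have "ivl_deriv a b j f a = 0" if z "j \<le> k" for j
    using zero[OF that] e[OF that(2) \<open>a \<in> {a..b}\<close>] by simp
  ultimately show "frac_repr z \<beta> k a b f v"
    unfolding frac_repr_def Ck_space_iff_deriv_chain using D(1) f(2) v by blast
  have "sup_norm a b (ivl_deriv a b j f) = sup_norm a b (F j)" if "j \<le> k" for j
    using e that by (intro sup_norm_cong) auto
  then show "frac_norm k a b f v = (\<Sum>j\<le>k. sup_norm a b (F j)) + sup_norm a b v"
    by (simp add: frac_norm_def)
qed

lemma frac_reprD:
  assumes "frac_repr z \<beta> k a b f v"
  shows "deriv_chain k a b (\<lambda>j. ivl_deriv a b j f)" "\<And>t. t \<notin> {a..b} \<Longrightarrow> f t = 0" "continuous_on {a..b} v"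
    "\<And>t. t \<in> {a..b} \<Longrightarrow> ivl_deriv a b k f t = ivl_deriv a b k f a + fint \<beta> a v t"
    "\<And>j. z \<Longrightarrow> j \<le> k \<Longrightarrow> ivl_deriv a b j f a = 0"
    "\<And>j. j \<le> k \<Longrightarrow> continuous_on {a..b} (ivl_deriv a b j f)"
  using assms deriv_chain_continuous[of k a b "\<lambda>j. ivl_deriv a b j f"]
  unfolding frac_repr_def Ck_space_iff_deriv_chain by blast+

lemma frac_repr_unique:
  assumes ab: "a < b" and \<beta>: "\<beta> > 0" and v: "frac_repr z \<beta> k a b f v" and w: "frac_repr z' \<beta> k a b f w" and t: "t \<in> {a..b}"
  shows "v t = w t"
proof (rule fint_inject[OF \<beta> ab frac_reprD(3)[OF v] frac_reprD(3)[OF w] _ t])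
  fix s assume "s \<in> {a..b}"
  then show "fint \<beta> a v s = fint \<beta> a w s" using frac_reprD(4)[OF v, of s] frac_reprD(4)[OF w, of s] by simp
qed

lemma frac_norm_le:
  assumes f: "frac_repr z \<beta> k a b f v" and ab: "a < b" and j: "j \<le> k" and t: "t \<in> {a..b}"
  shows "norm (ivl_deriv a b j f t) \<le> frac_norm k a b f v" "norm (v t) \<le> frac_norm k a b f v"
    "0 \<le> frac_norm k a b f v"
proof -
  have nn: "0 \<le> sup_norm a b (ivl_deriv a b j f)" if "j \<le> k" for j
    using ab frac_reprD(6)[OF f that] by (intro sup_norm_nonneg) auto
  have nv: "0 \<le> sup_norm a b v" using ab frac_reprD(3)[OF f] by (intro sup_norm_nonneg) auto
  have "sup_norm a b (ivl_deriv a b j f) \<le> (\<Sum>j\<le>k. sup_norm a b (ivl_deriv a b j f))"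
    using j nn by (intro member_le_sum) auto
  then show "norm (ivl_deriv a b j f t) \<le> frac_norm k a b f v"
    using norm_le_sup_norm[OF frac_reprD(6)[OF f j] t] nv by (simp add: frac_norm_def)
  have "0 \<le> (\<Sum>j\<le>k. sup_norm a b (ivl_deriv a b j f))" using nn by (intro sum_nonneg) auto
  then show "norm (v t) \<le> frac_norm k a b f v" "0 \<le> frac_norm k a b f v"
    using norm_le_sup_norm[OF frac_reprD(3)[OF f] t] nv by (auto simp: frac_norm_def)
qed

text \<open>The factor counts the k + 1 suprema of derivatives and the one of the density.\<close>

lemma frac_norm_leI:
  assumes ab: "a < b" and "\<And>j t. j \<le> k \<Longrightarrow> t \<in> {a..b} \<Longrightarrow> norm (ivl_deriv a b j f t) \<le> M" "\<And>t. t \<in> {a..b} \<Longrightarrow> norm (v t) \<le> M"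
  shows "frac_norm k a b f v \<le> (real k + 2) * M"
proof -
  have "(\<Sum>j\<le>k. sup_norm a b (ivl_deriv a b j f)) \<le> (\<Sum>j\<le>k. M)"
    using assms by (intro sum_mono sup_norm_le) auto
  moreover have "sup_norm a b v \<le> M" using assms by (intro sup_norm_le) auto
  ultimately show ?thesis by (simp add: frac_norm_def algebra_simps)
qed

lemma frac_repr_add:
  assumes ab: "a < b" and \<beta>: "\<beta> > 0" and f: "frac_repr z \<beta> k a b f v" and g: "frac_repr z \<beta> k a b g w"
  shows "frac_repr z \<beta> k a b (\<lambda>t. f t + g t) (\<lambda>t. v t + w t)"
    and "frac_norm k a b (\<lambda>t. f t + g t) (\<lambda>t. v t + w t) \<le> frac_norm k a b f v + frac_norm k a b g w"
proof -
  note F = frac_reprD[OF f] and G = frac_reprD[OF g]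
  have chain: "deriv_chain k a b (\<lambda>j t. ivl_deriv a b j f t + ivl_deriv a b j g t)"
    using F(1) G(1) by (auto simp: deriv_chain_def intro!: has_vector_derivative_add continuous_intros simp del: ivl_deriv.simps)
  have eq: "ivl_deriv a b k f t + ivl_deriv a b k g t = (ivl_deriv a b k f a + ivl_deriv a b k g a) + fint \<beta> a (\<lambda>t. v t + w t) t"
    if t: "t \<in> {a..b}" for t
  proof -
    have "fint \<beta> a (\<lambda>t. v t + w t) t = fint \<beta> a v t + fint \<beta> a w t"
      using t by (intro fint_add \<beta> continuous_on_subset[OF F(3)] continuous_on_subset[OF G(3)]) auto
    then show ?thesis using F(4)[OF t] G(4)[OF t] by simp
  qed
  have vw: "continuous_on {a..b} (\<lambda>t. v t + w t)" using F(3) G(3) by (intro continuous_intros)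
  note R = frac_reprI[OF ab chain, of "\<lambda>t. f t + g t" "\<lambda>t. v t + w t" \<beta> z, OF _ _ vw eq]
  show "frac_repr z \<beta> k a b (\<lambda>t. f t + g t) (\<lambda>t. v t + w t)"
    by (rule R(1)) (use F(2,5) G(2,5) in \<open>auto simp del: ivl_deriv.simps(2)\<close>)
  have "frac_norm k a b (\<lambda>t. f t + g t) (\<lambda>t. v t + w t) = (\<Sum>j\<le>k. sup_norm a b (\<lambda>t. ivl_deriv a b j f t + ivl_deriv a b j g t)) + sup_norm a b (\<lambda>t. v t + w t)"
    by (rule R(3)) (use F(2,5) G(2,5) in \<open>auto simp del: ivl_deriv.simps(2)\<close>)
  also have "\<dots> \<le> (\<Sum>j\<le>k. sup_norm a b (ivl_deriv a b j f) + sup_norm a b (ivl_deriv a b j g)) + (sup_norm a b v + sup_norm a b w)"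
    using ab F(3,6) G(3,6) by (intro add_mono sum_mono sup_norm_triangle) auto
  also have "\<dots> = frac_norm k a b f v + frac_norm k a b g w"
    by (simp add: frac_norm_def sum.distrib)
  finally show "frac_norm k a b (\<lambda>t. f t + g t) (\<lambda>t. v t + w t) \<le> frac_norm k a b f v + frac_norm k a b g w" .
qed

lemma frac_repr_linear:
  fixes f :: "real \<Rightarrow> 'a::banach" and h :: "'a \<Rightarrow> 'a"
  assumes ab: "a < b" and \<beta>: "\<beta> > 0" and h: "bounded_linear h" and f: "frac_repr z \<beta> k a b f v"
  shows "frac_repr z \<beta> k a b (\<lambda>t. h (f t)) (\<lambda>t. h (v t))"
    and "\<And>j t. j \<le> k \<Longrightarrow> t \<in> {a..b} \<Longrightarrow> ivl_deriv a b j (\<lambda>t. h (f t)) t = h (ivl_deriv a b j f t)"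
    and "(\<And>x. norm (h x) = c * norm x) \<Longrightarrow> frac_norm k a b (\<lambda>t. h (f t)) (\<lambda>t. h (v t)) = c * frac_norm k a b f v"
proof -
  interpret h: bounded_linear h by fact
  note F = frac_reprD[OF f]
  have chain: "deriv_chain k a b (\<lambda>j t. h (ivl_deriv a b j f t))"
    using F(1) by (auto simp: deriv_chain_def intro!: h.has_vector_derivative h.continuous_on simp del: ivl_deriv.simps)
  have eq: "h (ivl_deriv a b k f t) = h (ivl_deriv a b k f a) + fint \<beta> a (\<lambda>t. h (v t)) t"
    if t: "t \<in> {a..b}" for t
  proof -
    have "fint \<beta> a (\<lambda>t. h (v t)) t = h (fint \<beta> a v t)"
      using t by (intro fint_linear \<beta> h continuous_on_subset[OF F(3)]) auto
    then show ?thesis using F(4)[OF t] by (metis h.add)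
  qed
  have hv: "continuous_on {a..b} (\<lambda>t. h (v t))" using F(3) by (intro h.continuous_on)
  note R = frac_reprI[OF ab chain, of "\<lambda>t. h (f t)" "\<lambda>t. h (v t)" \<beta> z, OF _ _ hv eq]
  show "frac_repr z \<beta> k a b (\<lambda>t. h (f t)) (\<lambda>t. h (v t))"
    by (rule R(1)) (use F(2,5) in \<open>auto simp: h.zero simp del: ivl_deriv.simps(2)\<close>)
  show "\<And>j t. j \<le> k \<Longrightarrow> t \<in> {a..b} \<Longrightarrow> ivl_deriv a b j (\<lambda>t. h (f t)) t = h (ivl_deriv a b j f t)"
    by (rule R(2)) (use F(2,5) in \<open>auto simp: h.zero simp del: ivl_deriv.simps(2)\<close>)
  assume c: "\<And>x. norm (h x) = c * norm x"
  have "frac_norm k a b (\<lambda>t. h (f t)) (\<lambda>t. h (v t)) = (\<Sum>j\<le>k. sup_norm a b (\<lambda>t. h (ivl_deriv a b j f t))) + sup_norm a b (\<lambda>t. h (v t))"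
    by (rule R(3)) (use F(2,5) in \<open>auto simp: h.zero simp del: ivl_deriv.simps(2)\<close>)
  also have "\<dots> = c * frac_norm k a b f v"
    using ab F(3,6) sup_norm_scale[of a b _ h c] c by (simp add: frac_norm_def sum_distrib_left distrib_left)
  finally show "frac_norm k a b (\<lambda>t. h (f t)) (\<lambda>t. h (v t)) = c * frac_norm k a b f v" .
qed

lemma frac_repr_diff:
  assumes ab: "a < b" and \<beta>: "\<beta> > 0" and f: "frac_repr z \<beta> k a b f v" and g: "frac_repr z \<beta> k a b g w"
  shows "frac_repr z \<beta> k a b (\<lambda>t. f t - g t) (\<lambda>t. v t - w t)"
  using frac_repr_add(1)[OF ab \<beta> f frac_repr_linear(1)[OF ab \<beta> bounded_linear_minus[OF bounded_linear_ident] g]]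
  by simp

lemma ivl_deriv_diff:
  assumes ab: "a < b" and F: "deriv_chain k a b (\<lambda>j. ivl_deriv a b j f)" and G: "deriv_chain k a b (\<lambda>j. ivl_deriv a b j g)"
    and "j \<le> k" "t \<in> {a..b}"
  shows "ivl_deriv a b j (\<lambda>t. f t - g t) t = ivl_deriv a b j f t - ivl_deriv a b j g t"
  using deriv_chain_ivl_deriv(2)[OF ab deriv_chain_diff[OF F G], of "\<lambda>t. f t - g t" j t] assms by simp

lemma frac_repr_zero: "a < b \<Longrightarrow> frac_repr z \<beta> k a b (\<lambda>t. 0) (\<lambda>t. 0)"
  by (rule frac_reprI(1)[of _ _ _ "\<lambda>j t. 0"]) (auto simp: deriv_chain_def fint_def)

lemma frac_norm_eq_0_iff:
  assumes ab: "a < b" and \<beta>: "\<beta> > 0" and f: "frac_repr z \<beta> k a b f v"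
  shows "frac_norm k a b f v = 0 \<longleftrightarrow> f = (\<lambda>t. 0)"
proof
  assume "frac_norm k a b f v = 0"
  then have "norm (f t) \<le> 0" if "t \<in> {a..b}" for t
    using frac_norm_le(1)[OF f ab le0 that] by simp
  then show "f = (\<lambda>t. 0)" using frac_reprD(2)[OF f] by fastforce
next
  assume f0: "f = (\<lambda>t. 0)"
  \<comment> \<open>The zero function is also represented by the density 0, so uniqueness forces
    \<open>v\<close> to vanish on [a, b].\<close>
  have "frac_repr z \<beta> k a b f (\<lambda>t. 0)" unfolding f0 by (rule frac_repr_zero[OF ab])
  from frac_repr_unique[OF ab \<beta> f this] have v0: "v t = 0" if "t \<in> {a..b}" for t
    using that by simp
  have "ivl_deriv a b j f t = 0" if "j \<le> k" "t \<in> {a..b}" for j t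
    using deriv_chain_ivl_deriv(2)[OF ab, of k "\<lambda>j t. 0" f j t] that by (simp add: deriv_chain_def f0)
  then have "frac_norm k a b f v \<le> (real k + 2) * 0"
    using v0 by (intro frac_norm_leI ab) auto
  moreover have "frac_norm k a b f v \<ge> 0" using frac_norm_le(3)[OF f ab, of 0 a] ab by simp
  ultimately show "frac_norm k a b f v = 0" by simp
qed

lemma uniform_limit_norm_diff:
  fixes f :: "nat \<Rightarrow> 'b \<Rightarrow> 'a::banach"
  assumes "\<And>e. e > 0 \<Longrightarrow> \<exists>N. \<forall>m\<ge>N. \<forall>n\<ge>N. \<forall>t\<in>S. norm (f m t - f n t) \<le> e"
  shows "\<exists>l. uniform_limit S f l sequentially"
proof -
  have "uniformly_Cauchy_on S f"
    unfolding uniformly_Cauchy_on_def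
  proof (intro allI impI)
    fix e :: real assume "e > 0"
    then have "e / 2 > 0" by simp
    from assms[OF this] obtain N where N: "\<And>m n t. m \<ge> N \<Longrightarrow> n \<ge> N \<Longrightarrow> t \<in> S \<Longrightarrow> norm (f m t - f n t) \<le> e / 2" by blast
    show "\<exists>M. \<forall>x\<in>S. \<forall>m\<ge>M. \<forall>n\<ge>M. dist (f m x) (f n x) < e"
    proof (intro exI[of _ N] ballI allI impI)
      fix x m n assume "x \<in> S" "N \<le> m" "N \<le> n"
      then show "dist (f m x) (f n x) < e" using N[of m n x] \<open>e > 0\<close> by (simp add: dist_norm)
    qed
  qed
  then show ?thesis using Cauchy_uniformly_convergent unfolding uniformly_convergent_on_def by blast
qed

text \<open>All derivatives and the densities converge uniformly. The relations between them are
  passed to the limit in integrated form, since integrals respect uniform limits, and are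
  differentiated again afterwards.\<close>

lemma frac_repr_complete:
  fixes \<sigma> :: "nat \<Rightarrow> real \<Rightarrow> 'a::banach"
  assumes ab: "a < b" and \<beta>: "\<beta> > 0" and \<sigma>: "\<And>n. frac_repr z \<beta> k a b (\<sigma> n) (v n)"
    and Cauchy: "\<And>e. e > 0 \<Longrightarrow> \<exists>N. \<forall>m\<ge>N. \<forall>n\<ge>N. frac_norm k a b (\<lambda>t. \<sigma> m t - \<sigma> n t) (\<lambda>t. v m t - v n t) < e"
  shows "\<exists>f w. frac_repr z \<beta> k a b f w \<and> (\<lambda>n. frac_norm k a b (\<lambda>t. \<sigma> n t - f t) (\<lambda>t. v n t - w t)) \<longlonglongrightarrow> 0"
proof -
  define F where "F n j = ivl_deriv a b j (\<sigma> n)" for n j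
  note R = frac_reprD[OF \<sigma>, folded F_def]
  have bound: "norm (F m j t - F n j t) \<le> frac_norm k a b (\<lambda>t. \<sigma> m t - \<sigma> n t) (\<lambda>t. v m t - v n t)"
    "norm (v m t - v n t) \<le> frac_norm k a b (\<lambda>t. \<sigma> m t - \<sigma> n t) (\<lambda>t. v m t - v n t)"
    if "j \<le> k" "t \<in> {a..b}" for m n j t
  proof -
    have e: "ivl_deriv a b j (\<lambda>t. \<sigma> m t - \<sigma> n t) t = F m j t - F n j t"
      unfolding F_def by (rule ivl_deriv_diff[OF ab frac_reprD(1)[OF \<sigma>] frac_reprD(1)[OF \<sigma>] that])
    show "norm (F m j t - F n j t) \<le> frac_norm k a b (\<lambda>t. \<sigma> m t - \<sigma> n t) (\<lambda>t. v m t - v n t)"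
      using frac_norm_le(1)[OF frac_repr_diff[OF ab \<beta> \<sigma>[of m] \<sigma>[of n]] ab that] by (simp only: e)
    show "norm (v m t - v n t) \<le> frac_norm k a b (\<lambda>t. \<sigma> m t - \<sigma> n t) (\<lambda>t. v m t - v n t)"
      by (rule frac_norm_le(2)[OF frac_repr_diff[OF ab \<beta> \<sigma>[of m] \<sigma>[of n]] ab that])
  qed
  have "\<exists>l. uniform_limit {a..b} (\<lambda>n. F n j) l sequentially" if "j \<le> k" for j
  proof (rule uniform_limit_norm_diff)
    fix e :: real assume "e > 0"
    from Cauchy[OF this] show "\<exists>N. \<forall>m\<ge>N. \<forall>n\<ge>N. \<forall>t\<in>{a..b}. norm (F m j t - F n j t) \<le> e"
      using bound(1)[OF that] by (meson less_imp_le order_trans)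
  qed
  then have "\<forall>j. \<exists>l. j \<le> k \<longrightarrow> uniform_limit {a..b} (\<lambda>n. F n j) l sequentially" by blast
  from choice[OF this] obtain G where G: "\<And>j. j \<le> k \<Longrightarrow> uniform_limit {a..b} (\<lambda>n. F n j) (G j) sequentially" by blast
  have "\<exists>l. uniform_limit {a..b} v l sequentially"
  proof (rule uniform_limit_norm_diff)
    fix e :: real assume "e > 0"
    from Cauchy[OF this] show "\<exists>N. \<forall>m\<ge>N. \<forall>n\<ge>N. \<forall>t\<in>{a..b}. norm (v m t - v n t) \<le> e"
      using bound(2)[OF le0] by (meson less_imp_le order_trans)
  qed
  then obtain w where w: "uniform_limit {a..b} v w sequentially" by blast
  have Gc: "continuous_on {a..b} (G j)" if "j \<le> k" for j
    by (rule uniform_limit_theorem[OF _ G[OF that]]) (use R(6) that in auto)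
  have wc: "continuous_on {a..b} w"
    by (rule uniform_limit_theorem[OF _ w]) (use R(3) in auto)
  have lim: "(\<lambda>n. F n j t) \<longlonglongrightarrow> G j t" if "j \<le> k" "t \<in> {a..b}" for j t
    using tendsto_uniform_limitI[OF G] that by blast
  have mem: "a \<in> {a..b}" using ab by simp
  have Gk: "G k t = G k a + fint \<beta> a w t" if t: "t \<in> {a..b}" for t
  proof (rule LIMSEQ_unique[OF lim[OF order_refl t]])
    have "(\<lambda>n. F n k a + fint \<beta> a (v n) t) \<longlonglongrightarrow> G k a + fint \<beta> a w t"
      by (intro tendsto_add lim order_refl mem tendsto_fint_uniform_limit[where b = b] \<beta> R(3) w t)
    then show "(\<lambda>n. F n k t) \<longlonglongrightarrow> G k a + fint \<beta> a w t"
      by (rule Lim_transform_eventually) (use R(4)[OF t] in simp)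
  qed
  have chain: "deriv_chain k a b G"
    unfolding deriv_chain_def
  proof (intro conjI allI impI ballI)
    fix j t assume j: "j < k" and t: "t \<in> {a..b}"
    have jk: "j \<le> k" "Suc j \<le> k" using j by auto
    \<comment> \<open>The fundamental theorem holds for each member of the sequence; its limit says
      that \<open>G j\<close> is an antiderivative of \<open>G (Suc j)\<close>.\<close>
    have *: "G j s = G j a + fint 1 a (G (Suc j)) s" if s: "s \<in> {a..b}" for s
    proof (rule LIMSEQ_unique[OF lim[OF jk(1) s]])
      have "(\<lambda>n. F n j a + fint 1 a (F n (Suc j)) s) \<longlonglongrightarrow> G j a + fint 1 a (G (Suc j)) s"
        by (intro tendsto_add lim jk mem tendsto_fint_uniform_limit[where b = b] zero_less_one R(6) G s)
      moreover have "F n j a + fint 1 a (F n (Suc j)) s = F n j s" for n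
        by (rule fint_1_derivative[OF deriv_chainD[OF R(1) j] s, symmetric])
      ultimately show "(\<lambda>n. F n j s) \<longlonglongrightarrow> G j a + fint 1 a (G (Suc j)) s" by simp
    qed
    have "((\<lambda>t. G j a + fint 1 a (G (Suc j)) t) has_vector_derivative 0 + G (Suc j) t) (at t within {a..b})"
      by (intro has_vector_derivative_add has_vector_derivative_const has_vector_derivative_fint_1 Gc jk t)
    then have "(G j has_vector_derivative 0 + G (Suc j) t) (at t within {a..b})"
      by (rule has_vector_derivative_transform[OF t _, rotated]) (rule *)
    then show "(G j has_vector_derivative G (Suc j) t) (at t within {a..b})" by simp
  qed (rule Gc[OF order_refl])
  have Gz: "G j a = 0" if "z" "j \<le> k" for j
    using LIMSEQ_unique[OF lim[OF that(2) mem]] R(5)[OF that] by simp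
  define f where "f t = (if t \<in> {a..b} then G 0 t else 0)" for t
  have f12: "\<And>t. t \<in> {a..b} \<Longrightarrow> f t = G 0 t" "\<And>t. t \<notin> {a..b} \<Longrightarrow> f t = 0"
    unfolding f_def by auto
  have f: "frac_repr z \<beta> k a b f w"
    by (rule frac_reprI(1)[where F = G]; fact ab chain f12 wc Gk Gz)
  have fG: "ivl_deriv a b j f t = G j t" if "j \<le> k" "t \<in> {a..b}" for j t
    by (rule deriv_chain_ivl_deriv(2)[OF ab chain _ that]) (rule f12(1))
  have "(\<lambda>n. frac_norm k a b (\<lambda>t. \<sigma> n t - f t) (\<lambda>t. v n t - w t)) \<longlonglongrightarrow> 0"
  proof (rule LIMSEQ_I)
    fix r :: real assume r: "r > 0"
    \<comment> \<open>The norm is at most k + 2 times e; dividing by k + 3 keeps the final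
      inequality strict.\<close>
    define e where "e = r / (real k + 3)"
    have e: "e > 0" using r by (simp add: e_def)
    from Cauchy[OF this] obtain N where N: "\<And>m n. m \<ge> N \<Longrightarrow> n \<ge> N \<Longrightarrow> frac_norm k a b (\<lambda>t. \<sigma> m t - \<sigma> n t) (\<lambda>t. v m t - v n t) < e"
      by blast
    have "norm (frac_norm k a b (\<lambda>t. \<sigma> n t - f t) (\<lambda>t. v n t - w t) - 0) < r" if n: "n \<ge> N" for n
    proof -
      have rd: "frac_repr z \<beta> k a b (\<lambda>t. \<sigma> n t - f t) (\<lambda>t. v n t - w t)"
        by (rule frac_repr_diff[OF ab \<beta> \<sigma> f])
      have "frac_norm k a b (\<lambda>t. \<sigma> n t - f t) (\<lambda>t. v n t - w t) \<le> (real k + 2) * e"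
      proof (rule frac_norm_leI[OF ab])
        fix j t assume j: "j \<le> k" and t: "t \<in> {a..b}"
        have "ivl_deriv a b j (\<lambda>t. \<sigma> n t - f t) t = F n j t - G j t"
          unfolding F_def using ivl_deriv_diff[OF ab frac_reprD(1)[OF \<sigma>] frac_reprD(1)[OF f] j t] fG[OF j t] by simp
        moreover have "norm (F n j t - G j t) \<le> e"
        proof (rule LIMSEQ_le_const2)
          show "(\<lambda>m. norm (F n j t - F m j t)) \<longlonglongrightarrow> norm (F n j t - G j t)"
            by (intro tendsto_intros lim j t)
          show "\<exists>N. \<forall>m\<ge>N. norm (F n j t - F m j t) \<le> e"
            using bound(1)[OF j t, of n] N[OF n] by (meson less_imp_le order_trans)
        qed
        ultimately show "norm (ivl_deriv a b j (\<lambda>t. \<sigma> n t - f t) t) \<le> e" by simp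
      next
        fix t assume t: "t \<in> {a..b}"
        show "norm (v n t - w t) \<le> e"
        proof (rule LIMSEQ_le_const2)
          show "(\<lambda>m. norm (v n t - v m t)) \<longlonglongrightarrow> norm (v n t - w t)"
            by (intro tendsto_intros tendsto_uniform_limitI[OF w t])
          show "\<exists>N. \<forall>m\<ge>N. norm (v n t - v m t) \<le> e"
            using bound(2)[OF le0 t, of n] N[OF n] by (meson less_imp_le order_trans)
        qed
      qed
      also have "\<dots> < r" using r by (simp add: e_def field_simps)
      finally show ?thesis using frac_norm_le(3)[OF rd ab le0 mem] by simp
    qed
    then show "\<exists>N. \<forall>n\<ge>N. norm (frac_norm k a b (\<lambda>t. \<sigma> n t - f t) (\<lambda>t. v n t - w t) - 0) < r" by blast
  qed
  with f show ?thesis by blast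
qed

section \<open>Closure under multiplication\<close>

text \<open>Recursion on the number of derivatives makes the Leibniz rule a single induction step.
  One constant \<open>M\<close> bounds the function, its derivatives and the density, so only one
  number per factor has to be tracked.\<close>

primrec frac_bounded :: "nat \<Rightarrow> bool \<Rightarrow> real \<Rightarrow> real \<Rightarrow> real \<Rightarrow> (real \<Rightarrow> 'a::banach) \<Rightarrow> real \<Rightarrow> bool" where
  "frac_bounded 0 z \<beta> a b f M \<longleftrightarrow> (z \<longrightarrow> f a = 0) \<and> (\<forall>t\<in>{a..b}. norm (f t) \<le> M) \<and>
     (\<exists>u. continuous_on {a..b} u \<and> (\<forall>t\<in>{a..b}. norm (u t) \<le> M) \<and> (\<forall>t\<in>{a..b}. f t = f a + fint \<beta> a u t))"
| "frac_bounded (Suc k) z \<beta> a b f M \<longleftrightarrow> (z \<longrightarrow> f a = 0) \<and> (\<forall>t\<in>{a..b}. norm (f t) \<le> M) \<and>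
     (\<exists>f'. (\<forall>t\<in>{a..b}. (f has_vector_derivative f' t) (at t within {a..b})) \<and> frac_bounded k z \<beta> a b f' M)"

lemma frac_boundedD: "frac_bounded k z \<beta> a b f M \<Longrightarrow> t \<in> {a..b} \<Longrightarrow> norm (f t) \<le> M"
  by (cases k) auto

lemma frac_bounded_at_left: "frac_bounded k z \<beta> a b f M \<Longrightarrow> z \<Longrightarrow> f a = 0"
  by (cases k) auto

lemma frac_bounded_nonneg: "frac_bounded k z \<beta> a b f M \<Longrightarrow> a < b \<Longrightarrow> 0 \<le> M"
  using frac_boundedD[of k z \<beta> a b f M a] norm_ge_zero[of "f a"] by (simp del: norm_ge_zero)

lemma frac_bounded_mono: "frac_bounded k z \<beta> a b f M \<Longrightarrow> M \<le> N \<Longrightarrow> frac_bounded k z \<beta> a b f N"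
proof (induction k arbitrary: f)
  case 0
  then show ?case unfolding frac_bounded.simps(1) by (meson order_trans)
next
  case (Suc k)
  then show ?case unfolding frac_bounded.simps(2) by (meson order_trans)
qed

lemma frac_bounded_add:
  assumes \<beta>: "\<beta> > 0"
  shows "frac_bounded k z \<beta> a b f M \<Longrightarrow> frac_bounded k z \<beta> a b g N \<Longrightarrow> frac_bounded k z \<beta> a b (\<lambda>t. f t + g t) (M + N)"
proof (induction k arbitrary: f g)
  case 0
  then obtain u w where u: "continuous_on {a..b} u" "\<forall>t\<in>{a..b}. norm (u t) \<le> M" "\<forall>t\<in>{a..b}. f t = f a + fint \<beta> a u t"
    and w: "continuous_on {a..b} w" "\<forall>t\<in>{a..b}. norm (w t) \<le> N" "\<forall>t\<in>{a..b}. g t = g a + fint \<beta> a w t"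
    unfolding frac_bounded.simps(1) by blast
  have "f t + g t = f a + g a + fint \<beta> a (\<lambda>t. u t + w t) t" if t: "t \<in> {a..b}" for t
  proof -
    have "fint \<beta> a (\<lambda>t. u t + w t) t = fint \<beta> a u t + fint \<beta> a w t"
      using t by (intro fint_add \<beta> continuous_on_subset[OF u(1)] continuous_on_subset[OF w(1)]) auto
    then show ?thesis using bspec[OF u(3) t] bspec[OF w(3) t] by simp
  qed
  moreover have "continuous_on {a..b} (\<lambda>t. u t + w t)" using u w by (intro continuous_intros)
  moreover have "\<forall>t\<in>{a..b}. norm (u t + w t) \<le> M + N" using u w by (auto intro: norm_triangle_mono)
  moreover have "\<forall>t\<in>{a..b}. norm (f t + g t) \<le> M + N"
    using frac_boundedD[OF 0(1)] frac_boundedD[OF 0(2)] by (auto intro: norm_triangle_mono)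
  moreover have "z \<longrightarrow> f a + g a = 0" using 0 by simp
  ultimately show ?case unfolding frac_bounded.simps(1) by blast
next
  case (Suc k)
  then obtain f' g' where f': "\<And>t. t \<in> {a..b} \<Longrightarrow> (f has_vector_derivative f' t) (at t within {a..b})" "frac_bounded k z \<beta> a b f' M"
    and g': "\<And>t. t \<in> {a..b} \<Longrightarrow> (g has_vector_derivative g' t) (at t within {a..b})" "frac_bounded k z \<beta> a b g' N"
    unfolding frac_bounded.simps(2) by blast
  have "\<forall>t\<in>{a..b}. ((\<lambda>t. f t + g t) has_vector_derivative f' t + g' t) (at t within {a..b})"
    using f' g' by (auto intro: has_vector_derivative_add)
  moreover have "frac_bounded k z \<beta> a b (\<lambda>t. f' t + g' t) (M + N)" using f' g' by (intro Suc.IH)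
  moreover have "\<forall>t\<in>{a..b}. norm (f t + g t) \<le> M + N"
    using frac_boundedD[OF Suc.prems(1)] frac_boundedD[OF Suc.prems(2)] by (auto intro: norm_triangle_mono)
  moreover have "z \<longrightarrow> f a + g a = 0" using Suc.prems by simp
  ultimately show ?case unfolding frac_bounded.simps(2) by (intro conjI exI[of _ "\<lambda>t. f' t + g' t"])
qed

text \<open>The density is \<open>J^(1-\<beta>)\<close> of \<open>g\<close>, by the semigroup law.
  \<open>C \<ge> 1\<close> lets the same constant also enlarge the bounds on the function
  itself.\<close>

lemma fint_1_as_fint:
  fixes g :: "real \<Rightarrow> 'a::banach"
  assumes ab: "a < b" and \<beta>: "0 < \<beta>" "\<beta> \<le> 1"
  obtains C where "C \<ge> 1" "\<And>(g :: real \<Rightarrow> 'a) M. continuous_on {a..b} g \<Longrightarrow> (\<forall>t\<in>{a..b}. norm (g t) \<le> M) \<Longrightarrow>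
    \<exists>u. continuous_on {a..b} u \<and> (\<forall>t\<in>{a..b}. norm (u t) \<le> C * M) \<and> (\<forall>t\<in>{a..b}. fint 1 a g t = fint \<beta> a u t)"
proof (cases "\<beta> = 1")
  case True
  show ?thesis by (rule that[of 1]) (use True in auto)
next
  case False
  define C where "C = max 1 ((b - a) powr (1 - \<beta>) / Gamma (1 - \<beta> + 1))"
  show ?thesis
  proof (rule that[of C])
    show "C \<ge> 1" by (simp add: C_def)
    fix g :: "real \<Rightarrow> 'a" and M
    assume g: "continuous_on {a..b} g" and M: "\<forall>t\<in>{a..b}. norm (g t) \<le> M"
    have M0: "M \<ge> 0" using bspec[OF M, of a] ab by (auto intro: order_trans[OF norm_ge_zero])
    show "\<exists>u. continuous_on {a..b} u \<and> (\<forall>t\<in>{a..b}. norm (u t) \<le> C * M) \<and> (\<forall>t\<in>{a..b}. fint 1 a g t = fint \<beta> a u t)"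
    proof (intro exI[of _ "fint (1 - \<beta>) a g"] conjI ballI)
      show "continuous_on {a..b} (fint (1 - \<beta>) a g)" using False \<beta> ab g by (intro continuous_on_fint) auto
      fix t assume t: "t \<in> {a..b}"
      have "norm (fint (1 - \<beta>) a g t) \<le> (b - a) powr (1 - \<beta>) / Gamma (1 - \<beta> + 1) * M"
        using False \<beta> M by (intro norm_fint_le_interval[OF _ g _ t]) auto
      also have "\<dots> \<le> C * M" using M0 by (intro mult_right_mono) (auto simp: C_def)
      finally show "norm (fint (1 - \<beta>) a g t) \<le> C * M" .
      show "fint 1 a g t = fint \<beta> a (fint (1 - \<beta>) a g) t"
        using fint_fint[of \<beta> "1 - \<beta>" a b g t] False \<beta> g t by simp
    qed
  qed
qed

lemma frac_bounded_continuous: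
  assumes "a < b" "\<beta> > 0"
  shows "frac_bounded k z \<beta> a b f M \<Longrightarrow> continuous_on {a..b} f"
proof (cases k)
  case 0
  assume "frac_bounded k z \<beta> a b f M"
  then obtain u where u: "continuous_on {a..b} u" "\<And>t. t \<in> {a..b} \<Longrightarrow> f t = f a + fint \<beta> a u t"
    unfolding 0 frac_bounded.simps(1) by blast
  have "continuous_on {a..b} (\<lambda>t. f a + fint \<beta> a u t)"
    using assms u by (intro continuous_intros continuous_on_fint) auto
  then show ?thesis by (rule continuous_on_eq) (rule u(2)[symmetric])
next
  case (Suc n)
  assume "frac_bounded k z \<beta> a b f M"
  then obtain f' where "\<And>t. t \<in> {a..b} \<Longrightarrow> (f has_vector_derivative f' t) (at t within {a..b})"
    unfolding Suc frac_bounded.simps(2) by blast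
  then show ?thesis by (rule continuous_on_vector_derivative)
qed

text \<open>Needed for the Leibniz rule, whose terms pair a function with k + 1 derivatives and one
  with k. Only the innermost level changes: there an ordinary integral is rewritten as a fractional
  one.\<close>

lemma frac_bounded_Suc_imp:
  assumes ab: "a < b" and \<beta>: "0 < \<beta>" "\<beta> \<le> 1"
  shows "\<exists>C\<ge>1. \<forall>(f :: real \<Rightarrow> 'a::banach) M. frac_bounded (Suc k) z \<beta> a b f M \<longrightarrow> frac_bounded k z \<beta> a b f (C * M)"
proof (induction k)
  case 0
  obtain C where C: "C \<ge> 1" "\<And>(g :: real \<Rightarrow> 'a) M. continuous_on {a..b} g \<Longrightarrow> (\<forall>t\<in>{a..b}. norm (g t) \<le> M) \<Longrightarrow>
    \<exists>u. continuous_on {a..b} u \<and> (\<forall>t\<in>{a..b}. norm (u t) \<le> C * M) \<and> (\<forall>t\<in>{a..b}. fint 1 a g t = fint \<beta> a u t)"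
    by (fact fint_1_as_fint[OF ab \<beta>])
  have "frac_bounded 0 z \<beta> a b f (C * M)" if f: "frac_bounded (Suc 0) z \<beta> a b f M" for f :: "real \<Rightarrow> 'a" and M
  proof -
    obtain f' where f': "\<And>t. t \<in> {a..b} \<Longrightarrow> (f has_vector_derivative f' t) (at t within {a..b})" "frac_bounded 0 z \<beta> a b f' M"
      using f unfolding frac_bounded.simps(2) by blast
    have "\<forall>t\<in>{a..b}. norm (f' t) \<le> M" using frac_boundedD[OF f'(2)] by blast
    from C(2)[OF frac_bounded_continuous[OF ab \<beta>(1) f'(2)] this]
    obtain u where u: "continuous_on {a..b} u" "\<forall>t\<in>{a..b}. norm (u t) \<le> C * M" "\<forall>t\<in>{a..b}. fint 1 a f' t = fint \<beta> a u t"
      by blast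
    have "\<forall>t\<in>{a..b}. f t = f a + fint \<beta> a u t"
    proof
      fix t assume t: "t \<in> {a..b}"
      show "f t = f a + fint \<beta> a u t" using fint_1_derivative[OF f'(1) t] bspec[OF u(3) t] by simp
    qed
    moreover have "M \<le> C * M" using mult_right_mono[OF C(1) frac_bounded_nonneg[OF f ab]] by simp
    then have "\<forall>t\<in>{a..b}. norm (f t) \<le> C * M" using frac_boundedD[OF f] order_trans by blast
    moreover have "z \<longrightarrow> f a = 0" using frac_bounded_at_left[OF f] by blast
    ultimately show ?thesis unfolding frac_bounded.simps(1) using u by blast
  qed
  with C(1) show ?case by blast
next
  case (Suc k)
  then obtain C where C: "C \<ge> 1" "\<And>(f :: real \<Rightarrow> 'a) M. frac_bounded (Suc k) z \<beta> a b f M \<Longrightarrow> frac_bounded k z \<beta> a b f (C * M)"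
    by blast
  have "frac_bounded (Suc k) z \<beta> a b f (C * M)" if f: "frac_bounded (Suc (Suc k)) z \<beta> a b f M" for f :: "real \<Rightarrow> 'a" and M
  proof -
    obtain f' where f': "\<forall>t\<in>{a..b}. (f has_vector_derivative f' t) (at t within {a..b})" "frac_bounded (Suc k) z \<beta> a b f' M"
      using f unfolding frac_bounded.simps(2)[of "Suc k"] by blast
    have "M \<le> C * M" using mult_right_mono[OF C(1) frac_bounded_nonneg[OF f ab]] by simp
    then have "\<forall>t\<in>{a..b}. norm (f t) \<le> C * M" using frac_boundedD[OF f] order_trans by blast
    moreover have "z \<longrightarrow> f a = 0" using frac_bounded_at_left[OF f] by blast
    ultimately show ?thesis unfolding frac_bounded.simps(2)[of k] using f'(1) C(2)[OF f'(2)] by blast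
  qed
  with C(1) show ?case by blast
qed

text \<open>The base case multiplies two sums of a constant and a fractional integral; constants
  pass under the integral by linearity, and \<open>fint_mult\<close> treats the remaining product.
  The induction step is the Leibniz rule after lowering the smoother factors.\<close>

lemma frac_bounded_mult:
  fixes mul :: "'a::banach \<Rightarrow> 'a \<Rightarrow> 'a"
  assumes ab: "a < b" and \<beta>: "0 < \<beta>" "\<beta> \<le> 1" and mul: "bounded_bilinear mul"
  shows "\<exists>C\<ge>0. \<forall>f g M N. frac_bounded k z \<beta> a b f M \<longrightarrow> frac_bounded k z \<beta> a b g N \<longrightarrow>
    frac_bounded k z \<beta> a b (\<lambda>t. mul (f t) (g t)) (C * (M * N))"
proof -
  interpret mul: bounded_bilinear mul by fact
  obtain B where B0: "B > 0" and "\<And>x y. norm (mul x y) \<le> norm x * norm y * B" using mul.pos_bounded by blast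
  then have B: "norm (mul x y) \<le> B * (X * Y)" if "norm x \<le> X" "norm y \<le> Y" for x y X Y
  proof -
    have "norm x * norm y * B \<le> X * Y * B"
      using that B0 by (intro mult_right_mono mult_mono) (auto intro: order_trans[OF norm_ge_zero])
    then show ?thesis using \<open>norm (mul x y) \<le> norm x * norm y * B\<close> by (simp add: mult_ac)
  qed
  show ?thesis
  proof (induction k)
    case 0
    obtain K where K0: "K \<ge> 0" and K: "\<And>u w U W. continuous_on {a..b} u \<Longrightarrow> continuous_on {a..b} w \<Longrightarrow>
       (\<forall>t\<in>{a..b}. norm (u t) \<le> U) \<Longrightarrow> (\<forall>t\<in>{a..b}. norm (w t) \<le> W) \<Longrightarrow>
       \<exists>y. continuous_on {a..b} y \<and> (\<forall>t\<in>{a..b}. mul (fint \<beta> a u t) (fint \<beta> a w t) = fint \<beta> a y t) \<and>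
         (\<forall>t\<in>{a..b}. norm (y t) \<le> K * (U * W))"
      using fint_mult[OF \<beta> mul ab] by blast
    \<comment> \<open>\<open>B\<close> for each of the two terms in which one factor is evaluated at
      a, and \<open>K\<close> for the product of the fractional integrals.\<close>
    define C where "C = 2 * B + K"
    have C: "C \<ge> 0" "B \<le> C" using K0 B0 by (auto simp: C_def)
    have "frac_bounded 0 z \<beta> a b (\<lambda>t. mul (f t) (g t)) (C * (M * N))"
      if f: "frac_bounded 0 z \<beta> a b f M" and g: "frac_bounded 0 z \<beta> a b g N" for f g M N
    proof -
      obtain u where u: "continuous_on {a..b} u" "\<forall>t\<in>{a..b}. norm (u t) \<le> M" "\<forall>t\<in>{a..b}. f t = f a + fint \<beta> a u t"
        using f unfolding frac_bounded.simps(1) by blast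
      obtain w where w: "continuous_on {a..b} w" "\<forall>t\<in>{a..b}. norm (w t) \<le> N" "\<forall>t\<in>{a..b}. g t = g a + fint \<beta> a w t"
        using g unfolding frac_bounded.simps(1) by blast
      obtain y where y: "continuous_on {a..b} y" "\<forall>t\<in>{a..b}. mul (fint \<beta> a u t) (fint \<beta> a w t) = fint \<beta> a y t"
         "\<forall>t\<in>{a..b}. norm (y t) \<le> K * (M * N)"
        using K[OF u(1) w(1) u(2) w(2)] by blast
      have MN: "M \<ge> 0" "N \<ge> 0" using frac_bounded_nonneg[OF f ab] frac_bounded_nonneg[OF g ab] by auto
      \<comment> \<open>The density of the product minus its value at a, read off from expanding
        (f(a) + J u)(g(a) + J w).\<close>
      define q where "q t = mul (f a) (w t) + (mul (u t) (g a) + y t)" for t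
      have c: "continuous_on {a..b} (\<lambda>t. mul (f a) (w t))" "continuous_on {a..b} (\<lambda>t. mul (u t) (g a))"
        using u(1) w(1) by (auto intro!: mul.continuous_on continuous_intros)
      have qc: "continuous_on {a..b} q"
        unfolding q_def using y c by (intro continuous_intros)
      have bounds: "norm (f t) \<le> M" "norm (g t) \<le> N" "norm (u t) \<le> M" "norm (w t) \<le> N" "norm (y t) \<le> K * (M * N)"
        if "t \<in> {a..b}" for t
        using frac_boundedD[OF f that] frac_boundedD[OF g that] u(2) w(2) y(3) that by auto
      have mem: "a \<in> {a..b}" using ab by simp
      have "norm (q t) \<le> C * (M * N)" if t: "t \<in> {a..b}" for t
      proof -
        have "norm (q t) \<le> B * (M * N) + (B * (M * N) + K * (M * N))"
          unfolding q_def by (intro norm_triangle_mono B bounds t mem)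
        also have "\<dots> = C * (M * N)" by (simp add: C_def algebra_simps)
        finally show ?thesis .
      qed
      moreover have "norm (mul (f t) (g t)) \<le> C * (M * N)" if t: "t \<in> {a..b}" for t
      proof -
        have "norm (mul (f t) (g t)) \<le> B * (M * N)" by (intro B bounds t)
        also have "\<dots> \<le> C * (M * N)" using C MN by (intro mult_right_mono) auto
        finally show ?thesis .
      qed
      moreover have "mul (f t) (g t) = mul (f a) (g a) + fint \<beta> a q t" if t: "t \<in> {a..b}" for t
      proof -
        have sub: "continuous_on {a..b} h \<Longrightarrow> continuous_on {a..t} h" for h :: "real \<Rightarrow> 'a"
          using t by (auto intro: continuous_on_subset)
        have "fint \<beta> a q t = fint \<beta> a (\<lambda>t. mul (f a) (w t)) t + fint \<beta> a (\<lambda>t. mul (u t) (g a) + y t) t"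
          unfolding q_def using y c by (intro fint_add \<beta> sub continuous_intros)
        also have "fint \<beta> a (\<lambda>t. mul (u t) (g a) + y t) t = fint \<beta> a (\<lambda>t. mul (u t) (g a)) t + fint \<beta> a y t"
          using y c by (intro fint_add \<beta> sub)
        also have "fint \<beta> a (\<lambda>t. mul (f a) (w t)) t = mul (f a) (fint \<beta> a w t)"
          by (intro fint_linear \<beta> sub w mul.bounded_linear_right)
        also have "fint \<beta> a (\<lambda>t. mul (u t) (g a)) t = mul (fint \<beta> a u t) (g a)"
          by (rule fint_linear[OF \<beta>(1) sub[OF u(1)] mul.bounded_linear_left])
        finally have q: "fint \<beta> a q t = mul (f a) (fint \<beta> a w t) + (mul (fint \<beta> a u t) (g a) + fint \<beta> a y t)" .
        have "mul (f t) (g t) = mul (f a + fint \<beta> a u t) (g a + fint \<beta> a w t)"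
          using bspec[OF u(3) t] bspec[OF w(3) t] by simp
        then show ?thesis using y(2) t by (simp add: q mul.add_left mul.add_right)
      qed
      moreover have "z \<longrightarrow> mul (f a) (g a) = 0" using frac_bounded_at_left[OF f] by (simp add: mul.zero_left)
      ultimately show ?thesis unfolding frac_bounded.simps(1) using qc by blast
    qed
    then show ?case using C by blast
  next
    case (Suc k)
    then obtain C where C0: "C \<ge> 0" and C: "\<And>f g M N. frac_bounded k z \<beta> a b f M \<Longrightarrow> frac_bounded k z \<beta> a b g N \<Longrightarrow>
      frac_bounded k z \<beta> a b (\<lambda>t. mul (f t) (g t)) (C * (M * N))" by blast
    obtain D where D1: "D \<ge> 1" and D: "\<And>(f :: real \<Rightarrow> 'a) M. frac_bounded (Suc k) z \<beta> a b f M \<Longrightarrow> frac_bounded k z \<beta> a b f (D * M)"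
      using frac_bounded_Suc_imp[OF ab \<beta>] by blast
    \<comment> \<open>Each of the two Leibniz terms costs \<open>C\<close>, and its undifferentiated
      factor costs \<open>D\<close>; the summand \<open>B\<close> bounds the product itself.\<close>
    define C' where "C' = 2 * C * D + B"
    have C': "C' \<ge> 0" "B \<le> C'" "2 * C * D \<le> C'" using C0 D1 B0 by (auto simp: C'_def)
    have "frac_bounded (Suc k) z \<beta> a b (\<lambda>t. mul (f t) (g t)) (C' * (M * N))"
      if f: "frac_bounded (Suc k) z \<beta> a b f M" and g: "frac_bounded (Suc k) z \<beta> a b g N" for f g M N
    proof -
      have MN: "M \<ge> 0" "N \<ge> 0" using frac_bounded_nonneg[OF f ab] frac_bounded_nonneg[OF g ab] by auto
      obtain f' where f': "\<forall>t\<in>{a..b}. (f has_vector_derivative f' t) (at t within {a..b})" "frac_bounded k z \<beta> a b f' M"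
        using f unfolding frac_bounded.simps(2) by blast
      obtain g' where g': "\<forall>t\<in>{a..b}. (g has_vector_derivative g' t) (at t within {a..b})" "frac_bounded k z \<beta> a b g' N"
        using g unfolding frac_bounded.simps(2) by blast
      have "\<forall>t\<in>{a..b}. ((\<lambda>t. mul (f t) (g t)) has_vector_derivative mul (f t) (g' t) + mul (f' t) (g t)) (at t within {a..b})"
        using f'(1) g'(1) by (auto intro!: mul.has_vector_derivative)
      moreover have "frac_bounded k z \<beta> a b (\<lambda>t. mul (f t) (g' t) + mul (f' t) (g t)) (C' * (M * N))"
      proof (rule frac_bounded_mono)
        show "frac_bounded k z \<beta> a b (\<lambda>t. mul (f t) (g' t) + mul (f' t) (g t)) (C * ((D * M) * N) + C * (M * (D * N)))"
          by (intro frac_bounded_add \<beta> C D f g f' g')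
        have "C * ((D * M) * N) + C * (M * (D * N)) = 2 * C * D * (M * N)" by simp
        also have "\<dots> \<le> C' * (M * N)" using C' MN by (intro mult_right_mono) auto
        finally show "C * ((D * M) * N) + C * (M * (D * N)) \<le> C' * (M * N)" .
      qed
      moreover have "\<forall>t\<in>{a..b}. norm (mul (f t) (g t)) \<le> C' * (M * N)"
      proof
        fix t assume t: "t \<in> {a..b}"
        have "norm (mul (f t) (g t)) \<le> B * (M * N)" by (intro B frac_boundedD[OF f t] frac_boundedD[OF g t])
        also have "\<dots> \<le> C' * (M * N)" using C' MN by (intro mult_right_mono) auto
        finally show "norm (mul (f t) (g t)) \<le> C' * (M * N)" .
      qed
      moreover have "z \<longrightarrow> mul (f a) (g a) = 0" using frac_bounded_at_left[OF f] by (simp add: mul.zero_left)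
      ultimately show ?thesis unfolding frac_bounded.simps(2)
        by (intro conjI exI[of _ "\<lambda>t. mul (f t) (g' t) + mul (f' t) (g t)"])
    qed
    then show ?case using C'(1) by blast
  qed
qed

section \<open>Passage between bounded recursion and represented functions\<close>

lemma frac_bounded_chain:
  assumes "deriv_chain k a b F" "continuous_on {a..b} v" "\<forall>t\<in>{a..b}. F k t = F k a + fint \<beta> a v t"
    and "\<forall>j\<le>k. \<forall>t\<in>{a..b}. norm (F j t) \<le> M" "\<forall>t\<in>{a..b}. norm (v t) \<le> M" "\<forall>j\<le>k. z \<longrightarrow> F j a = 0"
  shows "frac_bounded k z \<beta> a b (F 0) M"
  using assms
proof (induction k arbitrary: F)
  case 0
  then show ?case unfolding frac_bounded.simps(1) by blast
next
  case (Suc k)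
  have "frac_bounded k z \<beta> a b (F (Suc 0)) M"
    by (rule Suc.IH[OF deriv_chain_Suc[OF Suc.prems(1)]]) (use Suc.prems in blast)+
  moreover have "\<forall>t\<in>{a..b}. (F 0 has_vector_derivative F (Suc 0) t) (at t within {a..b})"
    using deriv_chainD[OF Suc.prems(1)] by blast
  moreover have "\<forall>t\<in>{a..b}. norm (F 0 t) \<le> M" "z \<longrightarrow> F 0 a = 0" using Suc.prems(4,6) by blast+
  ultimately show ?case unfolding frac_bounded.simps(2) by blast
qed

lemma frac_bounded_imp_chain:
  assumes ab: "a < b" and \<beta>: "\<beta> > 0"
  shows "frac_bounded k z \<beta> a b f M \<Longrightarrow> \<exists>F v. F 0 = f \<and> deriv_chain k a b F \<and> continuous_on {a..b} v \<and>
     (\<forall>t\<in>{a..b}. F k t = F k a + fint \<beta> a v t) \<and> (\<forall>j\<le>k. \<forall>t\<in>{a..b}. norm (F j t) \<le> M) \<and>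
     (\<forall>t\<in>{a..b}. norm (v t) \<le> M) \<and> (\<forall>j\<le>k. z \<longrightarrow> F j a = 0)"
proof (induction k arbitrary: f)
  case 0
  then obtain u where u: "continuous_on {a..b} u" "\<forall>t\<in>{a..b}. norm (u t) \<le> M" "\<forall>t\<in>{a..b}. f t = f a + fint \<beta> a u t"
    unfolding frac_bounded.simps(1) by blast
  have "deriv_chain 0 a b (\<lambda>_. f)" using frac_bounded_continuous[OF ab \<beta> 0] by (simp add: deriv_chain_def)
  moreover have "\<forall>t\<in>{a..b}. norm (f t) \<le> M" "z \<longrightarrow> f a = 0" using 0 by auto
  ultimately show ?case using u by (intro exI[of _ "\<lambda>_. f"] exI[of _ u] conjI) blast+
next
  case (Suc k)
  then obtain f' where f': "\<forall>t\<in>{a..b}. (f has_vector_derivative f' t) (at t within {a..b})" "frac_bounded k z \<beta> a b f' M"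
    unfolding frac_bounded.simps(2) by blast
  from Suc.IH[OF f'(2)] obtain F v where F: "F 0 = f'" "deriv_chain k a b F" "continuous_on {a..b} v"
     "\<forall>t\<in>{a..b}. F k t = F k a + fint \<beta> a v t" "\<forall>j\<le>k. \<forall>t\<in>{a..b}. norm (F j t) \<le> M"
     "\<forall>t\<in>{a..b}. norm (v t) \<le> M" "\<forall>j\<le>k. z \<longrightarrow> F j a = 0" by blast
  define G where "G j = (case j of 0 \<Rightarrow> f | Suc i \<Rightarrow> F i)" for j
  have G: "G 0 = f" "\<And>i. G (Suc i) = F i" by (auto simp: G_def)
  have chain: "deriv_chain (Suc k) a b G"
    unfolding deriv_chain_def
  proof (intro conjI allI impI)
    show "continuous_on {a..b} (G (Suc k))" using deriv_chain_continuous[OF F(2) order_refl] by (simp add: G)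
    fix j assume j: "j < Suc k"
    show "\<forall>t\<in>{a..b}. (G j has_vector_derivative G (Suc j) t) (at t within {a..b})"
    proof (cases j)
      case 0
      then show ?thesis using f'(1) by (simp add: G F(1))
    next
      case (Suc i)
      then show ?thesis using F(2) j by (simp add: G deriv_chain_def)
    qed
  qed
  have 1: "norm (G j t) \<le> M" if "j \<le> Suc k" "t \<in> {a..b}" for j t
    using that F(5) frac_boundedD[OF Suc.prems that(2)] by (cases j) (auto simp: G)
  have 2: "G j a = 0" if "j \<le> Suc k" "z" for j
    using that F(7) frac_bounded_at_left[OF Suc.prems that(2)] by (cases j) (auto simp: G)
  have 3: "\<forall>t\<in>{a..b}. G (Suc k) t = G (Suc k) a + fint \<beta> a v t" unfolding G(2) by (rule F(4))
  show ?case
    by (rule exI[of _ G], rule exI[of _ v]) (intro conjI G(1) chain F(3) 3 F(6) allI ballI impI 1 2; assumption)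
qed

lemma frac_repr_imp_bounded:
  assumes ab: "a < b" and f: "frac_repr z \<beta> k a b f v"
  shows "frac_bounded k z \<beta> a b f (frac_norm k a b f v)"
proof -
  have "frac_bounded k z \<beta> a b (ivl_deriv a b 0 f) (frac_norm k a b f v)"
    using frac_reprD[OF f] frac_norm_le[OF f ab] by (intro frac_bounded_chain) blast+
  then show ?thesis by simp
qed

lemma frac_bounded_imp_repr:
  assumes ab: "a < b" and \<beta>: "\<beta> > 0" and f: "frac_bounded k z \<beta> a b f M" and out: "\<And>t. t \<notin> {a..b} \<Longrightarrow> f t = 0"
  shows "\<exists>v. frac_repr z \<beta> k a b f v \<and> frac_norm k a b f v \<le> (real k + 2) * M"
proof -
  from frac_bounded_imp_chain[OF ab \<beta> f] obtain F v where F: "F 0 = f" "deriv_chain k a b F" "continuous_on {a..b} v"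
     "\<And>t. t \<in> {a..b} \<Longrightarrow> F k t = F k a + fint \<beta> a v t" "\<And>j t. j \<le> k \<Longrightarrow> t \<in> {a..b} \<Longrightarrow> norm (F j t) \<le> M"
     "\<And>t. t \<in> {a..b} \<Longrightarrow> norm (v t) \<le> M" "\<And>j. z \<Longrightarrow> j \<le> k \<Longrightarrow> F j a = 0" by blast
  have fF: "\<And>t. t \<in> {a..b} \<Longrightarrow> f t = F 0 t" by (simp add: F(1))
  have "frac_repr z \<beta> k a b f v"
    by (rule frac_reprI(1)[where F = F]; fact ab F(2) fF out F(3) F(4) F(7))
  moreover have "frac_norm k a b f v \<le> (real k + 2) * M"
  proof (rule frac_norm_leI[OF ab])
    fix j t assume "j \<le> k" "t \<in> {a..b}"
    then show "norm (ivl_deriv a b j f t) \<le> M"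
      using deriv_chain_ivl_deriv(2)[OF ab F(2) fF] F(5) by simp
  qed (rule F(6))
  ultimately show ?thesis by blast
qed

section \<open>The Banach algebras\<close>

text \<open>The analysis sees only the real structure; compatibility of \<open>scale\<close> with
  \<open>of_real\<close> makes the multiplication bilinear over the reals.\<close>

lemma banach_algebra_bounded_bilinear:
  fixes scale :: "'k::real_normed_field \<Rightarrow> 'a::banach \<Rightarrow> 'a"
  assumes "banach_algebra scale UNIV mul norm" and real: "\<And>r x. scale (of_real r) x = r *\<^sub>R x"
  shows "bounded_bilinear mul"
proof -
  interpret A: banach_algebra scale UNIV mul norm by fact
  obtain K where K: "\<And>f g. norm (mul f g) \<le> K * norm f * norm g" using A.nrm_mul by auto
  show ?thesis
  proof
    show "mul (x + y) w = mul x w + mul y w" "mul w (x + y) = mul w x + mul w y" for x y w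
      by (simp_all add: A.mul_add_left A.mul_add_right)
    show "mul (r *\<^sub>R x) y = r *\<^sub>R mul x y" "mul x (r *\<^sub>R y) = r *\<^sub>R mul x y" for r x y
      unfolding real[symmetric] by (simp_all add: A.mul_scale_left A.mul_scale_right)
    show "\<exists>K. \<forall>x y. norm (mul x y) \<le> norm x * norm y * K"
      by (rule exI[of _ K]) (use K in \<open>simp add: mult_ac\<close>)
  qed
qed

lemma banach_algebra_bounded_linear_scale:
  fixes scale :: "'k::real_normed_field \<Rightarrow> 'a::banach \<Rightarrow> 'a"
  assumes "banach_algebra scale UNIV mul norm" and real: "\<And>r x. scale (of_real r) x = r *\<^sub>R x"
  shows "bounded_linear (scale c)"
proof -
  interpret A: banach_algebra scale UNIV mul norm by fact
  show ?thesis
  proof (rule bounded_linear_intro)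
    show "scale c (x + y) = scale c x + scale c y" for x y by (rule A.scale_right_distrib)
    show "scale c (r *\<^sub>R x) = r *\<^sub>R scale c x" for r x
      unfolding real[symmetric] by (simp add: mult.commute)
    show "norm (scale c x) \<le> norm x * norm c" for x by (simp add: A.nrm_scale mult.commute)
  qed
qed

text \<open>The norm \<open>N\<close> is prescribed through any representing density, which is
  consistent because densities are unique on [a, b]. Both spaces are instances, differing in
  \<open>z\<close>.\<close>

theorem banach_algebra_frac:
  fixes scale :: "'k::real_normed_field \<Rightarrow> 'a::banach \<Rightarrow> 'a"
  assumes ab: "a < b" and \<beta>: "0 < \<beta>" "\<beta> \<le> 1"
    and alg: "banach_algebra scale UNIV mul norm" and real: "\<And>r x. scale (of_real r) x = r *\<^sub>R x"
    and S: "\<And>f. f \<in> S \<longleftrightarrow> (\<exists>v. frac_repr z \<beta> k a b f v)"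
    and N: "\<And>f v. frac_repr z \<beta> k a b f v \<Longrightarrow> N f = frac_norm k a b f v"
  shows "banach_algebra (\<lambda>c f t. scale c (f t)) S (\<lambda>f g t. mul (f t) (g t)) N"
proof -
  interpret A: banach_algebra scale UNIV mul norm by fact
  note mul = banach_algebra_bounded_bilinear[OF alg real]
  note lin = banach_algebra_bounded_linear_scale[OF alg real]
  interpret mul: bounded_bilinear mul by (rule mul)
  have plus: "f + g = (\<lambda>t. f t + g t)" and minus: "f - g = (\<lambda>t. f t - g t)" and zero: "0 = (\<lambda>t::real. 0::'a)"
    for f g :: "real \<Rightarrow> 'a" by (auto simp: fun_eq_iff)
  interpret V: vector_space "\<lambda>c (f :: real \<Rightarrow> 'a) t. scale c (f t)"
    by unfold_locales (auto simp: fun_eq_iff A.scale_right_distrib A.scale_left_distrib)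
  obtain C where C0: "C \<ge> 0" and C: "\<And>f g M N. frac_bounded k z \<beta> a b f M \<Longrightarrow> frac_bounded k z \<beta> a b g N \<Longrightarrow>
      frac_bounded k z \<beta> a b (\<lambda>t. mul (f t) (g t)) (C * (M * N))"
    using frac_bounded_mult[OF ab \<beta> mul] by blast
  have prod: "\<exists>y. frac_repr z \<beta> k a b (\<lambda>t. mul (f t) (g t)) y \<and>
      frac_norm k a b (\<lambda>t. mul (f t) (g t)) y \<le> (real k + 2) * (C * (frac_norm k a b f v * frac_norm k a b g w))"
    if f: "frac_repr z \<beta> k a b f v" and g: "frac_repr z \<beta> k a b g w" for f g v w
    using frac_reprD(2)[OF f]
    by (intro frac_bounded_imp_repr ab \<beta> C frac_repr_imp_bounded f g) (simp add: mul.zero_left)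
  have add: "\<exists>y. frac_repr z \<beta> k a b (f + g) y" if "f \<in> S" "g \<in> S" for f g
    using that frac_repr_add(1)[OF ab \<beta>(1)] unfolding S plus by blast
  have scal: "frac_repr z \<beta> k a b (\<lambda>t. scale c (f t)) (\<lambda>t. scale c (v t))" if "frac_repr z \<beta> k a b f v" for c f v
    by (rule frac_repr_linear(1)[OF ab \<beta>(1) lin that])
  show ?thesis
  proof
    show "V.subspace S"
      unfolding V.subspace_def
    proof (intro conjI ballI allI)
      show "0 \<in> S" using frac_repr_zero[OF ab] unfolding S zero by blast
      show "f + g \<in> S" if "f \<in> S" "g \<in> S" for f g using add[OF that] unfolding S .
      show "(\<lambda>t. scale c (f t)) \<in> S" if "f \<in> S" for c f using that scal unfolding S by blast
    qed
  next
    fix f assume "f \<in> S"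
    then obtain v where v: "frac_repr z \<beta> k a b f v" unfolding S by blast
    show "0 \<le> N f" using frac_norm_le(3)[OF v ab le0, of a] ab N[OF v] by simp
    show "N f = 0 \<longleftrightarrow> f = 0" using frac_norm_eq_0_iff[OF ab \<beta>(1) v] N[OF v] by (simp add: zero)
    show "N (\<lambda>t. scale c (f t)) = norm c * N f" for c
      using frac_repr_linear(3)[OF ab \<beta>(1) lin v, of c "norm c"] N[OF v] N[OF scal[OF v]] by (simp add: A.nrm_scale)
    fix g assume "g \<in> S"
    then obtain w where w: "frac_repr z \<beta> k a b g w" unfolding S by blast
    show "N (f + g) \<le> N f + N g"
      unfolding plus N[OF v] N[OF w] N[OF frac_repr_add(1)[OF ab \<beta>(1) v w]] by (rule frac_repr_add(2)[OF ab \<beta>(1) v w])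
    show "(\<lambda>t. mul (f t) (g t)) \<in> S" using prod[OF v w] unfolding S by blast
  next
    fix \<sigma> :: "nat \<Rightarrow> real \<Rightarrow> 'a" assume \<sigma>: "\<And>n. \<sigma> n \<in> S" and Cauchy: "\<And>e. 0 < e \<Longrightarrow> \<exists>M. \<forall>m\<ge>M. \<forall>n\<ge>M. N (\<sigma> m - \<sigma> n) < e"
    have "\<forall>n. \<exists>v. frac_repr z \<beta> k a b (\<sigma> n) v" using \<sigma> unfolding S by blast
    from choice[OF this] obtain v where v: "\<And>n. frac_repr z \<beta> k a b (\<sigma> n) (v n)" by blast
    have N': "N (\<sigma> m - \<sigma> n) = frac_norm k a b (\<lambda>t. \<sigma> m t - \<sigma> n t) (\<lambda>t. v m t - v n t)" for m n
      unfolding minus by (rule N[OF frac_repr_diff[OF ab \<beta>(1) v v]])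
    have "\<exists>f w. frac_repr z \<beta> k a b f w \<and> (\<lambda>n. frac_norm k a b (\<lambda>t. \<sigma> n t - f t) (\<lambda>t. v n t - w t)) \<longlonglongrightarrow> 0"
      by (rule frac_repr_complete[where \<sigma> = \<sigma> and v = v]; fact ab \<beta>(1) v Cauchy[unfolded N'])
    then obtain f w where f: "frac_repr z \<beta> k a b f w"
      and lim: "(\<lambda>n. frac_norm k a b (\<lambda>t. \<sigma> n t - f t) (\<lambda>t. v n t - w t)) \<longlonglongrightarrow> 0" by blast
    have e: "N (\<sigma> n - f) = frac_norm k a b (\<lambda>t. \<sigma> n t - f t) (\<lambda>t. v n t - w t)" for n
      unfolding minus by (rule N[OF frac_repr_diff[OF ab \<beta>(1) v f]])
    have "f \<in> S" using f unfolding S by blast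
    then show "\<exists>f\<in>S. (\<lambda>n. N (\<sigma> n - f)) \<longlonglongrightarrow> 0"
      by (rule bexI[rotated]) (simp only: e lim)
  next
    \<comment> \<open>\<open>C\<close> may be 0, while the constant of a Banach algebra has to be
      positive.\<close>
    define K where "K = (real k + 2) * C + 1"
    have K: "K > 0" "(real k + 2) * C \<le> K" using C0 by (auto simp: K_def intro!: add_nonneg_pos)
    show "\<exists>K>0. \<forall>f\<in>S. \<forall>g\<in>S. N (\<lambda>t. mul (f t) (g t)) \<le> K * N f * N g"
    proof (intro exI[of _ K] conjI ballI K(1))
      fix f g assume "f \<in> S" "g \<in> S"
      then obtain v w where v: "frac_repr z \<beta> k a b f v" and w: "frac_repr z \<beta> k a b g w" unfolding S by blast
      from prod[OF v w] obtain y where y: "frac_repr z \<beta> k a b (\<lambda>t. mul (f t) (g t)) y"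
        "frac_norm k a b (\<lambda>t. mul (f t) (g t)) y \<le> (real k + 2) * (C * (frac_norm k a b f v * frac_norm k a b g w))" by blast
      have nn: "0 \<le> frac_norm k a b f v" "0 \<le> frac_norm k a b g w"
        using frac_norm_le(3)[OF v ab le0, of a] frac_norm_le(3)[OF w ab le0, of a] ab by auto
      have "N (\<lambda>t. mul (f t) (g t)) \<le> (real k + 2) * C * (N f * N g)"
        using y(2) unfolding N[OF y(1)] N[OF v] N[OF w] by (simp only: mult.assoc)
      also have "\<dots> \<le> K * (N f * N g)"
        using K nn by (intro mult_right_mono) (auto simp: N[OF v] N[OF w])
      finally show "N (\<lambda>t. mul (f t) (g t)) \<le> K * N f * N g" by (simp only: mult.assoc)
    qed
  qed (auto simp: fun_eq_iff A.mul_assoc A.mul_add_left A.mul_add_right A.mul_scale_left A.mul_scale_right)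
qed

section \<open>Identification of the two fractional spaces\<close>

lemma has_RL_deriv_iff_frac_repr:
  fixes f :: "real \<Rightarrow> 'a::banach"
  assumes ab: "a < b" and \<beta>: "0 < \<beta>" "\<beta> \<le> 1" and f: "f \<in> Ck_space k a b" and v: "continuous_on {a..b} v"
  shows "has_RL_deriv (real k + \<beta>) a b f v \<longleftrightarrow> frac_repr (\<beta> < 1) \<beta> k a b f v"
  using has_RL_deriv_iff[OF ab \<beta> _ v, of k "\<lambda>j. ivl_deriv a b j f"] f v
  by (auto simp: Ck_space_iff_deriv_chain frac_repr_def)

lemma has_caputo_deriv_iff_frac_repr:
  fixes f :: "real \<Rightarrow> 'a::banach"
  assumes ab: "a < b" and \<beta>: "0 < \<beta>" "\<beta> \<le> 1" and f: "f \<in> Ck_space k a b" and v: "continuous_on {a..b} v"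
  shows "has_caputo_deriv (real k + \<beta>) a b f v \<longleftrightarrow> frac_repr False \<beta> k a b f v"
  using has_caputo_deriv_iff[OF ab \<beta> v, of k f] f v
  by (auto simp: Ck_space_iff_deriv_chain frac_repr_def)

text \<open>\<open>P\<close> stands for either derivative relation. Whatever representative the
  choice operator picks, uniqueness of the density fixes its values on [a, b], the only ones that
  enter the supremum.\<close>

lemma frac_norm_some_deriv:
  fixes f :: "real \<Rightarrow> 'a::banach"
  assumes ab: "a < b" and \<beta>: "0 < \<beta>" and f: "frac_repr z \<beta> k a b f v"
    and P: "\<And>w. continuous_on {a..b} w \<Longrightarrow> P w \<longleftrightarrow> frac_repr z \<beta> k a b f w"
  shows "Ck_norm k a b f + (SUP t\<in>{a..b}. norm ((SOME w. continuous_on {a..b} w \<and> P w) t)) = frac_norm k a b f v"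
proof -
  define D where "D = (SOME w. continuous_on {a..b} w \<and> P w)"
  have "continuous_on {a..b} v \<and> P v" using f P frac_reprD(3)[OF f] by blast
  then have "continuous_on {a..b} D \<and> P D" unfolding D_def by (rule someI[of "\<lambda>w. continuous_on {a..b} w \<and> P w"])
  then have "frac_repr z \<beta> k a b f D" using P by blast
  then have "sup_norm a b D = sup_norm a b v"
    by (intro sup_norm_cong frac_repr_unique[OF ab \<beta> _ f])
  then show ?thesis by (simp add: frac_norm_def Ck_norm_def D_def[symmetric] sup_norm_def)
qed

theorem corollary28:
  fixes t0 t1 \<alpha> :: real
    and scale :: "'k::real_normed_field \<Rightarrow> 'a::banach \<Rightarrow> 'a"
    and mul :: "'a \<Rightarrow> 'a \<Rightarrow> 'a"
  assumes "t0 < t1" and "\<alpha> > 0"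
    and "banach_algebra scale UNIV mul norm"
    and "\<And>r x. scale (of_real r) x = r *\<^sub>R x"
  shows "banach_algebra (\<lambda>c f t. scale c (f t))
             (RL_space \<alpha> t0 t1) (\<lambda>f g t. mul (f t) (g t)) (RL_norm \<alpha> t0 t1) \<and>
         banach_algebra (\<lambda>c f t. scale c (f t))
             (caputo_space \<alpha> t0 t1) (\<lambda>f g t. mul (f t) (g t)) (caputo_norm \<alpha> t0 t1)"
proof -
  \<comment> \<open>The ceiling minus one, and not the floor: an integer \<alpha> thus gives \<beta>
    = 1 instead of 0, in accordance with the order of the classical space in the
    definitions.\<close>
  define k where "k = ceil_nat \<alpha> - 1"
  define \<beta> where "\<beta> = \<alpha> - real k"
  have "\<lceil>\<alpha>\<rceil> \<ge> 1" using \<open>\<alpha> > 0\<close> by simp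
  then have "1 \<le> ceil_nat \<alpha>" "real (ceil_nat \<alpha>) = of_int \<lceil>\<alpha>\<rceil>" by linarith+
  then have "real k = of_int \<lceil>\<alpha>\<rceil> - 1" by (simp add: k_def of_nat_diff)
  then have \<beta>: "0 < \<beta>" "\<beta> \<le> 1" unfolding \<beta>_def by linarith+
  have \<alpha>: "\<alpha> = real k + \<beta>" by (simp add: \<beta>_def)
  have k: "ceil_nat (real k + \<beta>) - 1 = k" using ceil_nat_eq[OF \<beta>] by simp
  note ab = \<open>t0 < t1\<close>
  have Ck: "f \<in> Ck_space k t0 t1" "continuous_on {t0..t1} v" if "frac_repr z \<beta> k t0 t1 f v" for z and f v :: "real \<Rightarrow> 'a"
    using that by (auto simp: frac_repr_def)
  have "banach_algebra (\<lambda>c f t. scale c (f t)) (RL_space \<alpha> t0 t1) (\<lambda>f g t. mul (f t) (g t)) (RL_norm \<alpha> t0 t1)"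
  proof (rule banach_algebra_frac[OF ab \<beta> assms(3,4)])
    show "f \<in> RL_space \<alpha> t0 t1 \<longleftrightarrow> (\<exists>v. frac_repr (\<beta> < 1) \<beta> k t0 t1 f v)" for f :: "real \<Rightarrow> 'a"
      unfolding RL_space_def \<alpha> k using has_RL_deriv_iff_frac_repr[OF ab \<beta>] Ck by blast
    show "RL_norm \<alpha> t0 t1 f = frac_norm k t0 t1 f v" if "frac_repr (\<beta> < 1) \<beta> k t0 t1 f v" for f v :: "real \<Rightarrow> 'a"
      unfolding RL_norm_def RL_deriv_def \<alpha> k
      by (rule frac_norm_some_deriv[OF ab \<beta>(1) that has_RL_deriv_iff_frac_repr[OF ab \<beta> Ck(1)[OF that]]])
  qed
  moreover have "banach_algebra (\<lambda>c f t. scale c (f t)) (caputo_space \<alpha> t0 t1) (\<lambda>f g t. mul (f t) (g t)) (caputo_norm \<alpha> t0 t1)"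
  proof (rule banach_algebra_frac[OF ab \<beta> assms(3,4)])
    show "f \<in> caputo_space \<alpha> t0 t1 \<longleftrightarrow> (\<exists>v. frac_repr False \<beta> k t0 t1 f v)" for f :: "real \<Rightarrow> 'a"
      unfolding caputo_space_def \<alpha> k using has_caputo_deriv_iff_frac_repr[OF ab \<beta>] Ck by blast
    show "caputo_norm \<alpha> t0 t1 f = frac_norm k t0 t1 f v" if "frac_repr False \<beta> k t0 t1 f v" for f v :: "real \<Rightarrow> 'a"
      unfolding caputo_norm_def caputo_deriv_def \<alpha> k
      by (rule frac_norm_some_deriv[OF ab \<beta>(1) that has_caputo_deriv_iff_frac_repr[OF ab \<beta> Ck(1)[OF that]]])
  qed
  ultimately show ?thesis ..
qed

end
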